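(* Let $V$ be an FI-module over a field of characteristic $0$. Then $V$ is finitely generated if and only if the sequence $\{V_n,\phi_n\}$ of $S_n$-representations is uniformly representation stable and each $V_n$ is finite-dimensional. In particular, for any finitely generated FI-module $V$ over a field of characteristic $0$ there are nonnegative integers $c_\lambda$, not depending on $n$, such that for all sufficiently large $n$ there is an isomorphism of $S_n$-representations $V_n\simeq\bigoplus_\lambda c_\lambda V(\lambda)_n$.
   Context: FI is the category of finite sets and injections; an FI-module over $k$ is a functor $V$ from FI to $k$-modules, $V_n=V(\{1,\dots,n\})$, an $S_n$-representation. $V$ is finitely generated if there is a finite set $\Sigma\subset\coprod_nV_n$ such that no proper sub-FI-module of $V$ contains $\Sigma$. $\phi_n\colon V_n\to V_{n+1}$ is the $S_n$-equivariant map induced by the standard inclusion $\{1,\dots,n\}\hookrightarrow\{1,\dots,n+1\}$. For a partition $\lambda=(\lambda_1\ge\cdots\ge\lambda_\ell>0)$ (possibly empty, with $\lambda_1=0$) and $n\ge|\lambda|+\lambda_1$, $V(\lambda)_n$ is the irreducible $S_n$-representation over the field corresponding to the partition $(n-|\lambda|,\lambda_1,\dots,\lambda_\ell)$ of $n$; every irreducible $S_n$-representation is $V(\lambda)_n$ for a unique $\lambda$. The sequence $\{V_n,\phi_n\}$ is uniformly representation stable if there is $N$ such that: (I) $\phi_n\colon V_n\to V_{n+1}$ is injective for all $n\ge N$; (II) the span of the $S_{n+1}$-orbit of $\phi_n(V_n)$ is all of $V_{n+1}$ for all $n\ge N$; (III) writing $V_n=\bigoplus_\lambda c_{\lambda,n}V(\lambda)_n$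 with multiplicities $0\le c_{\lambda,n}\le\infty$, for each $\lambda$ the multiplicity $c_{\lambda,n}$ is independent of $n$ for $n\ge N$ (with $N$ not depending on $\lambda$). *)

theory Defs
  imports
    Complex_Main
    "HOL-Library.FuncSet"
    "HOL-Library.Extended_Nat"
    "HOL-Library.Function_Algebras"
    "HOL-Combinatorics.Permutations"
begin

section \<open>FI-modules\<close>

text \<open>
  The objects of FI are rendered as the finite subsets of \<open>nat\<close>, a small full subcategory
  that is equivalent to the category of all finite sets and contains every \<open>{1..n}\<close>.
  Morphisms are extensional functions, so that each injection \<open>S \<rightarrow> T\<close> is represented by
  exactly one HOL function; composition is \<^const>\<open>compose\<close>.
\<close>

definition fi_hom :: "nat set \<Rightarrow> nat set \<Rightarrow> (nat \<Rightarrow> nat) set" where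
  "fi_hom S T = {f \<in> S \<rightarrow>\<^sub>E T. finite S \<and> finite T \<and> inj_on f S}"

text \<open>
  The vector spaces \<open>V S\<close> are linear subspaces of one ambient space. They need not be
  independent or related by inclusion. This loses no generality: any family of vector spaces
  embeds in its direct sum. The map induced by \<open>f : S \<rightarrow> T\<close> is \<open>F S T f\<close>, of which only the
  values on \<open>V S\<close> matter.
\<close>

locale fi_module = vector_space scale
  for scale :: "'k::field \<Rightarrow> 'v::ab_group_add \<Rightarrow> 'v" +
  fixes V :: "nat set \<Rightarrow> 'v set"
    and F :: "nat set \<Rightarrow> nat set \<Rightarrow> (nat \<Rightarrow> nat) \<Rightarrow> 'v \<Rightarrow> 'v"
  assumes subspace_obj: "finite S \<Longrightarrow> subspace (V S)"
    and map_closed: "f \<in> fi_hom S T \<Longrightarrow> x \<in> V S \<Longrightarrow> F S T f x \<in> V T"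
    and map_add: "f \<in> fi_hom S T \<Longrightarrow> x \<in> V S \<Longrightarrow> y \<in> V S \<Longrightarrow>
                    F S T f (x + y) = F S T f x + F S T f y"
    and map_scale: "f \<in> fi_hom S T \<Longrightarrow> x \<in> V S \<Longrightarrow> F S T f (scale a x) = scale a (F S T f x)"
    and map_id: "finite S \<Longrightarrow> x \<in> V S \<Longrightarrow> F S S (\<lambda>i\<in>S. i) x = x"
    and map_comp: "f \<in> fi_hom S T \<Longrightarrow> g \<in> fi_hom T U \<Longrightarrow> x \<in> V S \<Longrightarrow>
                    F S U (compose S g f) x = F T U g (F S T f x)"

definition fi_submodule ::
  "('k::field \<Rightarrow> 'v::ab_group_add \<Rightarrow> 'v) \<Rightarrow> (nat set \<Rightarrow> 'v set) \<Rightarrow>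
   (nat set \<Rightarrow> nat set \<Rightarrow> (nat \<Rightarrow> nat) \<Rightarrow> 'v \<Rightarrow> 'v) \<Rightarrow> (nat set \<Rightarrow> 'v set) \<Rightarrow> bool" where
  "fi_submodule scale V F U \<longleftrightarrow>
     (\<forall>S. finite S \<longrightarrow> U S \<subseteq> V S \<and> module.subspace scale (U S)) \<and>
     (\<forall>S T. \<forall>f \<in> fi_hom S T. \<forall>x \<in> U S. F S T f x \<in> U T)"

definition fi_finitely_generated ::
  "('k::field \<Rightarrow> 'v::ab_group_add \<Rightarrow> 'v) \<Rightarrow> (nat set \<Rightarrow> 'v set) \<Rightarrow>
   (nat set \<Rightarrow> nat set \<Rightarrow> (nat \<Rightarrow> nat) \<Rightarrow> 'v \<Rightarrow> 'v) \<Rightarrow> bool" where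
  "fi_finitely_generated scale V F \<longleftrightarrow>
     (\<exists>\<Sigma> \<subseteq> (SIGMA n:UNIV. V {1..n}). finite \<Sigma> \<and>
        (\<forall>U. fi_submodule scale V F U \<and> (\<forall>(n, v) \<in> \<Sigma>. v \<in> U {1..n}) \<longrightarrow>
             (\<forall>S. finite S \<longrightarrow> U S = V S)))"


section \<open>Representations of symmetric groups\<close>

text \<open>
  A permutation of \<open>{1..n}\<close> is a function \<open>\<sigma>\<close> on \<open>nat\<close> with \<open>\<sigma> permutes {1..n}\<close>, i.e. a
  bijection that is the identity outside \<open>{1..n}\<close>. The record carries the data of a
  representation on a subset of an ambient additive group; only the action of
  permutations of \<open>{1..n}\<close> on the carrier is relevant for a representation of \<open>S\<^sub>n\<close>.
\<close>

record ('k, 'v) rep =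
  rep_carrier :: "'v set"
  rep_scale :: "'k \<Rightarrow> 'v \<Rightarrow> 'v"
  rep_act :: "(nat \<Rightarrow> nat) \<Rightarrow> 'v \<Rightarrow> 'v"

definition rep_iso ::
  "nat \<Rightarrow> ('k, 'v::ab_group_add) rep \<Rightarrow> ('k, 'w::ab_group_add) rep \<Rightarrow> bool" where
  "rep_iso n A B \<longleftrightarrow>
     (\<exists>h. bij_betw h (rep_carrier A) (rep_carrier B) \<and>
        (\<forall>x \<in> rep_carrier A. \<forall>y \<in> rep_carrier A. h (x + y) = h x + h y) \<and>
        (\<forall>a. \<forall>x \<in> rep_carrier A. h (rep_scale A a x) = rep_scale B a (h x)) \<and>
        (\<forall>\<sigma>. \<sigma> permutes {1..n} \<longrightarrow>
           (\<forall>x \<in> rep_carrier A. h (rep_act A \<sigma> x) = rep_act B \<sigma> (h x))))"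

text \<open>External direct sum of the representations \<open>R j\<close>, \<open>j \<in> J\<close>.\<close>

definition rep_dsum :: "'j set \<Rightarrow> ('j \<Rightarrow> ('k, 'w::ab_group_add) rep) \<Rightarrow> ('k, 'j \<Rightarrow> 'w) rep" where
  "rep_dsum J R =
     \<lparr>rep_carrier = {x. (\<forall>j \<in> J. x j \<in> rep_carrier (R j)) \<and> (\<forall>j. j \<notin> J \<longrightarrow> x j = 0) \<and>
                        finite {j. x j \<noteq> 0}},
      rep_scale = (\<lambda>a x j. if j \<in> J then rep_scale (R j) a (x j) else 0),
      rep_act = (\<lambda>\<sigma> x j. if j \<in> J then rep_act (R j) \<sigma> (x j) else 0)\<rparr>"

definition rep_finite_dim :: "('k::field, 'v::ab_group_add) rep \<Rightarrow> bool" where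
  "rep_finite_dim A \<longleftrightarrow>
     (\<exists>B. finite B \<and> B \<subseteq> rep_carrier A \<and> module.span (rep_scale A) B = rep_carrier A)"


section \<open>The irreducible representation attached to a partition\<close>

text \<open>
  The irreducible representation of a partition \<open>\<mu>\<close> of \<open>n\<close> is the left ideal
  \<open>k[S\<^sub>n] c\<^sub>\<mu>\<close> generated by the Young symmetrizer \<open>c\<^sub>\<mu> = a\<^sub>\<mu> b\<^sub>\<mu>\<close>, as in Fulton and Harris,
  Representation Theory, Section 4.1. Here \<open>a\<^sub>\<mu>\<close> is the sum of the row-preserving
  permutations and \<open>b\<^sub>\<mu>\<close> the signed sum of the column-preserving permutations of the
  tableau of shape \<open>\<mu>\<close> filled with \<open>1, 2, \<dots>, n\<close> row after row. With this convention \<open>(n)\<close>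
  gives the trivial and \<open>(1, \<dots>, 1)\<close> the sign representation.
  Rows and columns are indexed from \<open>0\<close>, and an empty row (as in the list \<open>[0]\<close>) is harmless.
\<close>

definition young_cells :: "nat list \<Rightarrow> (nat \<times> nat) set" where
  "young_cells \<mu> = {(i, j). i < length \<mu> \<and> j < \<mu> ! i}"

definition young_entry :: "nat list \<Rightarrow> nat \<Rightarrow> nat \<Rightarrow> nat" where
  "young_entry \<mu> i j = sum_list (take i \<mu>) + j + 1"

definition row_group :: "nat list \<Rightarrow> (nat \<Rightarrow> nat) set" where
  "row_group \<mu> = {p. p permutes {1..sum_list \<mu>} \<and>
     (\<forall>(i, j) \<in> young_cells \<mu>. \<exists>j'. (i, j') \<in> young_cells \<mu> \<and>
        p (young_entry \<mu> i j) = young_entry \<mu> i j')}"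

definition column_group :: "nat list \<Rightarrow> (nat \<Rightarrow> nat) set" where
  "column_group \<mu> = {q. q permutes {1..sum_list \<mu>} \<and>
     (\<forall>(i, j) \<in> young_cells \<mu>. \<exists>i'. (i', j) \<in> young_cells \<mu> \<and>
        q (young_entry \<mu> i j) = young_entry \<mu> i' j)}"

text \<open>
  An element \<open>\<Sum>\<^sub>\<sigma> x\<^sub>\<sigma> \<sigma>\<close> of the group algebra \<open>k[S\<^sub>n]\<close> is the function \<open>\<sigma> \<mapsto> x\<^sub>\<sigma>\<close>, which vanishes
  outside \<open>S\<^sub>n\<close>. Its product is convolution, and \<open>\<tau> \<in> S\<^sub>n\<close> acts on the left by
  \<open>(\<tau> x)\<^sub>\<sigma> = x\<close> evaluated at \<open>\<tau>\<^sup>-\<^sup>1 \<sigma>\<close>.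
\<close>

definition group_algebra :: "nat \<Rightarrow> ((nat \<Rightarrow> nat) \<Rightarrow> 'k::field) set" where
  "group_algebra n = {x. \<forall>\<sigma>. \<not> \<sigma> permutes {1..n} \<longrightarrow> x \<sigma> = 0}"

definition group_algebra_mult ::
  "nat \<Rightarrow> ((nat \<Rightarrow> nat) \<Rightarrow> 'k::field) \<Rightarrow> ((nat \<Rightarrow> nat) \<Rightarrow> 'k) \<Rightarrow> (nat \<Rightarrow> nat) \<Rightarrow> 'k" where
  "group_algebra_mult n x y = (\<lambda>\<sigma>. \<Sum>\<tau> | \<tau> permutes {1..n}. x \<tau> * y (inv \<tau> \<circ> \<sigma>))"

definition young_symmetrizer :: "nat list \<Rightarrow> (nat \<Rightarrow> nat) \<Rightarrow> 'k::field" where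
  "young_symmetrizer \<mu> =
     group_algebra_mult (sum_list \<mu>)
       (\<lambda>p. if p \<in> row_group \<mu> then 1 else 0)
       (\<lambda>q. if q \<in> column_group \<mu> then of_int (sign q) else 0)"

definition young_rep :: "nat list \<Rightarrow> ('k::field, (nat \<Rightarrow> nat) \<Rightarrow> 'k) rep" where
  "young_rep \<mu> =
     \<lparr>rep_carrier = (\<lambda>x. group_algebra_mult (sum_list \<mu>) x (young_symmetrizer \<mu>)) `
                      group_algebra (sum_list \<mu>),
      rep_scale = (\<lambda>a x \<sigma>. a * x \<sigma>),
      rep_act = (\<lambda>\<tau> x \<sigma>. x (inv \<tau> \<circ> \<sigma>))\<rparr>"

definition is_partition :: "nat list \<Rightarrow> bool" where
  "is_partition \<nu> \<longleftrightarrow> sorted_wrt (\<ge>) \<nu> \<and> 0 \<notin> set \<nu>"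

definition first_part :: "nat list \<Rightarrow> nat" where
  "first_part \<nu> = (case \<nu> of [] \<Rightarrow> 0 | l # _ \<Rightarrow> l)"

text \<open>The partitions \<open>\<nu>\<close> for which \<open>V(\<nu>)\<^sub>n\<close> is defined.\<close>

definition admissible :: "nat \<Rightarrow> nat list set" where
  "admissible n = {\<nu>. is_partition \<nu> \<and> sum_list \<nu> + first_part \<nu> \<le> n}"

definition V_irrep :: "nat list \<Rightarrow> nat \<Rightarrow> ('k::field, (nat \<Rightarrow> nat) \<Rightarrow> 'k) rep" where
  "V_irrep \<nu> n = young_rep ((n - sum_list \<nu>) # \<nu>)"


section \<open>Multiplicities and uniform representation stability\<close>

text \<open>
  \<open>has_multiplicities n W c\<close> says that \<open>W \<simeq> \<Oplus>\<^sub>\<nu> c\<^sub>\<nu> V(\<nu>)\<^sub>n\<close> as representations of \<open>S\<^sub>n\<close>. The copies of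
  \<open>V(\<nu>)\<^sub>n\<close> are indexed by a set \<open>I \<nu>\<close> with \<open>c\<^sub>\<nu>\<close> elements, any infinite cardinality counting as
  \<open>\<infinity>\<close>. The elements of \<open>I \<nu>\<close> are taken from the ambient type of \<open>W\<close>, which is large enough
  because a choice of one nonzero vector in each summand is injective. If \<open>V(\<nu>)\<^sub>n\<close> is not defined
  then \<open>\<nu>\<close> must have multiplicity \<open>0\<close>. Values of \<open>c\<close> at lists that are not partitions are
  irrelevant.
\<close>

definition has_multiplicities ::
  "nat \<Rightarrow> ('k::field, 'v::ab_group_add) rep \<Rightarrow> (nat list \<Rightarrow> enat) \<Rightarrow> bool" where
  "has_multiplicities n W c \<longleftrightarrow>
     (\<forall>\<nu>. is_partition \<nu> \<and> \<nu> \<notin> admissible n \<longrightarrow> c \<nu> = 0) \<and>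
     (\<exists>I :: nat list \<Rightarrow> 'v set.
        (\<forall>\<nu> \<in> admissible n. c \<nu> = (if finite (I \<nu>) then enat (card (I \<nu>)) else \<infinity>)) \<and>
        rep_iso n W (rep_dsum (SIGMA \<nu>:admissible n. I \<nu>) (\<lambda>(\<nu>, i). V_irrep \<nu> n)))"

definition uniformly_rep_stable ::
  "(nat \<Rightarrow> ('k::field, 'v::ab_group_add) rep) \<Rightarrow> (nat \<Rightarrow> 'v \<Rightarrow> 'v) \<Rightarrow> bool" where
  "uniformly_rep_stable W \<phi> \<longleftrightarrow>
     (\<exists>N.
        (\<forall>n\<ge>N. inj_on (\<phi> n) (rep_carrier (W n))) \<and>
        (\<forall>n\<ge>N. module.span (rep_scale (W (Suc n)))
                  {rep_act (W (Suc n)) \<sigma> (\<phi> n x) | \<sigma> x.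
                     \<sigma> permutes {1..Suc n} \<and> x \<in> rep_carrier (W n)}
                = rep_carrier (W (Suc n))) \<and>
        (\<exists>c :: nat \<Rightarrow> nat list \<Rightarrow> enat.
           (\<forall>n. has_multiplicities n (W n) (c n)) \<and>
           (\<forall>\<nu>. is_partition \<nu> \<longrightarrow> (\<forall>n\<ge>N. c n \<nu> = c N \<nu>))))"


section \<open>The sequence of representations underlying an FI-module\<close>

definition fi_rep ::
  "('k::field \<Rightarrow> 'v::ab_group_add \<Rightarrow> 'v) \<Rightarrow> (nat set \<Rightarrow> 'v set) \<Rightarrow>
   (nat set \<Rightarrow> nat set \<Rightarrow> (nat \<Rightarrow> nat) \<Rightarrow> 'v \<Rightarrow> 'v) \<Rightarrow> nat \<Rightarrow> ('k, 'v) rep" where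
  "fi_rep scale V F n =
     \<lparr>rep_carrier = V {1..n},
      rep_scale = scale,
      rep_act = (\<lambda>\<sigma>. F {1..n} {1..n} (restrict \<sigma> {1..n}))\<rparr>"

definition fi_phi ::
  "(nat set \<Rightarrow> nat set \<Rightarrow> (nat \<Rightarrow> nat) \<Rightarrow> 'v \<Rightarrow> 'v) \<Rightarrow> nat \<Rightarrow> 'v \<Rightarrow> 'v" where
  "fi_phi F n = F {1..n} {1..Suc n} (\<lambda>i\<in>{1..n}. i)"

end

theory Submission
  imports Defs "HOL-Combinatorics.Orbits"
begin

text \<open>
  For a representation \<open>W\<close> of \<open>S\<^sub>n\<close> in characteristic 0 the multiplicity of the Specht module of
  shape \<open>\<mu>\<close> is the dimension of \<open>c\<^sub>\<mu> W\<close>, where \<open>c\<^sub>\<mu> = a\<^sub>\<mu> b\<^sub>\<mu>\<close> is the Young symmetrizer. This needs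
  neither irreducibility nor complete reducibility, only that \<open>c\<^sub>\<mu> A c\<^sub>\<mu> = k c\<^sub>\<mu>\<close> and
  \<open>c\<^sub>\<mu>\<^sup>2 \<noteq> 0\<close>, that \<open>c\<^sub>\<lambda> A c\<^sub>\<mu> = 0\<close> for \<open>\<lambda> \<noteq> \<mu>\<close>, and that \<open>1\<close> lies in the sum of the ideals \<open>A c\<^sub>\<mu> A\<close>,
  for \<open>A = k[S\<^sub>n]\<close>. The last point is a dimension count in the centre: the averages
  \<open>\<Sum>\<^sub>g g c\<^sub>\<mu> g\<^sup>-\<^sup>1\<close> are central, pairwise orthogonal and not nilpotent, and there are at least as many of
  them as conjugacy classes.

  Let \<open>V\<close> be generated in degrees at most \<open>d\<close>, let \<open>\<mu>\<close> be the shape of \<open>V(\<nu>)\<^sub>n\<close>, and let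
  \<open>c' = a' b'\<close> be the symmetrizer of the shape of \<open>V(\<nu>)\<^sub>m\<close>, where \<open>m = n + 1\<close>. A generator involves
  at most \<open>d\<close> letters. If \<open>|\<nu>| > d\<close>, two cells of one column avoid these letters, so \<open>b\<^sub>\<mu>\<close> kills the
  generator and \<open>c\<^sub>\<mu> V\<^sub>n = 0\<close>. If \<open>n\<close> is large, the letters can be moved off the last cell of the first
  row of the larger shape by a row permutation that commutes with \<open>b'\<close>. Hence \<open>y \<mapsto> a' \<iota>(y)\<close> maps
  \<open>c\<^sub>\<mu> V\<^sub>n\<close> onto \<open>c' V\<^sub>m\<close>, where \<open>\<iota>\<close> is induced by the injection that skips that cell. The dimensions
  are therefore eventually constant, which makes these maps injective, and this in turn forces the
  kernel of \<open>\<phi>\<^sub>n\<close> to vanish.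
\<close>

section \<open>Cells of a Young diagram\<close>

text \<open>The obstacle is that a field of characteristic 0 carries no positivity that would
  exclude nilpotents. All elements in question have integer coefficients, however, and if g |-> g^-1
  is extended to an anti-automorphism \<open>star\<close>, the coefficient of x times
  \<open>star n x\<close> at the identity is a sum of integer squares. This one observation yields
  both c_\<mu>^2 \<noteq> 0 and the non-nilpotency of the central averages. Cycle types are indexed
  by the same set \<open>admissible n\<close> as the symmetrizers, with a partition of n stored
  without its first row. The dimension count thus compares this set with itself. The point from
  which the dimensions attached to \<nu> are constant comes from a decreasing sequence of naturals
  and is not explicit. One N serves for all \<nu> because only the finitely many \<nu> with |\<nu>|
  \<le> d contribute.\<close>

lemma young_cells_Cons:
  "young_cells (m # \<mu>) = Pair 0 ` {..<m} \<union> (\<lambda>(i, j). (Suc i, j)) ` young_cells \<mu>"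
proof -
  have "(i, j) \<in> young_cells (m # \<mu>) \<longleftrightarrow>
    (i, j) \<in> Pair 0 ` {..<m} \<union> (\<lambda>(i, j). (Suc i, j)) ` young_cells \<mu>" for i j
    by (cases i) (auto simp: young_cells_def image_iff)
  then show ?thesis by auto
qed

lemma young_entry_Cons [simp]:
  "young_entry (m # \<mu>) 0 j = Suc j"
  "young_entry (m # \<mu>) (Suc i) j = m + young_entry \<mu> i j"
  by (simp_all add: young_entry_def)

lemma bij_betw_young_entry:
  "bij_betw (\<lambda>(i, j). young_entry \<mu> i j) (young_cells \<mu>) {1..sum_list \<mu>}"
proof (induction \<mu>)
  case Nil
  then show ?case by (simp add: young_cells_def bij_betw_def)
next
  case (Cons m \<mu>)
  let ?e = "\<lambda>(i, j). young_entry (m # \<mu>) i j"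
  have 1: "bij_betw ?e (Pair 0 ` {..<m}) {1..m}"
    by (rule bij_betw_byWitness[where f' = "\<lambda>e. (0, e - 1)"]) auto
  have "bij_betw ((+) m) {1..sum_list \<mu>} {m + 1..m + sum_list \<mu>}"
    by simp
  from bij_betw_trans[OF Cons this]
  have 2: "bij_betw ((+) m \<circ> (\<lambda>(i, j). young_entry \<mu> i j)) (young_cells \<mu>) {m + 1..m + sum_list \<mu>}" .
  have 3: "bij_betw ?e ((\<lambda>(i, j). (Suc i, j)) ` young_cells \<mu>) {m + 1..m + sum_list \<mu>}"
  proof (subst bij_betw_comp_iff)
    show "bij_betw (\<lambda>(i, j). (Suc i, j)) (young_cells \<mu>) ((\<lambda>(i, j). (Suc i, j)) ` young_cells \<mu>)"
      by (auto simp: bij_betw_def inj_on_def)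
    show "bij_betw (?e \<circ> (\<lambda>(i, j). (Suc i, j))) (young_cells \<mu>) {m + 1..m + sum_list \<mu>}"
      using 2 by (rule iffD1[OF bij_betw_cong, rotated]) auto
  qed
  have "bij_betw ?e (young_cells (m # \<mu>)) ({1..m} \<union> {m + 1..m + sum_list \<mu>})"
    unfolding young_cells_Cons by (rule bij_betw_combine[OF 1 3]) auto
  also have "{1..m} \<union> {m + 1..m + sum_list \<mu>} = {1..sum_list (m # \<mu>)}"
    by auto
  finally show ?case .
qed

definition row_of :: "nat list \<Rightarrow> nat \<Rightarrow> nat" where
  "row_of \<mu> e = fst (inv_into (young_cells \<mu>) (\<lambda>(i, j). young_entry \<mu> i j) e)"

definition col_of :: "nat list \<Rightarrow> nat \<Rightarrow> nat" where
  "col_of \<mu> e = snd (inv_into (young_cells \<mu>) (\<lambda>(i, j). young_entry \<mu> i j) e)"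

lemma row_of_entry [simp]: "(i, j) \<in> young_cells \<mu> \<Longrightarrow> row_of \<mu> (young_entry \<mu> i j) = i"
  and col_of_entry [simp]: "(i, j) \<in> young_cells \<mu> \<Longrightarrow> col_of \<mu> (young_entry \<mu> i j) = j"
  using bij_betw_inv_into_left[OF bij_betw_young_entry, of "(i, j)" \<mu>]
  by (simp_all add: row_of_def col_of_def)

lemma cell_of_entry: "e \<in> {1..sum_list \<mu>} \<Longrightarrow> (row_of \<mu> e, col_of \<mu> e) \<in> young_cells \<mu>"
  unfolding row_of_def col_of_def
  by (metis bij_betw_young_entry bij_betw_def inv_into_into prod.collapse)

lemma entry_of_cell: "e \<in> {1..sum_list \<mu>} \<Longrightarrow> young_entry \<mu> (row_of \<mu> e) (col_of \<mu> e) = e"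
  using bij_betw_inv_into_right[OF bij_betw_young_entry, of e \<mu>]
  by (simp add: row_of_def col_of_def case_prod_beta)

lemma entry_in_range: "(i, j) \<in> young_cells \<mu> \<Longrightarrow> young_entry \<mu> i j \<in> {1..sum_list \<mu>}"
  using bij_betw_young_entry[of \<mu>] by (auto simp: bij_betw_def)

text \<open>With the existential over cells replaced by invariance of \<open>row_of\<close>, closure
  under composition and inverse becomes rewriting.\<close>

lemma row_group_iff:
  "p \<in> row_group \<mu> \<longleftrightarrow> p permutes {1..sum_list \<mu>} \<and>
     (\<forall>e \<in> {1..sum_list \<mu>}. row_of \<mu> (p e) = row_of \<mu> e)" (is "?L \<longleftrightarrow> ?R")
proof
  assume L: ?L
  then have p: "p permutes {1..sum_list \<mu>}" by (simp add: row_group_def)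
  have "row_of \<mu> (p e) = row_of \<mu> e" if e: "e \<in> {1..sum_list \<mu>}" for e
  proof -
    obtain j' where "(row_of \<mu> e, j') \<in> young_cells \<mu>" "p e = young_entry \<mu> (row_of \<mu> e) j'"
      using L cell_of_entry[OF e] entry_of_cell[OF e] by (fastforce simp: row_group_def)
    then show ?thesis by simp
  qed
  with p show ?R by blast
next
  assume R: ?R
  then have p: "p permutes {1..sum_list \<mu>}" by simp
  have "\<exists>j'. (i, j') \<in> young_cells \<mu> \<and> p (young_entry \<mu> i j) = young_entry \<mu> i j'"
    if ij: "(i, j) \<in> young_cells \<mu>" for i j
  proof -
    let ?e = "young_entry \<mu> i j"
    have e: "?e \<in> {1..sum_list \<mu>}" using entry_in_range[OF ij] .
    then have pe: "p ?e \<in> {1..sum_list \<mu>}" using permutes_in_image[OF p] by blast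
    have "row_of \<mu> (p ?e) = i" using R e ij by simp
    then show ?thesis using cell_of_entry[OF pe] entry_of_cell[OF pe] by metis
  qed
  with p show ?L by (auto simp: row_group_def)
qed

lemma column_group_iff:
  "p \<in> column_group \<mu> \<longleftrightarrow> p permutes {1..sum_list \<mu>} \<and>
     (\<forall>e \<in> {1..sum_list \<mu>}. col_of \<mu> (p e) = col_of \<mu> e)" (is "?L \<longleftrightarrow> ?R")
proof
  assume L: ?L
  then have p: "p permutes {1..sum_list \<mu>}" by (simp add: column_group_def)
  have "col_of \<mu> (p e) = col_of \<mu> e" if e: "e \<in> {1..sum_list \<mu>}" for e
  proof -
    obtain i' where "(i', col_of \<mu> e) \<in> young_cells \<mu>" "p e = young_entry \<mu> i' (col_of \<mu> e)"
      using L cell_of_entry[OF e] entry_of_cell[OF e] by (fastforce simp: column_group_def)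
    then show ?thesis by simp
  qed
  with p show ?R by blast
next
  assume R: ?R
  then have p: "p permutes {1..sum_list \<mu>}" by simp
  have "\<exists>i'. (i', j) \<in> young_cells \<mu> \<and> p (young_entry \<mu> i j) = young_entry \<mu> i' j"
    if ij: "(i, j) \<in> young_cells \<mu>" for i j
  proof -
    let ?e = "young_entry \<mu> i j"
    have e: "?e \<in> {1..sum_list \<mu>}" using entry_in_range[OF ij] .
    then have pe: "p ?e \<in> {1..sum_list \<mu>}" using permutes_in_image[OF p] by blast
    have "col_of \<mu> (p ?e) = j" using R e ij by simp
    then show ?thesis using cell_of_entry[OF pe] entry_of_cell[OF pe] by metis
  qed
  with p show ?L by (auto simp: column_group_def)
qed

lemma row_col_inj:
  assumes "x \<in> {1..sum_list \<mu>}" "y \<in> {1..sum_list \<mu>}"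
    and "row_of \<mu> x = row_of \<mu> y" "col_of \<mu> x = col_of \<mu> y"
  shows "x = y"
  using assms entry_of_cell by metis

section \<open>Counting entries by rows and columns\<close>

lemma sum_list_take_mono: "i \<le> j \<Longrightarrow> sum_list (take i (\<mu> :: nat list)) \<le> sum_list (take j \<mu>)"
  by (metis le_iff_add sum_list_append take_add)

text \<open>Entries are written row after row, so the first i rows hold an initial segment of
  them.\<close>

lemma row_of_less_iff:
  assumes "e \<in> {1..sum_list \<mu>}"
  shows "row_of \<mu> e < i \<longleftrightarrow> e \<le> sum_list (take i \<mu>)"
proof -
  let ?r = "row_of \<mu> e" and ?c = "col_of \<mu> e"
  have rc: "?r < length \<mu>" "?c < \<mu> ! ?r"
    using cell_of_entry[OF assms] by (auto simp: young_cells_def)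
  have e: "e = sum_list (take ?r \<mu>) + ?c + 1"
    using entry_of_cell[OF assms] by (simp add: young_entry_def)
  show ?thesis
  proof
    assume "?r < i"
    then have "sum_list (take (Suc ?r) \<mu>) \<le> sum_list (take i \<mu>)"
      by (intro sum_list_take_mono) simp
    then show "e \<le> sum_list (take i \<mu>)"
      using e rc by (simp add: take_Suc_conv_app_nth)
  next
    assume "e \<le> sum_list (take i \<mu>)"
    moreover have "sum_list (take i \<mu>) < e" if "i \<le> ?r"
      using sum_list_take_mono[OF that, of \<mu>] e by linarith
    ultimately show "?r < i" by (meson leD leI)
  qed
qed

lemma card_row_less: "card {e \<in> {1..sum_list \<mu>}. row_of \<mu> e < i} = sum_list (take i \<mu>)"
proof -
  have "sum_list (take i \<mu>) \<le> sum_list \<mu>"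
    by (metis append_take_drop_id le_add1 sum_list_append)
  then have "{e \<in> {1..sum_list \<mu>}. row_of \<mu> e < i} = {1..sum_list (take i \<mu>)}"
    using row_of_less_iff[of _ \<mu> i] by auto
  then show ?thesis by simp
qed

definition column :: "nat list \<Rightarrow> nat \<Rightarrow> nat set" where
  "column \<mu> j = {e \<in> {1..sum_list \<mu>}. col_of \<mu> e = j}"

lemma finite_column [simp]: "finite (column \<mu> j)"
  by (simp add: column_def)

lemma inj_on_row_of_column: "inj_on (row_of \<mu>) (column \<mu> j)"
  by (rule inj_onI) (auto simp: column_def intro: row_col_inj)

text \<open>The rows that meet a column form a downward closed set because the parts weakly
  decrease, and a finite downward closed set of naturals is an initial segment.\<close>

lemma rows_of_column:
  assumes "sorted_wrt (\<ge>) \<mu>"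
  shows "row_of \<mu> ` column \<mu> j = {..<card (column \<mu> j)}"
proof -
  let ?R = "row_of \<mu> ` column \<mu> j"
  have R: "?R = {i. (i, j) \<in> young_cells \<mu>}"
  proof (intro set_eqI iffI)
    fix i assume "i \<in> {i. (i, j) \<in> young_cells \<mu>}"
    then show "i \<in> ?R"
      using entry_in_range by (intro image_eqI[of _ _ "young_entry \<mu> i j"]) (auto simp: column_def)
  qed (use cell_of_entry in \<open>fastforce simp: column_def\<close>)
  have down: "i' \<in> ?R" if "i \<in> ?R" "i' \<le> i" for i i'
  proof -
    from that(1) have i: "i < length \<mu>" "j < \<mu> ! i" unfolding R young_cells_def by auto
    have "\<mu> ! i' \<ge> \<mu> ! i"
      using that(2) i assms by (cases "i' = i") (auto simp: sorted_wrt_iff_nth_less)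
    then show ?thesis using i that(2) unfolding R young_cells_def by auto
  qed
  have fin: "finite ?R" by simp
  have "?R = {..<card ?R}"
  proof (cases "?R = {}")
    case False
    have "?R = {..Max ?R}"
      using down Max_in[OF fin False] Max_ge[OF fin] by blast
    then show ?thesis by (metis card_atMost lessThan_Suc_atMost)
  qed simp
  then show ?thesis by (simp add: card_image inj_on_row_of_column)
qed

lemma card_column_row_less:
  assumes "sorted_wrt (\<ge>) \<mu>"
  shows "card {e \<in> column \<mu> j. row_of \<mu> e < i} = min i (card (column \<mu> j))"
proof -
  have "row_of \<mu> ` {e \<in> column \<mu> j. row_of \<mu> e < i} = {..<card (column \<mu> j)} \<inter> {..<i}"
    unfolding rows_of_column[OF assms, symmetric] by auto
  also have "\<dots> = {..<min i (card (column \<mu> j))}" by auto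
  finally have "card (row_of \<mu> ` {e \<in> column \<mu> j. row_of \<mu> e < i}) = min i (card (column \<mu> j))"
    by simp
  moreover have "inj_on (row_of \<mu>) {e \<in> column \<mu> j. row_of \<mu> e < i}"
    by (rule inj_on_subset[OF inj_on_row_of_column]) auto
  ultimately show ?thesis by (simp add: card_image)
qed

text \<open>The summation range is the same for every A, so two such counts can be compared column
  by column. The extra 0 keeps \<open>Max\<close> meaningful for the empty diagram.\<close>

lemma card_sum_columns:
  assumes "A \<subseteq> {1..sum_list \<mu>}"
  shows "card A = (\<Sum>j < Suc (Max (col_of \<mu> ` {1..sum_list \<mu>} \<union> {0})). card (A \<inter> column \<mu> j))"
proof -
  let ?M = "Suc (Max (col_of \<mu> ` {1..sum_list \<mu>} \<union> {0}))"
  have fin: "finite A" using assms finite_subset by blast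
  have "A = (\<Union>j<?M. A \<inter> column \<mu> j)"
    using assms by (fastforce simp: column_def less_Suc_eq_le)
  then have "card A = card (\<Union>j<?M. A \<inter> column \<mu> j)" by simp
  also have "\<dots> = (\<Sum>j<?M. card (A \<inter> column \<mu> j))"
    by (rule card_UN_disjoint) (use fin in \<open>auto simp: column_def\<close>)
  finally show ?thesis .
qed

section \<open>Young's combinatorial lemma\<close>

context
  fixes \<alpha> \<mu> :: "nat list" and g :: "nat \<Rightarrow> nat"
  assumes sorted: "sorted_wrt (\<ge>) \<mu>"
    and size: "sum_list \<alpha> = sum_list \<mu>"
    and g: "g permutes {1..sum_list \<mu>}"
    and inj: "inj_on (\<lambda>e. (row_of \<alpha> (g e), col_of \<mu> e)) {1..sum_list \<mu>}"
begin

text \<open>The assumption \<open>inj\<close> says that g never sends two entries of one column of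
  \<mu> to the same row of \<alpha>. So at most i entries of column j land in the first i rows, and
  at most as many as the column has; the right-hand side is the minimum of these two bounds.\<close>

lemma card_low_entries:
  "card ({e \<in> {1..sum_list \<mu>}. row_of \<alpha> (g e) < i} \<inter> column \<mu> j)
     \<le> card ({e \<in> {1..sum_list \<mu>}. row_of \<mu> e < i} \<inter> column \<mu> j)"
proof -
  let ?D = "{e \<in> {1..sum_list \<mu>}. row_of \<alpha> (g e) < i} \<inter> column \<mu> j"
  have "inj_on (\<lambda>e. row_of \<alpha> (g e)) ?D"
    using inj unfolding inj_on_def column_def by blast
  then have "card ?D = card ((\<lambda>e. row_of \<alpha> (g e)) ` ?D)" by (simp add: card_image)
  also have "\<dots> \<le> card {..<i}" by (rule card_mono) auto
  finally have "card ?D \<le> i" by simp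
  moreover have "card ?D \<le> card (column \<mu> j)" by (rule card_mono) auto
  moreover have "{e \<in> {1..sum_list \<mu>}. row_of \<mu> e < i} \<inter> column \<mu> j = {e \<in> column \<mu> j. row_of \<mu> e < i}"
    using size by (auto simp: column_def)
  ultimately show ?thesis using card_column_row_less[OF sorted, of j i] by simp
qed

lemma card_low_rows: "card {e \<in> {1..sum_list \<mu>}. row_of \<alpha> (g e) < i} = sum_list (take i \<alpha>)"
proof -
  have "bij_betw g {e \<in> {1..sum_list \<mu>}. row_of \<alpha> (g e) < i} {e \<in> {1..sum_list \<mu>}. row_of \<alpha> e < i}"
    by (rule bij_betw_byWitness[where f' = "inv g"])
       (use permutes_in_image[OF g] permutes_in_image[OF permutes_inv[OF g]]
          permutes_inverses[OF g] in auto)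
  then have "card {e \<in> {1..sum_list \<mu>}. row_of \<alpha> (g e) < i} = card {e \<in> {1..sum_list \<mu>}. row_of \<alpha> e < i}"
    by (rule bij_betw_same_card)
  then show ?thesis using card_row_less[of \<alpha> i] size by simp
qed

text \<open>Summing the bounds of \<open>card_low_entries\<close> over the columns shows that \<mu>
  dominates \<alpha>. All vanishing results for Young symmetrizers below rest on this.\<close>

lemma dominance: "sum_list (take i \<alpha>) \<le> sum_list (take i \<mu>)"
proof -
  have "card {e \<in> {1..sum_list \<mu>}. row_of \<alpha> (g e) < i} \<le> card {e \<in> {1..sum_list \<mu>}. row_of \<mu> e < i}"
    using card_sum_columns[of "{e \<in> {1..sum_list \<mu>}. row_of \<alpha> (g e) < i}" \<mu>]
      card_sum_columns[of "{e \<in> {1..sum_list \<mu>}. row_of \<mu> e < i}" \<mu>]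
    by (simp only: Collect_restrict) (intro sum_mono card_low_entries)
  then show ?thesis using card_low_rows card_row_less[of \<mu> i] size by simp
qed

text \<open>For equal shapes the total counts behind \<open>dominance\<close> agree, so every column
  bound is an equality. This makes the cell in the row of g e and the column of e exist for every
  entry e.\<close>

lemma row_column_factorization:
  assumes eq: "\<alpha> = \<mu>"
  obtains p q where "p \<in> row_group \<mu>" "q \<in> column_group \<mu>" "g = p \<circ> q"
proof -
  have row_less: "row_of \<mu> (g e) < card (column \<mu> (col_of \<mu> e))" if e: "e \<in> {1..sum_list \<mu>}" for e
  proof -
    let ?j = "col_of \<mu> e"
    \<comment> \<open>With i the length of the column of e, equality forces the whole column to land
      in the first i rows.\<close>
    let ?i = "card (column \<mu> ?j)"
    let ?M = "Suc (Max (col_of \<mu> ` {1..sum_list \<mu>} \<union> {0}))"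
    have "card {e \<in> {1..sum_list \<mu>}. row_of \<mu> (g e) < ?i} = card {e \<in> {1..sum_list \<mu>}. row_of \<mu> e < ?i}"
      using card_low_rows card_row_less[of \<mu>] size eq by simp
    then have sums: "(\<Sum>j<?M. card ({e \<in> {1..sum_list \<mu>}. row_of \<mu> (g e) < ?i} \<inter> column \<mu> j))
      = (\<Sum>j<?M. card ({e \<in> {1..sum_list \<mu>}. row_of \<mu> e < ?i} \<inter> column \<mu> j))"
      using card_sum_columns[of "{e \<in> {1..sum_list \<mu>}. row_of \<mu> (g e) < ?i}" \<mu>]
        card_sum_columns[of "{e \<in> {1..sum_list \<mu>}. row_of \<mu> e < ?i}" \<mu>]
      by (simp only: Collect_restrict)
    have "?j < ?M" using e size by (auto simp: less_Suc_eq_le)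
    have "card ({e \<in> {1..sum_list \<mu>}. row_of \<mu> (g e) < ?i} \<inter> column \<mu> ?j)
      = card ({e \<in> {1..sum_list \<mu>}. row_of \<mu> e < ?i} \<inter> column \<mu> ?j)"
      by (rule sum_mono_inv[OF sums]) (use card_low_entries eq \<open>?j < ?M\<close> in auto)
    also have "{e \<in> {1..sum_list \<mu>}. row_of \<mu> e < ?i} \<inter> column \<mu> ?j = {e \<in> column \<mu> ?j. row_of \<mu> e < ?i}"
      using size by (auto simp: column_def)
    also have "card \<dots> = ?i" using card_column_row_less[OF sorted] by simp
    finally have "{e \<in> {1..sum_list \<mu>}. row_of \<mu> (g e) < ?i} \<inter> column \<mu> ?j = column \<mu> ?j"
      by (intro card_subset_eq) auto
    moreover have "e \<in> column \<mu> ?j" using e size by (simp add: column_def)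
    ultimately show ?thesis by blast
  qed
  have cell: "(row_of \<mu> (g e), col_of \<mu> e) \<in> young_cells \<mu>" if e: "e \<in> {1..sum_list \<mu>}" for e
  proof -
    have "row_of \<mu> (g e) \<in> row_of \<mu> ` column \<mu> (col_of \<mu> e)"
      using row_less[OF e] rows_of_column[OF sorted] by blast
    then obtain e' where "e' \<in> column \<mu> (col_of \<mu> e)" "row_of \<mu> (g e) = row_of \<mu> e'" by blast
    then show ?thesis using cell_of_entry[of e' \<mu>] by (auto simp: column_def)
  qed
  \<comment> \<open>q is the vertical part of g: it keeps the column of e and takes the row from g
    e. What remains, g q^-1, moves entries within rows.\<close>
  define q where "q e = (if e \<in> {1..sum_list \<mu>} then young_entry \<mu> (row_of \<mu> (g e)) (col_of \<mu> e) else e)" for e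
  have q_range: "q e \<in> {1..sum_list \<mu>}" if "e \<in> {1..sum_list \<mu>}" for e
    using entry_in_range[OF cell[OF that]] that size by (simp add: q_def)
  have q_row: "row_of \<mu> (q e) = row_of \<mu> (g e)" and q_col: "col_of \<mu> (q e) = col_of \<mu> e"
    if "e \<in> {1..sum_list \<mu>}" for e
    using cell[OF that] that by (simp_all add: q_def)
  have "inj_on q {1..sum_list \<mu>}"
    using inj eq q_row q_col unfolding inj_on_def by (metis prod.inject)
  then have "bij_betw q {1..sum_list \<mu>} {1..sum_list \<mu>}"
    using q_range by (metis bij_betw_def endo_inj_surj finite_atLeastAtMost image_subsetI)
  then have q: "q permutes {1..sum_list \<mu>}"
    by (rule bij_imp_permutes) (simp only: q_def if_False)
  have "row_of \<mu> ((g \<circ> inv q) e) = row_of \<mu> e" if "e \<in> {1..sum_list \<mu>}" for e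
  proof -
    have "inv q e \<in> {1..sum_list \<mu>}" using that permutes_in_image[OF permutes_inv[OF q]] by blast
    from q_row[OF this] show ?thesis using permutes_inverses[OF q] by simp
  qed
  then have "g \<circ> inv q \<in> row_group \<mu>"
    using permutes_compose[OF permutes_inv[OF q] g] size by (simp add: row_group_iff)
  moreover have "q \<in> column_group \<mu>" using q q_col size by (simp add: column_group_iff)
  moreover have "g = (g \<circ> inv q) \<circ> q" using permutes_inv_o[OF q] by (simp add: comp_assoc)
  ultimately show ?thesis using that by blast
qed

end

declare One_nat_def [simp del]

section \<open>Representations of symmetric groups as modules over the group algebra\<close>

lemma sum_fun_apply: "sum f I \<sigma> = (\<Sum>i\<in>I. f i \<sigma>)"
  by (induction I rule: infinite_finite_induct) auto

text \<open>The action is constrained only on W, as the maps of an FI-module are. The locale serves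
  both \<open>V {1..n}\<close> and the regular representation.\<close>

locale sym_rep = vector_space scale
  for scale :: "'k::field \<Rightarrow> 'v::ab_group_add \<Rightarrow> 'v" +
  fixes n :: nat and W :: "'v set" and \<rho> :: "(nat \<Rightarrow> nat) \<Rightarrow> 'v \<Rightarrow> 'v"
  assumes subspace_W: "subspace W"
    and action_closed: "\<sigma> permutes {1..n} \<Longrightarrow> w \<in> W \<Longrightarrow> \<rho> \<sigma> w \<in> W"
    and action_add: "\<sigma> permutes {1..n} \<Longrightarrow> v \<in> W \<Longrightarrow> w \<in> W \<Longrightarrow> \<rho> \<sigma> (v + w) = \<rho> \<sigma> v + \<rho> \<sigma> w"
    and action_scale: "\<sigma> permutes {1..n} \<Longrightarrow> w \<in> W \<Longrightarrow> \<rho> \<sigma> (scale a w) = scale a (\<rho> \<sigma> w)"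
    and action_id: "w \<in> W \<Longrightarrow> \<rho> id w = w"
    and action_comp: "\<sigma> permutes {1..n} \<Longrightarrow> \<tau> permutes {1..n} \<Longrightarrow> w \<in> W \<Longrightarrow>
                        \<rho> (\<sigma> \<circ> \<tau>) w = \<rho> \<sigma> (\<rho> \<tau> w)"
begin

definition act :: "((nat \<Rightarrow> nat) \<Rightarrow> 'k) \<Rightarrow> 'v \<Rightarrow> 'v" where
  "act x w = (\<Sum>\<sigma> | \<sigma> permutes {1..n}. scale (x \<sigma>) (\<rho> \<sigma> w))"

lemma act_closed: "w \<in> W \<Longrightarrow> act x w \<in> W"
  unfolding act_def by (intro subspace_sum subspace_scale subspace_W action_closed) auto

lemma act_add_right: "v \<in> W \<Longrightarrow> w \<in> W \<Longrightarrow> act x (v + w) = act x v + act x w"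
  by (simp add: act_def action_add scale_right_distrib sum.distrib)

lemma act_scale_right: "w \<in> W \<Longrightarrow> act x (scale a w) = scale a (act x w)"
  by (simp add: act_def action_scale scale_sum_right mult.commute)

lemma act_zero_right [simp]: "act x 0 = 0"
  using act_scale_right[of 0 x 0] subspace_0[OF subspace_W] by simp

lemma act_sum_right:
  "(\<And>i. i \<in> I \<Longrightarrow> f i \<in> W) \<Longrightarrow> act x (sum f I) = (\<Sum>i\<in>I. act x (f i))"
proof (induction I rule: infinite_finite_induct)
  case (insert i I)
  then have "f i \<in> W" "sum f I \<in> W" by (auto intro: subspace_sum subspace_W)
  with insert show ?case by (simp add: act_add_right)
qed simp_all

lemma act_add_left: "act (x + y) w = act x w + act y w"
  by (simp add: act_def scale_left_distrib sum.distrib)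

lemma act_scale_left: "act (\<lambda>\<sigma>. a * x \<sigma>) w = scale a (act x w)"
  by (simp add: act_def scale_sum_right)

lemma act_zero_left [simp]: "act 0 w = 0"
  by (simp add: act_def)

lemma act_sum_left: "act (sum f I) w = (\<Sum>i\<in>I. act (f i) w)"
  unfolding act_def by (subst sum.swap) (simp add: sum_fun_apply scale_sum_left)

lemma action_sum:
  assumes "\<sigma> permutes {1..n}"
  shows "(\<And>i. i \<in> I \<Longrightarrow> f i \<in> W) \<Longrightarrow> \<rho> \<sigma> (sum f I) = (\<Sum>i\<in>I. \<rho> \<sigma> (f i))"
proof (induction I rule: infinite_finite_induct)
  case (insert i I)
  then have "f i \<in> W" "sum f I \<in> W" by (auto intro: subspace_sum subspace_W)
  with insert assms show ?case by (simp add: action_add)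
next
  case empty
  show ?case using action_scale[OF assms, of 0 0] subspace_0[OF subspace_W] by simp
next
  case (infinite I)
  show ?case using infinite action_scale[OF assms, of 0 0] subspace_0[OF subspace_W] by simp
qed

lemma act_translate:
  assumes \<tau>: "\<tau> permutes {1..n}" and w: "w \<in> W"
  shows "act (\<lambda>\<sigma>. x (inv \<tau> \<circ> \<sigma>)) w = \<rho> \<tau> (act x w)"
proof -
  have "act (\<lambda>\<sigma>. x (inv \<tau> \<circ> \<sigma>)) w
      = (\<Sum>\<sigma> | \<sigma> permutes {1..n}. scale (x (inv \<tau> \<circ> (\<tau> \<circ> \<sigma>))) (\<rho> (\<tau> \<circ> \<sigma>) w))"
    unfolding act_def by (rule setum_permutations_compose_left[OF \<tau>])
  also have "\<dots> = (\<Sum>\<sigma> | \<sigma> permutes {1..n}. \<rho> \<tau> (scale (x \<sigma>) (\<rho> \<sigma> w)))"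
    using permutes_inv_o[OF \<tau>]
    by (intro sum.cong) (auto simp: action_comp action_scale action_closed \<tau> w comp_assoc[symmetric])
  also have "\<dots> = \<rho> \<tau> (act x w)"
    unfolding act_def
    by (rule action_sum[OF \<tau>, symmetric]) (auto intro!: subspace_scale subspace_W action_closed w)
  finally show ?thesis .
qed

lemma act_action:
  assumes \<tau>: "\<tau> permutes {1..n}" and w: "w \<in> W"
  shows "act x (\<rho> \<tau> w) = act (\<lambda>\<sigma>. x (\<sigma> \<circ> inv \<tau>)) w"
proof -
  have "act (\<lambda>\<sigma>. x (\<sigma> \<circ> inv \<tau>)) w
      = (\<Sum>\<sigma> | \<sigma> permutes {1..n}. scale (x ((\<sigma> \<circ> \<tau>) \<circ> inv \<tau>)) (\<rho> (\<sigma> \<circ> \<tau>) w))"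
    unfolding act_def by (rule sum_permutations_compose_right[OF \<tau>])
  also have "\<dots> = act x (\<rho> \<tau> w)"
    unfolding act_def using permutes_inv_o[OF \<tau>]
    by (intro sum.cong) (auto simp: action_comp \<tau> w comp_assoc)
  finally show ?thesis ..
qed

lemma act_mult:
  assumes w: "w \<in> W"
  shows "act (group_algebra_mult n x y) w = act x (act y w)"
proof -
  have "act (group_algebra_mult n x y) w =
      (\<Sum>\<tau> | \<tau> permutes {1..n}. act (\<lambda>\<sigma>. x \<tau> * y (inv \<tau> \<circ> \<sigma>)) w)"
    unfolding act_def group_algebra_mult_def
    by (subst sum.swap) (simp add: scale_sum_left)
  also have "\<dots> = (\<Sum>\<tau> | \<tau> permutes {1..n}. scale (x \<tau>) (\<rho> \<tau> (act y w)))"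
    by (intro sum.cong) (auto simp: act_scale_left act_translate w)
  finally show ?thesis by (simp add: act_def)
qed

lemma act_one:
  assumes "w \<in> W"
  shows "act (\<lambda>\<sigma>. if \<sigma> = id then 1 else 0) w = w"
proof -
  have "act (\<lambda>\<sigma>. if \<sigma> = id then 1 else 0) w
      = (\<Sum>\<sigma> | \<sigma> permutes {1..n}. if \<sigma> = id then \<rho> id w else 0)"
    unfolding act_def by (intro sum.cong) auto
  also have "\<dots> = \<rho> id w"
    by (subst sum.delta) (auto simp: finite_permutations permutes_id)
  finally show ?thesis by (simp add: action_id assms)
qed

lemma subspace_image_act: "subspace (act x ` W)"
proof (rule subspaceI)
  show "0 \<in> act x ` W" using subspace_0[OF subspace_W] act_zero_right by (metis imageI)
next
  fix u v assume "u \<in> act x ` W" "v \<in> act x ` W"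
  then obtain u' v' where "u' \<in> W" "v' \<in> W" "u = act x u'" "v = act x v'" by blast
  then show "u + v \<in> act x ` W"
    using subspace_add[OF subspace_W] by (auto simp: act_add_right[symmetric])
next
  fix a u assume "u \<in> act x ` W"
  then show "scale a u \<in> act x ` W"
    using subspace_scale[OF subspace_W] by (auto simp: act_scale_right[symmetric])
qed

end

lemma vector_space_fun: "vector_space (\<lambda>(a::'k::field) x (\<sigma>::'a). a * x \<sigma>)"
  by unfold_locales (auto simp: fun_eq_iff algebra_simps)

lemma sym_rep_regular:
  "sym_rep (\<lambda>(a::'k::field) x (\<sigma>::nat \<Rightarrow> nat). a * x \<sigma>) n UNIV (\<lambda>\<tau> x \<sigma>. x (inv \<tau> \<circ> \<sigma>))"
proof -
  interpret vector_space "\<lambda>(a::'k) x (\<sigma>::nat \<Rightarrow> nat). a * x \<sigma>"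
    by (rule vector_space_fun)
  show ?thesis
    by unfold_locales
      (auto simp: fun_eq_iff comp_assoc o_inv_distrib permutes_bij algebra_simps)
qed

text \<open>Convolution is the action of the group algebra on itself, so associativity and
  bilinearity are instances of the facts about \<open>act\<close>. Taking all functions as carrier
  avoids membership conditions.\<close>

interpretation regular: sym_rep "\<lambda>(a::'k::field) x (\<sigma>::nat \<Rightarrow> nat). a * x \<sigma>" n UNIV "\<lambda>\<tau> x \<sigma>. x (inv \<tau> \<circ> \<sigma>)"
  rewrites "sym_rep.act (\<lambda>(a::'k::field) x (\<sigma>::nat \<Rightarrow> nat). a * x \<sigma>) n (\<lambda>\<tau> x \<sigma>. x (inv \<tau> \<circ> \<sigma>))
              = group_algebra_mult n"
  for n
proof -
  show "sym_rep (\<lambda>(a::'k::field) x (\<sigma>::nat \<Rightarrow> nat). a * x \<sigma>) n UNIV (\<lambda>\<tau> x \<sigma>. x (inv \<tau> \<circ> \<sigma>))"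
    by (rule sym_rep_regular)
  show "sym_rep.act (\<lambda>(a::'k::field) x (\<sigma>::nat \<Rightarrow> nat). a * x \<sigma>) n (\<lambda>\<tau> x \<sigma>. x (inv \<tau> \<circ> \<sigma>)) = group_algebra_mult n"
    by (auto simp: fun_eq_iff sym_rep.act_def[OF sym_rep_regular] group_algebra_mult_def
        sum_fun_apply)
qed

lemmas gmult_assoc = regular.act_mult[OF UNIV_I]

section \<open>Translations in the group algebra\<close>

lemma permutes_cancel:
  assumes "p permutes A"
  shows "inv p \<circ> (p \<circ> \<sigma>) = \<sigma>" "(\<sigma> \<circ> p) \<circ> inv p = \<sigma>"
  using permutes_inv_o[OF assms] by (simp_all add: comp_assoc[symmetric]) (simp add: comp_assoc)

lemma permutes_comp_cancel:
  assumes "\<tau> permutes A"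
  shows "(\<tau> \<circ> \<sigma>) permutes A \<longleftrightarrow> \<sigma> permutes A" "(\<sigma> \<circ> \<tau>) permutes A \<longleftrightarrow> \<sigma> permutes A"
  using permutes_compose permutes_inv[OF assms] permutes_cancel[OF assms] assms by metis+

lemma group_algebra_mult_closed: "y \<in> group_algebra n \<Longrightarrow> group_algebra_mult n x y \<in> group_algebra n"
  by (auto simp: group_algebra_def group_algebra_mult_def permutes_comp_cancel permutes_inv
      intro!: sum.neutral)

definition delta :: "(nat \<Rightarrow> nat) \<Rightarrow> (nat \<Rightarrow> nat) \<Rightarrow> 'k::field" where
  "delta \<tau> = (\<lambda>\<sigma>. if \<sigma> = \<tau> then 1 else 0)"

lemma delta_in: "\<tau> permutes {1..n} \<Longrightarrow> delta \<tau> \<in> group_algebra n"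
  by (auto simp: delta_def group_algebra_def)

lemma delta_mult:
  assumes "\<tau> permutes {1..n}"
  shows "group_algebra_mult n (delta \<tau>) x = (\<lambda>\<sigma>. x (inv \<tau> \<circ> \<sigma>))"
proof
  fix \<sigma>
  have "group_algebra_mult n (delta \<tau>) x \<sigma>
      = (\<Sum>\<upsilon> | \<upsilon> permutes {1..n}. if \<upsilon> = \<tau> then x (inv \<tau> \<circ> \<sigma>) else 0)"
    unfolding group_algebra_mult_def delta_def by (intro sum.cong) auto
  also have "\<dots> = x (inv \<tau> \<circ> \<sigma>)"
    by (subst sum.delta) (auto simp: finite_permutations assms)
  finally show "group_algebra_mult n (delta \<tau>) x \<sigma> = x (inv \<tau> \<circ> \<sigma>)" .
qed

text \<open>Unlike in \<open>delta_mult\<close>, x has to be supported on S_n: at any other \<sigma>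
  the left-hand side is an empty contribution and equals 0.\<close>

lemma mult_delta:
  assumes \<tau>: "\<tau> permutes {1..n}" and x: "x \<in> group_algebra n"
  shows "group_algebra_mult n x (delta \<tau>) = (\<lambda>\<sigma>. x (\<sigma> \<circ> inv \<tau>))"
proof
  fix \<sigma>
  have iff: "inv \<upsilon> \<circ> \<sigma> = \<tau> \<longleftrightarrow> \<upsilon> = \<sigma> \<circ> inv \<tau>" if "\<upsilon> permutes {1..n}" for \<upsilon>
  proof
    assume "inv \<upsilon> \<circ> \<sigma> = \<tau>"
    then have "\<sigma> = \<upsilon> \<circ> \<tau>"
      using permutes_inv_o[OF that] by (metis comp_assoc id_comp)
    then show "\<upsilon> = \<sigma> \<circ> inv \<tau>" using permutes_inv_o[OF \<tau>] by (simp add: comp_assoc)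
  next
    assume "\<upsilon> = \<sigma> \<circ> inv \<tau>"
    then have "\<sigma> = \<upsilon> \<circ> \<tau>" using permutes_inv_o[OF \<tau>] by (simp add: comp_assoc)
    then show "inv \<upsilon> \<circ> \<sigma> = \<tau>"
      using permutes_inv_o[OF that] by (simp add: comp_assoc[symmetric])
  qed
  have "group_algebra_mult n x (delta \<tau>) \<sigma>
      = (\<Sum>\<upsilon> | \<upsilon> permutes {1..n}. if \<upsilon> = \<sigma> \<circ> inv \<tau> then x (\<sigma> \<circ> inv \<tau>) else 0)"
    unfolding group_algebra_mult_def delta_def by (intro sum.cong) (auto simp: iff)
  also have "\<dots> = x (\<sigma> \<circ> inv \<tau>)"
    using x by (subst sum.delta) (auto simp: finite_permutations group_algebra_def)
  finally show "group_algebra_mult n x (delta \<tau>) \<sigma> = x (\<sigma> \<circ> inv \<tau>)" .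
qed

lemma mult_right_translate:
  "group_algebra_mult n x y (\<sigma> \<circ> q) = group_algebra_mult n x (\<lambda>\<sigma>. y (\<sigma> \<circ> q)) \<sigma>"
  by (simp add: group_algebra_mult_def comp_assoc)

section \<open>The standard involution\<close>

text \<open>It reverses products and fixes row sums and column sums, so it exchanges statements
  about left and right factors. The cut-off outside S_n puts every value into
  \<open>group_algebra n\<close>.\<close>

definition star :: "nat \<Rightarrow> ((nat \<Rightarrow> nat) \<Rightarrow> 'k::field) \<Rightarrow> (nat \<Rightarrow> nat) \<Rightarrow> 'k" where
  "star n x = (\<lambda>\<sigma>. if \<sigma> permutes {1..n} then x (inv \<sigma>) else 0)"

lemma star_in: "star n x \<in> group_algebra n"
  by (simp add: star_def group_algebra_def)

lemma permutes_inv_inv': "\<sigma> permutes A \<Longrightarrow> inv (inv \<sigma>) = \<sigma>"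
  by (simp add: inv_inv_eq permutes_bij)

lemma star_star: "x \<in> group_algebra n \<Longrightarrow> star n (star n x) = x"
  by (auto simp: star_def group_algebra_def fun_eq_iff permutes_inv permutes_inv_inv')

lemma star_mult:
  assumes "x \<in> group_algebra n" "y \<in> group_algebra n"
  shows "star n (group_algebra_mult n x y) = group_algebra_mult n (star n y) (star n x)"
proof
  fix \<sigma>
  show "star n (group_algebra_mult n x y) \<sigma> = group_algebra_mult n (star n y) (star n x) \<sigma>"
  proof (cases "\<sigma> permutes {1..n}")
    case True
    have "group_algebra_mult n (star n y) (star n x) \<sigma>
        = (\<Sum>\<tau> | \<tau> permutes {1..n}. star n y (\<sigma> \<circ> \<tau>) * star n x (inv (\<sigma> \<circ> \<tau>) \<circ> \<sigma>))"
      unfolding group_algebra_mult_def by (rule setum_permutations_compose_left[OF True])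
    also have "\<dots> = (\<Sum>\<tau> | \<tau> permutes {1..n}. x \<tau> * y (inv \<tau> \<circ> inv \<sigma>))"
    proof (intro sum.cong refl, clarify)
      fix \<tau> assume \<tau>: "\<tau> permutes {1..n}"
      have st: "inv (\<sigma> \<circ> \<tau>) = inv \<tau> \<circ> inv \<sigma>"
        using True \<tau> by (simp add: o_inv_distrib permutes_bij)
      then have "inv (\<sigma> \<circ> \<tau>) \<circ> \<sigma> = inv \<tau>"
        using permutes_inv_o[OF True] by (simp add: comp_assoc)
      then show "star n y (\<sigma> \<circ> \<tau>) * star n x (inv (\<sigma> \<circ> \<tau>) \<circ> \<sigma>) = x \<tau> * y (inv \<tau> \<circ> inv \<sigma>)"
        using True \<tau> st
        by (simp add: star_def permutes_compose permutes_inv permutes_inv_inv')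
    qed
    finally show ?thesis using True by (simp add: star_def group_algebra_mult_def)
  next
    case False
    then show ?thesis
      using group_algebra_mult_closed[OF star_in, of n "star n y" x]
      by (simp add: star_def group_algebra_def)
  qed
qed

text \<open>The coefficient of the product at the identity is the sum of the squares of the
  coefficients of x. The field has no order, so integrality is used to compute this sum in the
  integers.\<close>

lemma mult_star_nonzero:
  fixes x :: "(nat \<Rightarrow> nat) \<Rightarrow> 'k::field_char_0"
  assumes x: "x \<in> group_algebra n" "x \<noteq> 0" and int: "\<And>\<sigma>. x \<sigma> \<in> \<int>"
  shows "group_algebra_mult n x (star n x) \<noteq> 0"
proof
  assume 0: "group_algebra_mult n x (star n x) = 0"
  have "\<forall>\<sigma>. \<exists>m. x \<sigma> = of_int m" using int by (auto elim: Ints_cases)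
  then obtain f where f: "\<And>\<sigma>. x \<sigma> = of_int (f \<sigma>)" by metis
  have "group_algebra_mult n x (star n x) id = (\<Sum>\<tau> | \<tau> permutes {1..n}. x \<tau> * x \<tau>)"
    unfolding group_algebra_mult_def
    by (intro sum.cong) (auto simp: star_def permutes_inv permutes_inv_inv')
  also have "\<dots> = of_int (\<Sum>\<tau> | \<tau> permutes {1..n}. f \<tau> * f \<tau>)"
    by (simp add: f)
  finally have "(\<Sum>\<tau> | \<tau> permutes {1..n}. f \<tau> * f \<tau>) = 0"
    using 0 by (metis of_int_eq_0_iff zero_fun_apply)
  then have "\<forall>\<tau>. \<tau> permutes {1..n} \<longrightarrow> f \<tau> = 0"
    by (subst (asm) sum_nonneg_eq_0_iff) (auto simp: finite_permutations)
  then have "x = 0" using x f by (auto simp: group_algebra_def fun_eq_iff)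
  with x show False by simp
qed

section \<open>Young symmetrizers\<close>

lemma row_group_permutes: "p \<in> row_group \<mu> \<Longrightarrow> p permutes {1..sum_list \<mu>}"
  by (simp add: row_group_def)

lemma column_group_permutes: "q \<in> column_group \<mu> \<Longrightarrow> q permutes {1..sum_list \<mu>}"
  by (simp add: column_group_def)

lemma row_group_compose: "p \<in> row_group \<mu> \<Longrightarrow> p' \<in> row_group \<mu> \<Longrightarrow> p \<circ> p' \<in> row_group \<mu>"
  by (simp add: row_group_iff permutes_compose permutes_in_image del: atLeastAtMost_iff)

lemma column_group_compose:
  "q \<in> column_group \<mu> \<Longrightarrow> q' \<in> column_group \<mu> \<Longrightarrow> q \<circ> q' \<in> column_group \<mu>"
  by (simp add: column_group_iff permutes_compose permutes_in_image del: atLeastAtMost_iff)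

lemma row_group_inv: "p \<in> row_group \<mu> \<Longrightarrow> inv p \<in> row_group \<mu>"
  unfolding row_group_iff
  by (metis permutes_inv permutes_in_image permutes_inverses(1))

lemma column_group_inv: "q \<in> column_group \<mu> \<Longrightarrow> inv q \<in> column_group \<mu>"
  unfolding column_group_iff
  by (metis permutes_inv permutes_in_image permutes_inverses(1))

lemma row_group_inv_iff: "bij p \<Longrightarrow> inv p \<in> row_group \<mu> \<longleftrightarrow> p \<in> row_group \<mu>"
  by (metis row_group_inv inv_inv_eq)

lemma column_group_inv_iff: "bij p \<Longrightarrow> inv p \<in> column_group \<mu> \<longleftrightarrow> p \<in> column_group \<mu>"
  by (metis column_group_inv inv_inv_eq)

lemma row_group_cancel:
  assumes p: "p \<in> row_group \<mu>"
  shows "p \<circ> \<sigma> \<in> row_group \<mu> \<longleftrightarrow> \<sigma> \<in> row_group \<mu>" "\<sigma> \<circ> p \<in> row_group \<mu> \<longleftrightarrow> \<sigma> \<in> row_group \<mu>"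
  using row_group_compose row_group_inv[OF p] permutes_cancel[OF row_group_permutes[OF p]] p
  by metis+

lemma column_group_cancel:
  assumes q: "q \<in> column_group \<mu>"
  shows "q \<circ> \<sigma> \<in> column_group \<mu> \<longleftrightarrow> \<sigma> \<in> column_group \<mu>"
    "\<sigma> \<circ> q \<in> column_group \<mu> \<longleftrightarrow> \<sigma> \<in> column_group \<mu>"
  using column_group_compose column_group_inv[OF q] permutes_cancel[OF column_group_permutes[OF q]] q
  by metis+

lemma row_column_disjoint:
  assumes "p \<in> row_group \<mu>" "p \<in> column_group \<mu>"
  shows "p = id"
proof
  fix e
  have p: "p permutes {1..sum_list \<mu>}" using row_group_permutes assms by blast
  show "p e = id e"
  proof (cases "e \<in> {1..sum_list \<mu>}")
    case True
    then show ?thesis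
      using assms row_col_inj[of "p e" \<mu> e] permutes_in_image[OF p]
      unfolding row_group_iff column_group_iff id_apply by blast
  qed (use permutes_not_in[OF p] in simp)
qed

definition row_sum :: "nat list \<Rightarrow> (nat \<Rightarrow> nat) \<Rightarrow> 'k::field" where
  "row_sum \<mu> = (\<lambda>p. if p \<in> row_group \<mu> then 1 else 0)"

definition column_sum :: "nat list \<Rightarrow> (nat \<Rightarrow> nat) \<Rightarrow> 'k::field" where
  "column_sum \<mu> = (\<lambda>q. if q \<in> column_group \<mu> then of_int (sign q) else 0)"

lemma young_symmetrizer_eq:
  "young_symmetrizer \<mu> = group_algebra_mult (sum_list \<mu>) (row_sum \<mu>) (column_sum \<mu>)"
  by (simp add: young_symmetrizer_def row_sum_def column_sum_def)

lemma id_in_row_group: "id \<in> row_group \<mu>"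
  by (simp add: row_group_iff permutes_id)

lemma id_in_column_group: "id \<in> column_group \<mu>"
  by (simp add: column_group_iff permutes_id)

lemma row_sum_in: "sum_list \<mu> = n \<Longrightarrow> row_sum \<mu> \<in> group_algebra n"
  by (auto simp: row_sum_def group_algebra_def row_group_def)

lemma column_sum_in: "sum_list \<mu> = n \<Longrightarrow> column_sum \<mu> \<in> group_algebra n"
  by (auto simp: column_sum_def group_algebra_def column_group_def)

lemma young_symmetrizer_in: "sum_list \<mu> = n \<Longrightarrow> young_symmetrizer \<mu> \<in> group_algebra n"
  by (auto simp: young_symmetrizer_eq group_algebra_mult_closed column_sum_in)

lemma sign_column_compose:
  assumes q: "q \<in> column_group \<mu>" and \<sigma>: "\<sigma> permutes {1..sum_list \<mu>}"
  shows "sign (q \<circ> \<sigma>) = sign q * sign \<sigma>" "sign (\<sigma> \<circ> q) = sign q * sign \<sigma>"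
proof -
  have "permutation q" "permutation \<sigma>"
    using column_group_permutes[OF q] \<sigma> by (auto simp: permutation_permutes)
  then show "sign (q \<circ> \<sigma>) = sign q * sign \<sigma>" "sign (\<sigma> \<circ> q) = sign q * sign \<sigma>"
    by (simp_all add: sign_compose mult.commute)
qed

lemma row_sum_left: "p \<in> row_group \<mu> \<Longrightarrow> row_sum \<mu> (p \<circ> \<sigma>) = row_sum \<mu> \<sigma>"
  and row_sum_right: "p \<in> row_group \<mu> \<Longrightarrow> row_sum \<mu> (\<sigma> \<circ> p) = row_sum \<mu> \<sigma>"
  by (simp_all add: row_sum_def row_group_cancel)

lemma column_sum_left: "q \<in> column_group \<mu> \<Longrightarrow> column_sum \<mu> (q \<circ> \<sigma>) = of_int (sign q) * column_sum \<mu> \<sigma>"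
  and column_sum_right: "q \<in> column_group \<mu> \<Longrightarrow> column_sum \<mu> (\<sigma> \<circ> q) = of_int (sign q) * column_sum \<mu> \<sigma>"
  by (auto simp: column_sum_def column_group_cancel sign_column_compose column_group_permutes)

lemma row_sum_mult_left:
  assumes p: "p \<in> row_group \<mu>"
  shows "group_algebra_mult (sum_list \<mu>) (row_sum \<mu>) y (p \<circ> \<sigma>)
    = group_algebra_mult (sum_list \<mu>) (row_sum \<mu>) y \<sigma>"
proof -
  let ?n = "sum_list \<mu>"
  have ip: "inv p permutes {1..?n}" using permutes_inv[OF row_group_permutes[OF p]] .
  have pp: "inv (inv p) = p" using row_group_permutes[OF p] permutes_inv_inv' by blast
  have "group_algebra_mult ?n (row_sum \<mu>) y (p \<circ> \<sigma>)
      = group_algebra_mult ?n (\<lambda>\<sigma>. row_sum \<mu> (p \<circ> \<sigma>)) y \<sigma>"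
    using regular.act_translate[OF ip UNIV_I, of "row_sum \<mu>" y] by (simp add: pp fun_eq_iff)
  then show ?thesis by (simp add: row_sum_left p)
qed

lemma column_sum_mult_right:
  assumes q: "q \<in> column_group \<mu>"
  shows "group_algebra_mult n x (column_sum \<mu>) (\<sigma> \<circ> q)
    = of_int (sign q) * group_algebra_mult n x (column_sum \<mu>) \<sigma>"
  by (simp add: mult_right_translate column_sum_right q regular.act_scale_right)

lemma young_symmetrizer_left:
  "p \<in> row_group \<mu> \<Longrightarrow> young_symmetrizer \<mu> (p \<circ> \<sigma>) = young_symmetrizer \<mu> \<sigma>"
  by (simp add: young_symmetrizer_eq row_sum_mult_left)

lemma young_symmetrizer_right:
  "q \<in> column_group \<mu> \<Longrightarrow> young_symmetrizer \<mu> (\<sigma> \<circ> q) = of_int (sign q) * young_symmetrizer \<mu> \<sigma>"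
  by (simp add: young_symmetrizer_eq column_sum_mult_right)

text \<open>By \<open>row_column_disjoint\<close>, a row permutation times a column permutation is
  the identity only if both are. In particular the symmetrizer is nonzero.\<close>

lemma young_symmetrizer_id: "young_symmetrizer \<mu> id = (1 :: 'k::field)"
proof -
  have "young_symmetrizer \<mu> id
      = (\<Sum>p | p permutes {1..sum_list \<mu>}. if p = id then 1 else (0::'k))"
    unfolding young_symmetrizer_eq group_algebra_mult_def
  proof (intro sum.cong refl, clarify)
    fix p assume "p permutes {1..sum_list \<mu>}"
    then have "row_sum \<mu> p * column_sum \<mu> (inv p) \<noteq> (0::'k) \<Longrightarrow> p = id"
      using row_column_disjoint
      by (auto simp: row_sum_def column_sum_def column_group_inv_iff permutes_bij split: if_splits)
    then show "row_sum \<mu> p * column_sum \<mu> (inv p \<circ> id) = (if p = id then 1 else (0::'k))"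
      by (auto simp: row_sum_def column_sum_def id_in_row_group id_in_column_group)
  qed
  also have "\<dots> = 1" by (subst sum.delta) (auto simp: finite_permutations permutes_id)
  finally show ?thesis .
qed

lemma transpose_in_row_group:
  assumes "x \<in> {1..sum_list \<mu>}" "y \<in> {1..sum_list \<mu>}" "row_of \<mu> x = row_of \<mu> y"
  shows "transpose x y \<in> row_group \<mu>"
  unfolding row_group_iff using assms by (auto simp: permutes_swap_id transpose_def)

lemma transpose_in_column_group:
  assumes "x \<in> {1..sum_list \<mu>}" "y \<in> {1..sum_list \<mu>}" "col_of \<mu> x = col_of \<mu> y"
  shows "transpose x y \<in> column_group \<mu>"
  unfolding column_group_iff using assms by (auto simp: permutes_swap_id transpose_def)

section \<open>Elements invariant under rows and alternating under columns\<close>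

context
  fixes \<alpha> \<mu> :: "nat list" and x :: "(nat \<Rightarrow> nat) \<Rightarrow> 'k::field_char_0"
  assumes sorted: "sorted_wrt (\<ge>) \<mu>"
    and size: "sum_list \<alpha> = sum_list \<mu>"
    and row_inv: "\<And>p \<sigma>. p \<in> row_group \<alpha> \<Longrightarrow> x (p \<circ> \<sigma>) = x \<sigma>"
    and col_inv: "\<And>q \<sigma>. q \<in> column_group \<mu> \<Longrightarrow> x (\<sigma> \<circ> q) = of_int (sign q) * x \<sigma>"
begin

text \<open>Let e and e' share a column of \<mu> and let g send both to one row of \<alpha>. The row
  transposition of g e and g e' composed with g equals g composed with the column transposition of e
  and e'. The former leaves x g unchanged and the latter negates it.\<close>

lemma vanishes_if_not_inj:
  assumes g: "g permutes {1..sum_list \<mu>}"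
    and "\<not> inj_on (\<lambda>e. (row_of \<alpha> (g e), col_of \<mu> e)) {1..sum_list \<mu>}"
  shows "x g = 0"
proof -
  obtain e e' where e: "e \<in> {1..sum_list \<mu>}" "e' \<in> {1..sum_list \<mu>}" "e \<noteq> e'"
    "row_of \<alpha> (g e) = row_of \<alpha> (g e')" "col_of \<mu> e = col_of \<mu> e'"
    using assms(2) by (auto simp: inj_on_def)
  have "transpose (g e) (g e') \<in> row_group \<alpha>"
    using e permutes_in_image[OF g] size by (intro transpose_in_row_group) simp_all
  moreover have "transpose (g e) (g e') \<circ> g = g \<circ> transpose e e'"
    using permutes_inj[OF g] by (auto simp: fun_eq_iff transpose_def inj_eq)
  moreover have "transpose e e' \<in> column_group \<mu>"
    using e by (intro transpose_in_column_group)
  ultimately have "x g = - x g"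
    using row_inv[of "transpose (g e) (g e')" g] col_inv[of "transpose e e'" g] e
    by (simp add: sign_swap_id)
  then show ?thesis by simp
qed

lemma young_vanishing:
  assumes "x \<in> group_algebra (sum_list \<mu>)" and "sum_list (take i \<alpha>) > sum_list (take i \<mu>)"
  shows "x = 0"
proof
  fix g
  show "x g = 0 g"
  proof (cases "g permutes {1..sum_list \<mu>}")
    case True
    then show ?thesis
      using vanishes_if_not_inj[OF True] dominance[OF sorted size True] assms(2) leD by fastforce
  qed (use assms(1) in \<open>simp add: group_algebra_def\<close>)
qed

end

text \<open>x and the symmetrizer obey the same two rules. These force 0 at every g that is not a
  product p q, and they determine the value at p q from the value at the identity.\<close>

lemma young_multiple:
  fixes x :: "(nat \<Rightarrow> nat) \<Rightarrow> 'k::field_char_0"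
  assumes sorted: "sorted_wrt (\<ge>) \<mu>"
    and row_inv: "\<And>p \<sigma>. p \<in> row_group \<mu> \<Longrightarrow> x (p \<circ> \<sigma>) = x \<sigma>"
    and col_inv: "\<And>q \<sigma>. q \<in> column_group \<mu> \<Longrightarrow> x (\<sigma> \<circ> q) = of_int (sign q) * x \<sigma>"
    and x: "x \<in> group_algebra (sum_list \<mu>)"
  shows "x = (\<lambda>\<sigma>. x id * young_symmetrizer \<mu> \<sigma>)"
proof
  fix g
  show "x g = x id * young_symmetrizer \<mu> g"
  proof (cases "g permutes {1..sum_list \<mu>}")
    case False
    then show ?thesis using x young_symmetrizer_in[OF refl, of \<mu>, where ?'a = 'k] by (simp add: group_algebra_def)
  next
    case g: True
    show ?thesis
    proof (cases "inj_on (\<lambda>e. (row_of \<mu> (g e), col_of \<mu> e)) {1..sum_list \<mu>}")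
      case False
      then show ?thesis
        using vanishes_if_not_inj[OF sorted refl row_inv col_inv g]
          vanishes_if_not_inj[where x = "young_symmetrizer \<mu> :: _ \<Rightarrow> 'k",
            OF sorted refl young_symmetrizer_left young_symmetrizer_right g]
        by simp
    next
      case True
      from row_column_factorization[OF sorted refl g True refl]
      obtain p q where pq: "p \<in> row_group \<mu>" "q \<in> column_group \<mu>" "g = p \<circ> q" by metis
      have "x g = of_int (sign q) * x id"
        using row_inv[OF pq(1), of q] col_inv[OF pq(2), of id] pq(3) by simp
      moreover have "young_symmetrizer \<mu> g = (of_int (sign q) :: 'k)"
        using young_symmetrizer_right[OF pq(2), of id, where ?'a = 'k] pq(3)
        by (simp add: young_symmetrizer_id young_symmetrizer_left[OF pq(1)])
      ultimately show ?thesis by simp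
    qed
  qed
qed

lemma row_column_vanishing:
  fixes y :: "(nat \<Rightarrow> nat) \<Rightarrow> 'k::field_char_0"
  assumes "sorted_wrt (\<ge>) \<mu>" "sum_list \<alpha> = n" "sum_list \<mu> = n"
    and "sum_list (take i \<alpha>) > sum_list (take i \<mu>)"
  shows "group_algebra_mult n (row_sum \<alpha>) (group_algebra_mult n y (column_sum \<mu>)) = 0"
proof (rule young_vanishing[OF assms(1)])
  let ?x = "group_algebra_mult n (row_sum \<alpha>) (group_algebra_mult n y (column_sum \<mu>))"
  show "sum_list \<alpha> = sum_list \<mu>" using assms by simp
  show "?x (p \<circ> \<sigma>) = ?x \<sigma>" if "p \<in> row_group \<alpha>" for p \<sigma>
    using row_sum_mult_left[OF that] assms(2) by simp
  show "?x (\<sigma> \<circ> q) = of_int (sign q) * ?x \<sigma>" if "q \<in> column_group \<mu>" for q \<sigma>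
    using column_sum_mult_right[OF that] by (simp add: gmult_assoc[symmetric])
  show "?x \<in> group_algebra (sum_list \<mu>)"
    using assms(3) by (simp add: group_algebra_mult_closed column_sum_in)
qed (rule assms)

lemma row_column_multiple:
  fixes y :: "(nat \<Rightarrow> nat) \<Rightarrow> 'k::field_char_0"
  assumes "sorted_wrt (\<ge>) \<mu>" "sum_list \<mu> = n"
  shows "\<exists>t. group_algebra_mult n (row_sum \<mu>) (group_algebra_mult n y (column_sum \<mu>))
    = (\<lambda>\<sigma>. t * young_symmetrizer \<mu> \<sigma>)"
proof (rule exI, rule young_multiple[OF assms(1)])
  let ?x = "group_algebra_mult n (row_sum \<mu>) (group_algebra_mult n y (column_sum \<mu>))"
  show "?x (p \<circ> \<sigma>) = ?x \<sigma>" if "p \<in> row_group \<mu>" for p \<sigma>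
    using row_sum_mult_left[OF that] assms(2) by simp
  show "?x (\<sigma> \<circ> q) = of_int (sign q) * ?x \<sigma>" if "q \<in> column_group \<mu>" for q \<sigma>
    using column_sum_mult_right[OF that] by (simp add: gmult_assoc[symmetric])
  show "?x \<in> group_algebra (sum_list \<mu>)"
    using assms(2) by (simp add: group_algebra_mult_closed column_sum_in)
qed

text \<open>c y c = a (b y a) b, so \<open>row_column_multiple\<close> applies with b y a in the
  middle.\<close>

lemma young_symmetrizer_sandwich:
  fixes y :: "(nat \<Rightarrow> nat) \<Rightarrow> 'k::field_char_0"
  assumes "sorted_wrt (\<ge>) \<mu>" "sum_list \<mu> = n"
  shows "\<exists>t. group_algebra_mult n (young_symmetrizer \<mu>) (group_algebra_mult n y (young_symmetrizer \<mu>))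
    = (\<lambda>\<sigma>. t * young_symmetrizer \<mu> \<sigma>)"
  using row_column_multiple[OF assms, of "group_algebra_mult n (column_sum \<mu>) (group_algebra_mult n y (row_sum \<mu>))"]
  by (simp add: young_symmetrizer_eq assms gmult_assoc)

lemma star_row_sum: "sum_list \<mu> = n \<Longrightarrow> star n (row_sum \<mu>) = row_sum \<mu>"
  by (auto simp: fun_eq_iff star_def row_sum_def row_group_inv_iff permutes_bij row_group_permutes)

lemma star_column_sum:
  assumes "sum_list \<mu> = n"
  shows "star n (column_sum \<mu>) = column_sum \<mu>"
proof
  fix \<sigma>
  have "sign (inv \<sigma>) = sign \<sigma>" if "\<sigma> permutes {1..n}"
    using that by (intro sign_inverse) (auto simp: permutation_permutes)
  then show "star n (column_sum \<mu>) \<sigma> = column_sum \<mu> \<sigma>"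
    using assms by (auto simp: star_def column_sum_def column_group_inv_iff permutes_bij column_group_permutes)
qed

lemma star_eq_0_iff: "x \<in> group_algebra n \<Longrightarrow> star n x = 0 \<longleftrightarrow> x = 0"
proof
  assume "x \<in> group_algebra n" "star n x = 0"
  then have "x = star n 0" using star_star by metis
  then show "x = 0" by (auto simp: star_def fun_eq_iff)
qed (auto simp: star_def fun_eq_iff)

text \<open>This is \<open>row_column_vanishing\<close> seen through \<open>star\<close>, which
  reverses products and fixes row sums and column sums.\<close>

lemma column_row_vanishing:
  fixes y :: "(nat \<Rightarrow> nat) \<Rightarrow> 'k::field_char_0"
  assumes "sorted_wrt (\<ge>) \<alpha>" "sum_list \<alpha> = n" "sum_list \<mu> = n"
    and "sum_list (take i \<mu>) > sum_list (take i \<alpha>)"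
  shows "group_algebra_mult n (column_sum \<alpha>) (group_algebra_mult n y (row_sum \<mu>)) = 0"
proof -
  \<comment> \<open>Applying \<open>star\<close> twice cuts y off outside S_n, where its values do
    not enter a convolution with y on the left. The result lies in \<open>group_algebra n\<close>,
    as \<open>star_mult\<close> requires.\<close>
  let ?y = "star n (star n y)"
  have y: "group_algebra_mult n y (row_sum \<mu>) = group_algebra_mult n ?y (row_sum \<mu>)"
    unfolding group_algebra_mult_def
    by (intro ext sum.cong) (auto simp: star_def permutes_inv permutes_inv_inv')
  have "star n (group_algebra_mult n (column_sum \<alpha>) (group_algebra_mult n ?y (row_sum \<mu>)))
    = group_algebra_mult n (row_sum \<mu>) (group_algebra_mult n (star n y) (column_sum \<alpha>))"
    using assms
    by (simp add: star_mult group_algebra_mult_closed star_in star_star gmult_assoc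
        row_sum_in column_sum_in star_row_sum star_column_sum)
  also have "\<dots> = 0" by (rule row_column_vanishing) (use assms in auto)
  finally show ?thesis
    unfolding y
    using star_eq_0_iff group_algebra_mult_closed row_sum_in[OF assms(3)] by metis
qed

text \<open>The product is a_\<alpha> (b_\<alpha> y a_\<mu>) b_\<mu>. If \<alpha> has the larger
  partial sum, the outer factors a_\<alpha> and b_\<mu> kill whatever stands between them; otherwise
  the inner factor is already 0.\<close>

lemma young_symmetrizer_orthogonal:
  fixes y :: "(nat \<Rightarrow> nat) \<Rightarrow> 'k::field_char_0"
  assumes "sorted_wrt (\<ge>) \<alpha>" "sum_list \<alpha> = n" "sorted_wrt (\<ge>) \<mu>" "sum_list \<mu> = n"
    and "sum_list (take i \<mu>) \<noteq> sum_list (take i \<alpha>)"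
  shows "group_algebra_mult n (young_symmetrizer \<alpha>) (group_algebra_mult n y (young_symmetrizer \<mu>)) = 0"
proof -
  let ?m = "group_algebra_mult n"
  have *: "?m (young_symmetrizer \<alpha>) (?m y (young_symmetrizer \<mu>))
    = ?m (row_sum \<alpha>) (?m (column_sum \<alpha>) (?m y (?m (row_sum \<mu>) (column_sum \<mu>))))"
    by (simp add: young_symmetrizer_eq assms gmult_assoc)
  show ?thesis
  proof (cases "sum_list (take i \<mu>) < sum_list (take i \<alpha>)")
    case True
    then show ?thesis
      unfolding * using row_column_vanishing[OF assms(3,2,4) True, of "?m (column_sum \<alpha>) (?m y (row_sum \<mu>))"]
      by (simp add: gmult_assoc)
  next
    case False
    then have "sum_list (take i \<alpha>) < sum_list (take i \<mu>)" using assms(5) by simp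
    from column_row_vanishing[OF assms(1,2,4) this, of y]
    have "?m (?m (column_sum \<alpha>) (?m y (row_sum \<mu>))) (column_sum \<mu>) = 0"
      by simp
    then show ?thesis unfolding * by (simp add: gmult_assoc)
  qed
qed

section \<open>Squares of row sums, column sums and Young symmetrizers\<close>

lemma row_sum_square:
  "group_algebra_mult (sum_list \<mu>) (row_sum \<mu>) (row_sum \<mu>)
    = (\<lambda>\<sigma>. of_nat (card (row_group \<mu>)) * (row_sum \<mu> \<sigma> :: 'k::field))"
proof
  fix \<sigma>
  have "group_algebra_mult (sum_list \<mu>) (row_sum \<mu>) (row_sum \<mu>) \<sigma>
    = (\<Sum>p \<in> row_group \<mu>. row_sum \<mu> \<sigma> :: 'k)"
    unfolding group_algebra_mult_def
    by (rule sum.mono_neutral_cong_right)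
       (auto simp: finite_permutations row_group_permutes row_sum_left row_group_inv,
        auto simp: row_sum_def)
  then show "group_algebra_mult (sum_list \<mu>) (row_sum \<mu>) (row_sum \<mu>) \<sigma>
    = of_nat (card (row_group \<mu>)) * (row_sum \<mu> \<sigma> :: 'k)"
    by simp
qed

lemma column_sum_square:
  "group_algebra_mult (sum_list \<mu>) (column_sum \<mu>) (column_sum \<mu>)
    = (\<lambda>\<sigma>. of_nat (card (column_group \<mu>)) * (column_sum \<mu> \<sigma> :: 'k::field))"
proof
  fix \<sigma>
  have sq: "column_sum \<mu> p * column_sum \<mu> (inv p \<circ> \<sigma>) = (column_sum \<mu> \<sigma> :: 'k)"
    if p: "p \<in> column_group \<mu>" for p
  proof -
    have "sign (inv p) = sign p"
      using column_group_permutes[OF p] by (intro sign_inverse) (auto simp: permutation_permutes)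
    then have "column_sum \<mu> p * of_int (sign (inv p)) = (1 :: 'k)"
      using p by (simp add: column_sum_def of_int_mult[symmetric] del: of_int_mult)
    then show ?thesis
      by (simp add: column_sum_left column_group_inv p mult.assoc[symmetric])
  qed
  have "group_algebra_mult (sum_list \<mu>) (column_sum \<mu>) (column_sum \<mu>) \<sigma>
    = (\<Sum>p \<in> column_group \<mu>. column_sum \<mu> \<sigma> :: 'k)"
    unfolding group_algebra_mult_def
    by (rule sum.mono_neutral_cong_right)
       (auto simp: finite_permutations column_group_permutes sq, auto simp: column_sum_def)
  then show "group_algebra_mult (sum_list \<mu>) (column_sum \<mu>) (column_sum \<mu>) \<sigma>
    = of_nat (card (column_group \<mu>)) * (column_sum \<mu> \<sigma> :: 'k)"
    by simp
qed

lemma group_algebra_mult_Ints: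
  "(\<And>\<sigma>. x \<sigma> \<in> \<int>) \<Longrightarrow> (\<And>\<sigma>. y \<sigma> \<in> \<int>) \<Longrightarrow> group_algebra_mult n x y \<sigma> \<in> \<int>"
  by (auto simp: group_algebra_mult_def)

lemma row_sum_Ints: "row_sum \<mu> \<sigma> \<in> \<int>" and column_sum_Ints: "column_sum \<mu> \<sigma> \<in> \<int>"
  by (auto simp: row_sum_def column_sum_def)

lemma young_symmetrizer_Ints: "young_symmetrizer \<mu> \<sigma> \<in> \<int>"
  by (simp add: young_symmetrizer_eq group_algebra_mult_Ints row_sum_Ints column_sum_Ints)

lemma star_Ints: "(\<And>\<sigma>. x \<sigma> \<in> \<int>) \<Longrightarrow> star n x \<sigma> \<in> \<int>"
  by (simp add: star_def)

text \<open>Positivity replaces the usual trace computation. The element u = c (star c) is nonzero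
  and fixed by \<open>star\<close>, so u u \<noteq> 0. As c = a b and star c = b a, the product u u
  is a multiple of c c a, whence c c \<noteq> 0.\<close>

lemma young_symmetrizer_idempotent:
  fixes \<mu> :: "nat list"
  assumes "sorted_wrt (\<ge>) \<mu>" "sum_list \<mu> = n"
  obtains t :: "'k::field_char_0" where "t \<noteq> 0"
    "group_algebra_mult n (young_symmetrizer \<mu>) (young_symmetrizer \<mu>) = (\<lambda>\<sigma>. t * young_symmetrizer \<mu> \<sigma>)"
proof -
  let ?m = "group_algebra_mult n :: _ \<Rightarrow> _ \<Rightarrow> _ \<Rightarrow> 'k"
  let ?a = "row_sum \<mu> :: _ \<Rightarrow> 'k" and ?b = "column_sum \<mu> :: _ \<Rightarrow> 'k"
  let ?c = "young_symmetrizer \<mu> :: _ \<Rightarrow> 'k"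
  let ?u = "?m ?c (star n ?c)"
  have in_n: "?a \<in> group_algebra n" "?b \<in> group_algebra n" "?c \<in> group_algebra n"
    using assms(2) by (auto intro: row_sum_in column_sum_in young_symmetrizer_in)
  have c: "?c = ?m ?a ?b" using young_symmetrizer_eq assms(2) by metis
  have star_c: "star n ?c = ?m ?b ?a"
    unfolding c using star_mult[OF in_n(1,2)] star_row_sum[OF assms(2)] star_column_sum[OF assms(2)] by metis
  have "?c \<noteq> 0" using young_symmetrizer_id[of \<mu>, where 'k = 'k] by (metis zero_fun_apply zero_neq_one)
  then have u0: "?u \<noteq> 0" using mult_star_nonzero in_n young_symmetrizer_Ints by blast
  have u: "?u \<in> group_algebra n" by (rule group_algebra_mult_closed[OF star_in])
  have star_u: "star n ?u = ?u"
    using star_mult[OF in_n(3) star_in] star_star[OF in_n(3)] by metis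
  have "?m ?u (star n ?u) \<noteq> 0"
    using mult_star_nonzero[OF u u0] group_algebra_mult_Ints young_symmetrizer_Ints star_Ints by blast
  moreover have "?m ?u ?u = (\<lambda>\<sigma>. of_nat (card (column_group \<mu>)) * (of_nat (card (column_group \<mu>)) *
      (of_nat (card (row_group \<mu>)) * ?m (?m ?c ?c) ?a \<sigma>)))"
  proof -
    have bb: "?m ?b (?m ?b y) = (\<lambda>\<sigma>. of_nat (card (column_group \<mu>)) * ?m ?b y \<sigma>)" for y
      using column_sum_square[of \<mu>, where 'k = 'k] assms(2)
      by (simp add: gmult_assoc[symmetric] regular.act_scale_left)
    have aa: "?m ?a (?m ?a y) = (\<lambda>\<sigma>. of_nat (card (row_group \<mu>)) * ?m ?a y \<sigma>)" for y
      using row_sum_square[of \<mu>, where 'k = 'k] assms(2)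
      by (simp add: gmult_assoc[symmetric] regular.act_scale_left)
    show ?thesis
      unfolding star_c unfolding c
      by (simp only: gmult_assoc bb regular.act_scale_right[OF UNIV_I] regular.act_scale_left aa)
  qed
  ultimately have "?m (?m ?c ?c) ?a \<noteq> 0"
    unfolding star_u by (auto simp: fun_eq_iff)
  then have cc: "?m ?c ?c \<noteq> 0" by auto
  obtain t where t: "?m ?c (?m (\<lambda>\<sigma>. if \<sigma> = id then 1 else 0) ?c) = (\<lambda>\<sigma>. t * ?c \<sigma>)"
    using young_symmetrizer_sandwich[OF assms] by blast
  then have "?m ?c ?c = (\<lambda>\<sigma>. t * ?c \<sigma>)" by (simp add: regular.act_one)
  moreover from this cc have "t \<noteq> 0" by (auto simp: fun_eq_iff)
  ultimately show ?thesis using that by blast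
qed

section \<open>Cycle types\<close>

lemma orbit_enumeration:
  assumes "permutation f"
  shows "bij_betw (\<lambda>j. (f ^^ j) x) {..<card (orbit f x)} (orbit f x)"
    and "(f ^^ card (orbit f x)) x = x"
proof -
  have x: "x \<in> orbit f x" by (rule permutation_self_in_orbit[OF assms])
  have *: "bij_betw (\<lambda>j. (f ^^ j) x) {0..<funpow_dist1 f x x} (orbit f x)"
    unfolding bij_betw_def using inj_on_funpow_dist1[OF x] orbit_conv_funpow_dist1[OF x] by blast
  from bij_betw_same_card[OF this] have card: "card (orbit f x) = funpow_dist1 f x x"
    by (simp only: card_atLeastLessThan diff_zero)
  show "bij_betw (\<lambda>j. (f ^^ j) x) {..<card (orbit f x)} (orbit f x)"
    using * by (simp only: card atLeast0LessThan)
  show "(f ^^ card (orbit f x)) x = x"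
    using funpow_dist1_prop[OF x] by (simp only: card)
qed

text \<open>The shape of V(\<nu>)_n. For n = 0 and empty \<nu> it is \<open>[0]\<close>, a diagram
  with one empty row.\<close>

definition padded :: "nat \<Rightarrow> nat list \<Rightarrow> nat list" where
  "padded n \<nu> = (n - sum_list \<nu>) # \<nu>"

text \<open>For a bijective filling h this encodes the cycle decomposition of \<sigma>: each row
  lists one cycle.\<close>

definition rotates_rows :: "nat list \<Rightarrow> (nat \<Rightarrow> nat) \<Rightarrow> (nat \<times> nat \<Rightarrow> nat) \<Rightarrow> bool" where
  "rotates_rows \<mu> \<sigma> h \<longleftrightarrow> (\<forall>(i, j) \<in> young_cells \<mu>. \<sigma> (h (i, j)) = h (i, Suc j mod \<mu> ! i))"

lemma cycle_decomposition_list: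
  assumes \<sigma>: "\<sigma> permutes S" and S: "finite S"
  obtains \<mu> h where "sorted_wrt (\<ge>) \<mu>" "0 \<notin> set \<mu>" "bij_betw h (young_cells \<mu>) S"
    "rotates_rows \<mu> \<sigma> h"
proof -
  have perm: "permutation \<sigma>" using \<sigma> S by (auto simp: permutation_permutes)
  define O' where "O' = orbit \<sigma> ` S"
  have "finite O'" using S by (simp add: O'_def)
  then obtain xs where xs: "set xs = O'" "distinct xs" using finite_distinct_list by blast
  \<comment> \<open>The negated key puts the orbits in order of decreasing size.\<close>
  define os where "os = sort_key (\<lambda>X. - int (card X)) xs"
  have os: "set os = O'" "distinct os" using xs by (simp_all add: os_def)
  have "sorted (map (\<lambda>X. - int (card X)) os)" unfolding os_def by (rule sorted_sort_key)
  then have sorted: "sorted_wrt (\<ge>) (map card os)" by (simp add: sorted_wrt_map)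
  have fin: "finite X" "X \<noteq> {}" if "X \<in> O'" for X
  proof -
    from that obtain x where X: "X = orbit \<sigma> x" by (auto simp: O'_def)
    have "x \<in> orbit \<sigma> x" by (rule permutation_self_in_orbit[OF perm])
    then show "finite X" "X \<noteq> {}" using finite_orbit X by fast+
  qed
  then have pos: "0 \<notin> set (map card os)" using os by auto
  define r where "r X = (SOME x. x \<in> X)" for X :: "nat set"
  have r: "X = orbit \<sigma> (r X)" if "X \<in> O'" for X
  proof -
    from that obtain x where x: "X = orbit \<sigma> x" by (auto simp: O'_def)
    have "r X \<in> X" unfolding r_def using fin(2)[OF that] by (simp add: some_in_eq)
    then show ?thesis using orbit_cyclic_eq3[OF cyclic_on_orbit'[OF perm]] x by metis
  qed
  define h where "h = (\<lambda>(i, j). (\<sigma> ^^ j) (r (os ! i)))"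
  have nth: "os ! i \<in> O'" if "i < length os" for i using that os nth_mem by blast
  have cells: "young_cells (map card os) = (SIGMA i:{..<length os}. {..<card (os ! i)})"
    by (auto simp: young_cells_def)
  have enum: "bij_betw (\<lambda>j. h (i, j)) {..<card (os ! i)} (os ! i)"
    and period: "(\<sigma> ^^ card (os ! i)) (r (os ! i)) = r (os ! i)" if "i < length os" for i
    using orbit_enumeration[OF perm, of "r (os ! i)"] r[OF nth[OF that]] by (simp_all add: h_def)
  have disj: "os ! i \<inter> os ! i' = {}" if "i < length os" "i' < length os" "i \<noteq> i'" for i i'
  proof (rule ccontr)
    assume "os ! i \<inter> os ! i' \<noteq> {}"
    then obtain y where "y \<in> os ! i" "y \<in> os ! i'" by blast
    then have "os ! i = orbit \<sigma> y" "os ! i' = orbit \<sigma> y"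
      using r[OF nth[OF that(1)]] r[OF nth[OF that(2)]] orbit_cyclic_eq3[OF cyclic_on_orbit'[OF perm]]
      by metis+
    then show False using that os(2) nth_eq_iff_index_eq by metis
  qed
  have "inj_on h (young_cells (map card os))"
  proof (rule inj_onI, clarify)
    fix i j i' j'
    assume ij: "(i, j) \<in> young_cells (map card os)" and ij': "(i', j') \<in> young_cells (map card os)"
      and eq: "h (i, j) = h (i', j')"
    have "h (i, j) \<in> os ! i" "h (i', j') \<in> os ! i'"
      using ij ij' enum unfolding cells bij_betw_def by blast+
    then have "i = i'" using disj ij ij' eq unfolding cells by auto
    then show "i = i' \<and> j = j'"
      using enum[of i] ij ij' eq unfolding cells bij_betw_def inj_on_def by auto
  qed
  moreover have "h ` young_cells (map card os) = S"
  proof -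
    have "h ` young_cells (map card os) = (\<Union>i<length os. (\<lambda>j. h (i, j)) ` {..<card (os ! i)})"
      unfolding cells by force
    also have "\<dots> = (\<Union>i<length os. os ! i)"
      using enum by (simp add: bij_betw_def)
    also have "\<dots> = \<Union>O'" using os(1) by (auto simp: set_conv_nth)
    also have "\<dots> = S"
      using permutes_orbit_subset[OF \<sigma>] permutation_self_in_orbit[OF perm] by (auto simp: O'_def)
    finally show ?thesis .
  qed
  moreover have "rotates_rows (map card os) \<sigma> h"
    unfolding rotates_rows_def
  proof clarify
    fix i j assume ij: "(i, j) \<in> young_cells (map card os)"
    then have i: "i < length os" and j: "j < card (os ! i)" by (auto simp: young_cells_def)
    show "\<sigma> (h (i, j)) = h (i, Suc j mod map card os ! i)"
    proof (cases "Suc j = card (os ! i)")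
      case True
      then show ?thesis using period[OF i] i by (simp add: h_def flip: True)
    next
      case False
      then show ?thesis using i j by (simp add: h_def)
    qed
  qed
  ultimately show ?thesis using that[OF sorted pos] by (simp add: bij_betw_def)
qed

section \<open>The shapes of size n\<close>

lemma padded_sorted: "\<nu> \<in> admissible n \<Longrightarrow> sorted_wrt (\<ge>) (padded n \<nu>)"
proof -
  assume \<nu>: "\<nu> \<in> admissible n"
  then have "sorted_wrt (\<ge>) \<nu>" "sum_list \<nu> + first_part \<nu> \<le> n"
    by (auto simp: admissible_def is_partition_def)
  moreover from this have "x \<le> n - sum_list \<nu>" if "x \<in> set \<nu>" for x
    using that by (cases \<nu>) (fastforce simp: first_part_def)+
  ultimately show ?thesis by (auto simp: padded_def)
qed

lemma padded_size: "\<nu> \<in> admissible n \<Longrightarrow> sum_list (padded n \<nu>) = n"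
  by (simp add: padded_def admissible_def)

lemma length_le_sum_list: "0 \<notin> set \<nu> \<Longrightarrow> length \<nu> \<le> sum_list (\<nu> :: nat list)"
  by (induction \<nu>) (auto simp: Suc_le_eq)

lemma finite_partitions: "finite {\<nu>. is_partition \<nu> \<and> sum_list \<nu> \<le> n}"
proof (rule finite_subset)
  show "{\<nu>. is_partition \<nu> \<and> sum_list \<nu> \<le> n} \<subseteq> {\<nu>. set \<nu> \<subseteq> {..n} \<and> length \<nu> \<le> n}"
    using length_le_sum_list member_le_sum_list
    by (fastforce simp: is_partition_def intro: order_trans)
qed (simp add: finite_lists_length_le)

lemma finite_admissible: "finite (admissible n)"
  by (rule finite_subset[OF _ finite_partitions[of n]]) (auto simp: admissible_def)

lemma take_sums_determine:
  assumes "0 \<notin> set xs" "0 \<notin> set ys" "\<And>i. sum_list (take i xs) = sum_list (take i (ys :: nat list))"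
  shows "xs = ys"
  using assms
proof (induction xs arbitrary: ys)
  case Nil
  then show ?case using Nil(3)[of "Suc 0"] by (cases ys) auto
next
  case (Cons x xs)
  from Cons.prems(1) Cons.prems(3)[of "Suc 0"] obtain y ys' where ys: "ys = y # ys'"
    by (cases ys) auto
  have "x = y" using Cons.prems(3)[of "Suc 0"] ys by simp
  moreover have "xs = ys'"
    by (rule Cons.IH) (use Cons.prems ys \<open>x = y\<close> Cons.prems(3)[of "Suc i" for i] in auto)
  ultimately show ?case using ys by simp
qed

text \<open>Equal partial sums would give equal first rows, and then \<nu> and \<nu>' agree because
  their parts are positive. A differing partial sum is what
  \<open>young_symmetrizer_orthogonal\<close> asks for.\<close>

lemma padded_distinct:
  assumes "\<nu> \<in> admissible n" "\<nu>' \<in> admissible n" "\<nu> \<noteq> \<nu>'"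
  obtains i where "sum_list (take i (padded n \<nu>)) \<noteq> sum_list (take i (padded n \<nu>'))"
proof -
  have "\<exists>i. sum_list (take i (padded n \<nu>)) \<noteq> sum_list (take i (padded n \<nu>'))"
  proof (rule ccontr)
    assume "\<not> ?thesis"
    then have eq: "sum_list (take i (padded n \<nu>)) = sum_list (take i (padded n \<nu>'))" for i by blast
    have "n - sum_list \<nu> = n - sum_list \<nu>'" using eq[of "Suc 0"] by (simp add: padded_def)
    then have "sum_list (take i \<nu>) = sum_list (take i \<nu>')" for i
      using eq[of "Suc i"] by (simp add: padded_def)
    then have "\<nu> = \<nu>'"
      using assms by (intro take_sums_determine) (auto simp: admissible_def is_partition_def)
    with assms show False by simp
  qed
  then show ?thesis using that by blast
qed

definition has_cycle_type :: "nat \<Rightarrow> (nat \<Rightarrow> nat) \<Rightarrow> nat list \<Rightarrow> bool" where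
  "has_cycle_type n \<sigma> \<nu> \<longleftrightarrow>
     (\<exists>h. bij_betw h (young_cells (padded n \<nu>)) {1..n} \<and> rotates_rows (padded n \<nu>) \<sigma> h)"

lemma cycle_type_exists:
  assumes \<sigma>: "\<sigma> permutes {1..n}"
  obtains \<nu> where "\<nu> \<in> admissible n" "has_cycle_type n \<sigma> \<nu>"
proof -
  obtain \<mu> h where \<mu>: "sorted_wrt (\<ge>) \<mu>" "0 \<notin> set \<mu>" "bij_betw h (young_cells \<mu>) {1..n}"
    "rotates_rows \<mu> \<sigma> h"
    using cycle_decomposition_list[OF \<sigma>] by auto
  have size: "sum_list \<mu> = n"
    using bij_betw_same_card[OF \<mu>(3)] bij_betw_same_card[OF bij_betw_young_entry[of \<mu>]] by simp
  define \<nu> where "\<nu> = tl \<mu>"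
  show ?thesis
  proof (cases \<mu>)
    case Nil
    then have n: "n = 0" using size by simp
    have "[] \<in> admissible n" "has_cycle_type n \<sigma> []"
      using n by (auto simp: admissible_def is_partition_def first_part_def has_cycle_type_def
          rotates_rows_def padded_def young_cells_def bij_betw_def)
    then show ?thesis using that by blast
  next
    case (Cons m \<nu>)
    then have "padded n \<nu> = \<mu>" using size by (simp add: padded_def)
    moreover have "\<nu> \<in> admissible n"
      using \<mu> Cons size by (cases \<nu>) (auto simp: admissible_def is_partition_def first_part_def)
    ultimately show ?thesis using that \<mu> unfolding has_cycle_type_def by blast
  qed
qed

text \<open>Given fillings h for \<sigma> and k for \<tau>, take g = h k^-1: both permutations step
  along the rows of the diagram in the same way.\<close>

lemma conjugate_if_same_cycle_type:
  assumes \<sigma>: "\<sigma> permutes {1..n}" and \<tau>: "\<tau> permutes {1..n}"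
    and "has_cycle_type n \<sigma> \<nu>" "has_cycle_type n \<tau> \<nu>"
  obtains g where "g permutes {1..n}" "\<tau> = inv g \<circ> \<sigma> \<circ> g"
proof -
  let ?\<mu> = "padded n \<nu>"
  obtain h k where h: "bij_betw h (young_cells ?\<mu>) {1..n}" "rotates_rows ?\<mu> \<sigma> h"
    and k: "bij_betw k (young_cells ?\<mu>) {1..n}" "rotates_rows ?\<mu> \<tau> k"
    using assms(3,4) unfolding has_cycle_type_def by blast
  define g where "g e = (if e \<in> {1..n} then h (inv_into (young_cells ?\<mu>) k e) else e)" for e
  have "bij_betw (h \<circ> inv_into (young_cells ?\<mu>) k) {1..n} {1..n}"
    using bij_betw_trans[OF bij_betw_inv_into[OF k(1)] h(1)] .
  then have "bij_betw g {1..n} {1..n}"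
    by (rule iffD1[OF bij_betw_cong, rotated]) (simp add: g_def)
  then have g: "g permutes {1..n}" by (rule bij_imp_permutes) (simp only: g_def if_False)
  have gk: "g (k c) = h c" if "c \<in> young_cells ?\<mu>" for c
    using that k(1) bij_betw_inv_into_left[OF k(1)] bij_betwE[OF k(1)] by (simp only: g_def if_True)
  have "\<sigma> (g e) = g (\<tau> e)" for e
  proof (cases "e \<in> {1..n}")
    case True
    then obtain i j where ij: "(i, j) \<in> young_cells ?\<mu>" "e = k (i, j)"
      using k(1) unfolding bij_betw_def by (metis imageE surj_pair)
    have nxt: "(i, Suc j mod ?\<mu> ! i) \<in> young_cells ?\<mu>" using ij(1) by (auto simp: young_cells_def)
    have "\<sigma> (g e) = h (i, Suc j mod ?\<mu> ! i)" "\<tau> e = k (i, Suc j mod ?\<mu> ! i)"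
      using h(2) k(2) ij gk[OF ij(1)] unfolding rotates_rows_def by fastforce+
    then show ?thesis using gk[OF nxt] by simp
  next
    case False
    then show ?thesis
      using permutes_not_in[OF g] permutes_not_in[OF \<sigma>] permutes_not_in[OF \<tau>] by simp
  qed
  then have "\<tau> = inv g \<circ> \<sigma> \<circ> g"
    using permutes_inverses[OF g] by (simp add: fun_eq_iff)
  then show ?thesis using that g by blast
qed

section \<open>Central elements and the resolution of the identity\<close>

text \<open>The sum of all conjugates of the symmetrizer, written as a class function;
  \<open>central_young_eq\<close> gives it as a sum of products.\<close>

definition central_young :: "nat \<Rightarrow> nat list \<Rightarrow> (nat \<Rightarrow> nat) \<Rightarrow> 'k::field" where
  "central_young n \<nu> =
     (\<lambda>\<sigma>. \<Sum>g | g permutes {1..n}. young_symmetrizer (padded n \<nu>) (inv g \<circ> \<sigma> \<circ> g))"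

lemma padded_symmetrizer_in: "\<nu> \<in> admissible n \<Longrightarrow> young_symmetrizer (padded n \<nu>) \<in> group_algebra n"
  by (rule young_symmetrizer_in[OF padded_size])

lemma central_young_eq:
  assumes "\<nu> \<in> admissible n"
  shows "central_young n \<nu> = (\<Sum>g | g permutes {1..n}. group_algebra_mult n (delta g)
    (group_algebra_mult n (young_symmetrizer (padded n \<nu>)) (delta (inv g))))"
proof
  fix \<sigma>
  show "central_young n \<nu> \<sigma> = (\<Sum>g | g permutes {1..n}. group_algebra_mult n (delta g)
    (group_algebra_mult n (young_symmetrizer (padded n \<nu>)) (delta (inv g)))) \<sigma>"
    unfolding central_young_def sum_fun_apply
    by (intro sum.cong refl)
       (auto simp: delta_mult mult_delta permutes_inv permutes_inv_inv' padded_symmetrizer_in assms)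
qed

lemma permutes_conj_iff:
  assumes "g permutes A"
  shows "(inv g \<circ> \<sigma> \<circ> g) permutes A \<longleftrightarrow> \<sigma> permutes A"
  using permutes_comp_cancel(2)[OF assms] permutes_comp_cancel(1)[OF permutes_inv[OF assms]] by metis

lemma permutes_inv_comp:
  "p permutes A \<Longrightarrow> q permutes A \<Longrightarrow> inv (p \<circ> q) = inv q \<circ> inv p"
  by (rule o_inv_distrib[OF permutes_bij permutes_bij])

lemma central_young_in:
  "\<nu> \<in> admissible n \<Longrightarrow> (central_young n \<nu> :: _ \<Rightarrow> 'k::field) \<in> group_algebra n"
  using padded_symmetrizer_in[of \<nu> n, where ?'a = 'k]
  by (auto simp: central_young_def group_algebra_def permutes_conj_iff intro!: sum.neutral)

lemma central_young_class:
  assumes h: "h permutes {1..n}"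
  shows "central_young n \<nu> (inv h \<circ> \<sigma> \<circ> h) = central_young n \<nu> \<sigma>"
proof -
  have "central_young n \<nu> \<sigma>
    = (\<Sum>g | g permutes {1..n}. young_symmetrizer (padded n \<nu>) (inv (h \<circ> g) \<circ> \<sigma> \<circ> (h \<circ> g)))"
    unfolding central_young_def by (rule setum_permutations_compose_left[OF h])
  also have "\<dots> = central_young n \<nu> (inv h \<circ> \<sigma> \<circ> h)"
    unfolding central_young_def
    by (intro sum.cong refl) (simp add: permutes_inv_comp[OF h] comp_assoc)
  finally show ?thesis ..
qed

text \<open>Substituting \<sigma> \<tau>^-1 for the summation variable of y x pairs x at \<tau> with
  y at \<sigma> \<tau>^-1, which is conjugate to \<tau>^-1 \<sigma>.\<close>

lemma class_function_central:
  assumes x: "x \<in> group_algebra n" and y: "y \<in> group_algebra n"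
    and conj_inv: "\<And>h \<sigma>. h permutes {1..n} \<Longrightarrow> y (inv h \<circ> \<sigma> \<circ> h) = y \<sigma>"
  shows "group_algebra_mult n x y = group_algebra_mult n y x"
proof
  fix \<sigma>
  show "group_algebra_mult n x y \<sigma> = group_algebra_mult n y x \<sigma>"
  proof (cases "\<sigma> permutes {1..n}")
    case True
    have "group_algebra_mult n y x \<sigma>
      = (\<Sum>\<tau> | \<tau> permutes {1..n}. y (\<sigma> \<circ> \<tau>) * x (inv (\<sigma> \<circ> \<tau>) \<circ> \<sigma>))"
      unfolding group_algebra_mult_def by (rule setum_permutations_compose_left[OF True])
    also have "\<dots> = (\<Sum>\<tau> | \<tau> permutes {1..n}. y (\<sigma> \<circ> inv \<tau>) * x (inv (\<sigma> \<circ> inv \<tau>) \<circ> \<sigma>))"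
      by (rule sum_permutations_inverse)
    also have "\<dots> = (\<Sum>\<tau> | \<tau> permutes {1..n}. x \<tau> * y (inv \<tau> \<circ> \<sigma>))"
    proof (intro sum.cong refl, clarify)
      fix \<tau> assume \<tau>: "\<tau> permutes {1..n}"
      have "inv (\<sigma> \<circ> inv \<tau>) \<circ> \<sigma> = \<tau>"
        unfolding permutes_inv_comp[OF True permutes_inv[OF \<tau>]] permutes_inv_inv'[OF \<tau>]
        using permutes_inv_o[OF True] by (simp add: comp_assoc)
      moreover have "y (\<sigma> \<circ> inv \<tau>) = y (inv \<tau> \<circ> \<sigma>)"
        using conj_inv[OF \<tau>, of "\<sigma> \<circ> inv \<tau>"] permutes_inv_o[OF \<tau>] by (simp add: comp_assoc)
      ultimately show "y (\<sigma> \<circ> inv \<tau>) * x (inv (\<sigma> \<circ> inv \<tau>) \<circ> \<sigma>) = x \<tau> * y (inv \<tau> \<circ> \<sigma>)"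
        by simp
    qed
    finally show ?thesis by (simp add: group_algebra_mult_def)
  next
    case False
    then show ?thesis
      using group_algebra_mult_closed[OF x, of y] group_algebra_mult_closed[OF y, of x]
      by (simp add: group_algebra_def)
  qed
qed

lemma padded_symmetrizer_orthogonal:
  fixes y :: "(nat \<Rightarrow> nat) \<Rightarrow> 'k::field_char_0"
  assumes "\<nu> \<in> admissible n" "\<nu>' \<in> admissible n" "\<nu> \<noteq> \<nu>'"
  shows "group_algebra_mult n (young_symmetrizer (padded n \<nu>))
    (group_algebra_mult n y (young_symmetrizer (padded n \<nu>'))) = 0"
proof -
  obtain i where "sum_list (take i (padded n \<nu>')) \<noteq> sum_list (take i (padded n \<nu>))"
    using padded_distinct assms by metis
  then show ?thesis
    using assms by (intro young_symmetrizer_orthogonal) (auto simp: padded_sorted padded_size)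
qed

lemma central_young_orthogonal:
  assumes "\<nu> \<in> admissible n" "\<nu>' \<in> admissible n" "\<nu> \<noteq> \<nu>'"
  shows "group_algebra_mult n (central_young n \<nu>) (central_young n \<nu>' :: _ \<Rightarrow> 'k::field_char_0) = 0"
proof -
  let ?m = "group_algebra_mult n :: _ \<Rightarrow> _ \<Rightarrow> _ \<Rightarrow> 'k"
  let ?c = "\<lambda>\<nu>. young_symmetrizer (padded n \<nu>) :: _ \<Rightarrow> 'k"
  have "?m (?c \<nu>) (?m x (?m y (?m (?c \<nu>') z))) = 0" for x y z
  proof -
    have "?m (?m (?c \<nu>) (?m (?m x y) (?c \<nu>'))) z = 0"
      by (simp add: padded_symmetrizer_orthogonal assms)
    then show ?thesis by (simp only: gmult_assoc)
  qed
  then show ?thesis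
    unfolding central_young_eq[OF assms(1)] central_young_eq[OF assms(2)]
    by (simp add: regular.act_sum_left regular.act_sum_right gmult_assoc)
qed

text \<open>The average z is nonzero, as its coefficient at the identity is n!. Then w = z (star z)
  is nonzero and fixed by \<open>star\<close>, so w w \<noteq> 0. Since z is central, w w has the
  factor z z.\<close>

lemma central_young_square:
  assumes \<nu>: "\<nu> \<in> admissible n"
  shows "group_algebra_mult n (central_young n \<nu>) (central_young n \<nu> :: _ \<Rightarrow> 'k::field_char_0) \<noteq> 0"
proof
  let ?m = "group_algebra_mult n :: _ \<Rightarrow> _ \<Rightarrow> _ \<Rightarrow> 'k"
  define z where "z = (central_young n \<nu> :: _ \<Rightarrow> 'k)"
  assume "?m (central_young n \<nu>) (central_young n \<nu>) = 0"
  then have zz: "?m z z = 0" by (simp add: z_def)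
  have z: "z \<in> group_algebra n" using central_young_in[OF \<nu>] by (simp add: z_def)
  have "z id = of_nat (card {g. g permutes {1..n}})"
  proof -
    have "young_symmetrizer (padded n \<nu>) (inv g \<circ> id \<circ> g) = (1::'k)" if "g permutes {1..n}" for g
      using permutes_inv_o(2)[OF that] by (simp add: young_symmetrizer_id)
    then show ?thesis by (simp add: z_def central_young_def)
  qed
  moreover have "card {g. g permutes {1..n}} \<noteq> 0"
    by (simp add: card_permutations)
  ultimately have z0: "z \<noteq> 0" by (metis of_nat_eq_0_iff zero_fun_apply)
  have int: "z \<sigma> \<in> \<int>" for \<sigma>
    unfolding z_def central_young_def by (intro Ints_sum young_symmetrizer_Ints)
  define w where "w = ?m z (star n z)"
  have w: "w \<in> group_algebra n" "w \<noteq> 0" "star n w = w"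
    using mult_star_nonzero[OF z z0 int] group_algebra_mult_closed[OF star_in]
      star_mult[OF z star_in] star_star[OF z] by (auto simp: w_def)
  have "?m w (star n w) \<noteq> 0"
    using w int by (intro mult_star_nonzero) (auto simp: w_def intro: group_algebra_mult_Ints star_Ints)
  moreover have "?m w w = 0"
  proof -
    have comm: "?m (star n z) z = ?m z (star n z)"
      using class_function_central[OF star_in z] central_young_class by (metis z_def)
    have "?m w w = ?m z (?m (?m (star n z) z) (star n z))"
      by (simp add: w_def gmult_assoc)
    also have "\<dots> = ?m (?m z z) (?m (star n z) (star n z))"
      by (simp add: comm gmult_assoc)
    finally show ?thesis by (simp add: zz)
  qed
  ultimately show False using w by simp
qed

section \<open>Dimension count among class functions\<close>

lemma inj_central_young: "inj_on (central_young n :: _ \<Rightarrow> _ \<Rightarrow> 'k::field_char_0) (admissible n)"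
  using central_young_orthogonal central_young_square by (metis inj_onI)

text \<open>Permutations with the same value of \<open>ty\<close> are conjugate, so a class function
  is a combination of indicators indexed by \<open>admissible n\<close>. This bounds the dimension
  from above.\<close>

lemma class_function_in_span:
  fixes x :: "(nat \<Rightarrow> nat) \<Rightarrow> 'k::field_char_0"
  assumes x: "x \<in> group_algebra n" and conj_inv: "\<And>h \<sigma>. h permutes {1..n} \<Longrightarrow> x (inv h \<circ> \<sigma> \<circ> h) = x \<sigma>"
    and ty: "\<And>\<sigma>. \<sigma> permutes {1..n} \<Longrightarrow> ty \<sigma> \<in> admissible n \<and> has_cycle_type n \<sigma> (ty \<sigma>)"
  shows "x \<in> regular.span ((\<lambda>\<nu> \<sigma>. if \<sigma> permutes {1..n} \<and> ty \<sigma> = \<nu> then 1 else 0) ` admissible n)"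
    (is "_ \<in> regular.span (?K ` _)")
proof -
  \<comment> \<open>If no permutation has type \<nu>, then \<open>r \<nu>\<close> is arbitrary, but
    its coefficient multiplies a zero indicator.\<close>
  define r where "r \<nu> = (SOME \<sigma>. \<sigma> permutes {1..n} \<and> ty \<sigma> = \<nu>)" for \<nu>
  have "x = (\<Sum>\<nu>\<in>admissible n. (\<lambda>\<sigma>. x (r \<nu>) * ?K \<nu> \<sigma>))"
  proof
    fix \<sigma>
    show "x \<sigma> = (\<Sum>\<nu>\<in>admissible n. (\<lambda>\<sigma>. x (r \<nu>) * ?K \<nu> \<sigma>)) \<sigma>"
    proof (cases "\<sigma> permutes {1..n}")
      case True
      have r: "r (ty \<sigma>) permutes {1..n} \<and> ty (r (ty \<sigma>)) = ty \<sigma>"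
        unfolding r_def by (rule someI[of _ \<sigma>]) (simp add: True)
      then obtain g where "g permutes {1..n}" "r (ty \<sigma>) = inv g \<circ> \<sigma> \<circ> g"
        using conjugate_if_same_cycle_type[OF True, of "r (ty \<sigma>)" "ty \<sigma>"] ty True by metis
      then have "x (r (ty \<sigma>)) = x \<sigma>" using conj_inv by simp
      then have "(\<Sum>\<nu>\<in>admissible n. (\<lambda>\<sigma>. x (r \<nu>) * ?K \<nu> \<sigma>)) \<sigma>
        = (\<Sum>\<nu>\<in>admissible n. if \<nu> = ty \<sigma> then x \<sigma> else 0)"
        unfolding sum_fun_apply using True by (intro sum.cong) auto
      also have "\<dots> = x \<sigma>"
        using ty[OF True] by (subst sum.delta) (auto simp: finite_admissible)
      finally show ?thesis ..
    next
      case False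
      then show ?thesis using x by (simp add: sum_fun_apply group_algebra_def)
    qed
  qed
  also have "\<dots> \<in> regular.span (?K ` admissible n)"
    by (intro regular.span_sum regular.span_scale regular.span_base imageI)
  finally show ?thesis .
qed

text \<open>Otherwise the identity could be adjoined to the elements
  \<open>central_young n \<nu>\<close>, giving one more independent class function than
  \<open>admissible n\<close> has elements, in contradiction to
  \<open>class_function_in_span\<close>.\<close>

lemma one_in_span_central_young:
  "delta id \<in> regular.span ((central_young n :: _ \<Rightarrow> _ \<Rightarrow> 'k::field_char_0) ` admissible n)"
proof (rule ccontr)
  let ?z = "central_young n :: _ \<Rightarrow> _ \<Rightarrow> 'k" and ?A = "admissible n"
  let ?m = "group_algebra_mult n :: _ \<Rightarrow> _ \<Rightarrow> _ \<Rightarrow> 'k"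
  assume not: "\<not> ?thesis"
  have "\<forall>\<sigma>. \<exists>\<nu>. \<sigma> permutes {1..n} \<longrightarrow> \<nu> \<in> ?A \<and> has_cycle_type n \<sigma> \<nu>"
    using cycle_type_exists by metis
  then obtain ty where ty: "\<And>\<sigma>. \<sigma> permutes {1..n} \<Longrightarrow> ty \<sigma> \<in> ?A \<and> has_cycle_type n \<sigma> (ty \<sigma>)"
    by metis
  let ?K = "\<lambda>\<nu> \<sigma>. if \<sigma> permutes {1..n} \<and> ty \<sigma> = \<nu> then 1 else (0::'k)"
  have "regular.independent (?z ` ?A)"
  proof (rule regular.independent_if_scalars_zero)
    fix f y assume sum0: "(\<Sum>x\<in>?z ` ?A. (\<lambda>\<sigma>. f x * x \<sigma>)) = 0" and "y \<in> ?z ` ?A"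
    then obtain \<nu> where \<nu>: "\<nu> \<in> ?A" "y = ?z \<nu>" by blast
    \<comment> \<open>By orthogonality, multiplication by one central element isolates its own
      coefficient.\<close>
    have "0 = ?m (?z \<nu>) (\<Sum>x\<in>?z ` ?A. (\<lambda>\<sigma>. f x * x \<sigma>))" by (simp add: sum0)
    also have "\<dots> = (\<Sum>\<nu>'\<in>?A. (\<lambda>\<sigma>. f (?z \<nu>') * ?m (?z \<nu>) (?z \<nu>') \<sigma>))"
      by (simp add: sum.reindex inj_central_young regular.act_sum_right regular.act_scale_right)
    also have "\<dots> = (\<Sum>\<nu>'\<in>?A. if \<nu>' = \<nu> then (\<lambda>\<sigma>. f y * ?m (?z \<nu>) (?z \<nu>) \<sigma>) else 0)"
    proof (intro sum.cong refl)
      fix \<nu>' assume "\<nu>' \<in> ?A"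
      then have "?m (?z \<nu>) (?z \<nu>') = 0" if "\<nu>' \<noteq> \<nu>"
        using that \<nu> by (intro central_young_orthogonal) auto
      then show "(\<lambda>\<sigma>. f (?z \<nu>') * ?m (?z \<nu>) (?z \<nu>') \<sigma>)
        = (if \<nu>' = \<nu> then (\<lambda>\<sigma>. f y * ?m (?z \<nu>) (?z \<nu>) \<sigma>) else 0)"
        by (cases "\<nu>' = \<nu>") (simp_all add: \<nu> zero_fun_def)
    qed
    also have "\<dots> = (\<lambda>\<sigma>. f y * ?m (?z \<nu>) (?z \<nu>) \<sigma>)"
      by (subst sum.delta) (auto simp: finite_admissible \<nu>)
    finally show "f y = 0"
      using central_young_square[OF \<nu>(1), where 'k = 'k] by (auto simp: fun_eq_iff)
  qed (simp add: finite_admissible)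
  then have indep: "regular.independent (insert (delta id) (?z ` ?A))"
    by (rule regular.independent_insertI[OF not])
  have "delta id \<in> regular.span (?K ` ?A)"
  proof (rule class_function_in_span[OF delta_in[OF permutes_id] _ ty])
    fix h \<sigma> assume h: "h permutes {1..n}"
    have "inv h \<circ> \<sigma> \<circ> h = id \<longleftrightarrow> \<sigma> = id"
    proof
      assume "inv h \<circ> \<sigma> \<circ> h = id"
      then have "h \<circ> (inv h \<circ> \<sigma> \<circ> h) \<circ> inv h = id"
        using permutes_inv_o[OF h] by simp
      then show "\<sigma> = id"
        using permutes_inv_o[OF h] by (metis comp_assoc comp_id id_comp)
    qed (simp add: permutes_inv_o[OF h])
    then show "delta id (inv h \<circ> \<sigma> \<circ> h) = (delta id \<sigma> :: 'k)" by (simp add: delta_def)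
  qed
  moreover have "?z \<nu> \<in> regular.span (?K ` ?A)" if "\<nu> \<in> ?A" for \<nu>
    by (rule class_function_in_span[OF central_young_in[OF that] central_young_class ty])
  ultimately have "insert (delta id) (?z ` ?A) \<subseteq> regular.span (?K ` ?A)" by blast
  from regular.independent_span_bound[OF _ indep this]
  have "card (insert (delta id) (?z ` ?A)) \<le> card (?K ` ?A)"
    by (simp add: finite_admissible)
  also have "\<dots> \<le> card ?A" by (rule card_image_le[OF finite_admissible])
  finally have "card (insert (delta id) (?z ` ?A)) \<le> card ?A" .
  moreover have "delta id \<notin> ?z ` ?A" using not by (blast intro: regular.span_base)
  ultimately show False
    by (simp add: finite_admissible card_image inj_central_young)
qed

lemma one_eq_sum_central_young:
  obtains \<alpha> where "delta id = (\<Sum>\<nu>\<in>admissible n. (\<lambda>\<sigma>. \<alpha> \<nu> * (central_young n \<nu> \<sigma> :: 'k::field_char_0)))"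
proof -
  let ?z = "central_young n :: _ \<Rightarrow> _ \<Rightarrow> 'k"
  obtain u where "delta id = (\<Sum>x\<in>?z ` admissible n. (\<lambda>\<sigma>. u x * x \<sigma>))"
    using one_in_span_central_young[of n, where 'k = 'k] finite_admissible[of n]
    by (subst (asm) regular.span_finite) auto
  then have "delta id = (\<Sum>\<nu>\<in>admissible n. (\<lambda>\<sigma>. u (?z \<nu>) * ?z \<nu> \<sigma>))"
    by (simp add: sum.reindex inj_central_young)
  then show ?thesis by (rule that)
qed

locale sym_rep_char_0 = sym_rep scale n W \<rho>
  for scale :: "'k::field_char_0 \<Rightarrow> 'v::ab_group_add \<Rightarrow> 'v" and n W \<rho>
begin

text \<open>This is the expression of 1 by central elements, applied to w. The coefficients come
  from the group algebra and are the same for all w.\<close>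

lemma resolution:
  "\<exists>\<alpha>. \<forall>w\<in>W. w = (\<Sum>\<nu>\<in>admissible n. scale (\<alpha> \<nu>)
    (\<Sum>g | g permutes {1..n}. \<rho> g (act (young_symmetrizer (padded n \<nu>)) (\<rho> (inv g) w))))"
proof -
  obtain \<alpha> where \<alpha>: "delta id = (\<Sum>\<nu>\<in>admissible n. (\<lambda>\<sigma>. \<alpha> \<nu> * (central_young n \<nu> \<sigma> :: 'k)))"
    by (rule one_eq_sum_central_young)
  have act_delta: "act (delta g) w = \<rho> g w" if "g permutes {1..n}" "w \<in> W" for g w
  proof -
    have "act (delta g) w = (\<Sum>\<sigma> | \<sigma> permutes {1..n}. if \<sigma> = g then \<rho> g w else 0)"
      unfolding act_def delta_def by (intro sum.cong) auto
    also have "\<dots> = \<rho> g w" using that by (subst sum.delta) (auto simp: finite_permutations)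
    finally show ?thesis .
  qed
  have "w = (\<Sum>\<nu>\<in>admissible n. scale (\<alpha> \<nu>)
    (\<Sum>g | g permutes {1..n}. \<rho> g (act (young_symmetrizer (padded n \<nu>)) (\<rho> (inv g) w))))"
    if w: "w \<in> W" for w
  proof -
    have "w = act (delta id) w" using act_one[OF w] by (simp add: delta_def)
    also have "\<dots> = (\<Sum>\<nu>\<in>admissible n. scale (\<alpha> \<nu>) (act (central_young n \<nu>) w))"
      unfolding \<alpha> by (simp add: act_sum_left act_scale_left)
    also have "\<dots> = (\<Sum>\<nu>\<in>admissible n. scale (\<alpha> \<nu>)
      (\<Sum>g | g permutes {1..n}. \<rho> g (act (young_symmetrizer (padded n \<nu>)) (\<rho> (inv g) w))))"
    proof (intro sum.cong refl arg_cong[where f = "scale _"])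
      fix \<nu> assume \<nu>: "\<nu> \<in> admissible n"
      show "act (central_young n \<nu>) w
        = (\<Sum>g | g permutes {1..n}. \<rho> g (act (young_symmetrizer (padded n \<nu>)) (\<rho> (inv g) w)))"
        unfolding central_young_eq[OF \<nu>] act_sum_left
      proof (rule sum.cong[OF refl])
        fix g assume "g \<in> {g. g permutes {1..n}}"
        then have g: "g permutes {1..n}" by simp
        show "act (group_algebra_mult n (delta g)
            (group_algebra_mult n (young_symmetrizer (padded n \<nu>)) (delta (inv g)))) w
          = \<rho> g (act (young_symmetrizer (padded n \<nu>)) (\<rho> (inv g) w))"
          unfolding act_mult[OF w] act_delta[OF permutes_inv[OF g] w]
          by (rule act_delta[OF g act_closed[OF action_closed[OF permutes_inv[OF g] w]]])
      qed
    qed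
    finally show ?thesis .
  qed
  then show ?thesis by blast
qed

lemma vanishes_if_symmetrizers_vanish:
  assumes "w \<in> W"
    and "\<And>\<nu> g. \<nu> \<in> admissible n \<Longrightarrow> g permutes {1..n} \<Longrightarrow> act (young_symmetrizer (padded n \<nu>)) (\<rho> g w) = 0"
  shows "w = 0"
proof -
  obtain \<alpha> where "w = (\<Sum>\<nu>\<in>admissible n. scale (\<alpha> \<nu>)
    (\<Sum>g | g permutes {1..n}. \<rho> g (act (young_symmetrizer (padded n \<nu>)) (\<rho> (inv g) w))))"
    using bspec[OF _ assms(1)] resolution by blast
  also have "\<dots> = (\<Sum>\<nu>\<in>admissible n. scale (\<alpha> \<nu>) (\<Sum>g | g permutes {1..n}. 0))"
  proof (intro sum.cong refl arg_cong[where f = "scale _"])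
    fix \<nu> g assume "\<nu> \<in> admissible n" "g \<in> {g. g permutes {1..n}}"
    then show "\<rho> g (act (young_symmetrizer (padded n \<nu>)) (\<rho> (inv g) w)) = 0"
      using assms action_scale[of g 0 0] subspace_0[OF subspace_W] by (simp add: permutes_inv)
  qed
  finally show ?thesis by simp
qed

end

section \<open>Decomposition into irreducible representations\<close>

text \<open>The isomorphism is easier to write from the direct sum to the representation, against
  the direction of \<open>rep_iso\<close>.\<close>

lemma rep_iso_inverseI:
  assumes bij: "bij_betw h (rep_carrier B) (rep_carrier A)"
    and closed: "\<And>x y. x \<in> rep_carrier B \<Longrightarrow> y \<in> rep_carrier B \<Longrightarrow> x + y \<in> rep_carrier B"
      "\<And>a x. x \<in> rep_carrier B \<Longrightarrow> rep_scale B a x \<in> rep_carrier B"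
      "\<And>\<sigma> x. \<sigma> permutes {1..n} \<Longrightarrow> x \<in> rep_carrier B \<Longrightarrow> rep_act B \<sigma> x \<in> rep_carrier B"
    and hom: "\<And>x y. x \<in> rep_carrier B \<Longrightarrow> y \<in> rep_carrier B \<Longrightarrow> h (x + y) = h x + h y"
      "\<And>a x. x \<in> rep_carrier B \<Longrightarrow> h (rep_scale B a x) = rep_scale A a (h x)"
      "\<And>\<sigma> x. \<sigma> permutes {1..n} \<Longrightarrow> x \<in> rep_carrier B \<Longrightarrow> h (rep_act B \<sigma> x) = rep_act A \<sigma> (h x)"
  shows "rep_iso n A B"
proof -
  let ?k = "inv_into (rep_carrier B) h"
  have k: "?k x \<in> rep_carrier B" "h (?k x) = x" if "x \<in> rep_carrier A" for x
    using that bij bij_betwE[OF bij_betw_inv_into[OF bij]] bij_betw_inv_into_right[OF bij] by auto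
  have kh: "?k (h x) = x" if "x \<in> rep_carrier B" for x
    using that bij_betw_inv_into_left[OF bij] by simp
  show ?thesis
    unfolding rep_iso_def
  proof (intro exI conjI allI ballI impI)
    show "bij_betw ?k (rep_carrier A) (rep_carrier B)" by (rule bij_betw_inv_into[OF bij])
    fix x assume x: "x \<in> rep_carrier A"
    show "?k (x + y) = ?k x + ?k y" if y: "y \<in> rep_carrier A" for y
      using kh[OF closed(1)[OF k(1)[OF x] k(1)[OF y]]] hom(1)[OF k(1)[OF x] k(1)[OF y]]
      by (simp add: k x y)
    show "?k (rep_scale A a x) = rep_scale B a (?k x)" for a
      using kh[OF closed(2)[OF k(1)[OF x], of a]] hom(2)[OF k(1)[OF x], of a] by (simp add: k x)
    show "?k (rep_act A \<sigma> x) = rep_act B \<sigma> (?k x)" if "\<sigma> permutes {1..n}" for \<sigma>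
      using kh[OF closed(3)[OF that k(1)[OF x]]] hom(3)[OF that k(1)[OF x]] by (simp add: k x)
  qed
qed

definition young_ideal :: "nat \<Rightarrow> nat list \<Rightarrow> ((nat \<Rightarrow> nat) \<Rightarrow> 'k::field) set" where
  "young_ideal n \<nu> = (\<lambda>x. group_algebra_mult n x (young_symmetrizer (padded n \<nu>))) ` group_algebra n"

lemma V_irrep_eq:
  assumes "\<nu> \<in> admissible n"
  shows "V_irrep \<nu> n = \<lparr>rep_carrier = young_ideal n \<nu>, rep_scale = (\<lambda>a x \<sigma>. a * x \<sigma>),
      rep_act = (\<lambda>\<tau> x \<sigma>. x (inv \<tau> \<circ> \<sigma>))\<rparr>"
  using padded_size[OF assms] by (simp add: V_irrep_def young_rep_def young_ideal_def padded_def)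

lemma young_ideal_add: "x \<in> young_ideal n \<nu> \<Longrightarrow> y \<in> young_ideal n \<nu> \<Longrightarrow> x + y \<in> young_ideal n \<nu>"
proof -
  assume "x \<in> young_ideal n \<nu>" "y \<in> young_ideal n \<nu>"
  then obtain x' y' where "x' \<in> group_algebra n" "y' \<in> group_algebra n"
    "x = group_algebra_mult n x' (young_symmetrizer (padded n \<nu>))"
    "y = group_algebra_mult n y' (young_symmetrizer (padded n \<nu>))"
    unfolding young_ideal_def by blast
  then show ?thesis
    unfolding young_ideal_def
    by (intro image_eqI[of _ _ "x' + y'"]) (auto simp: group_algebra_def regular.act_add_left)
qed

lemma young_ideal_scale: "x \<in> young_ideal n \<nu> \<Longrightarrow> (\<lambda>\<sigma>. a * x \<sigma>) \<in> young_ideal n \<nu>"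
proof -
  assume "x \<in> young_ideal n \<nu>"
  then obtain x' where "x' \<in> group_algebra n"
    "x = group_algebra_mult n x' (young_symmetrizer (padded n \<nu>))"
    unfolding young_ideal_def by blast
  then show ?thesis
    unfolding young_ideal_def
    by (intro image_eqI[of _ _ "\<lambda>\<sigma>. a * x' \<sigma>"]) (auto simp: group_algebra_def regular.act_scale_left)
qed

lemma young_ideal_translate:
  assumes "\<tau> permutes {1..n}" "x \<in> young_ideal n \<nu>"
  shows "(\<lambda>\<sigma>. x (inv \<tau> \<circ> \<sigma>)) \<in> young_ideal n \<nu>"
proof -
  obtain x' where x': "x' \<in> group_algebra n"
    "x = group_algebra_mult n x' (young_symmetrizer (padded n \<nu>))"
    using assms(2) unfolding young_ideal_def by blast
  have "(\<lambda>\<sigma>. x' (inv \<tau> \<circ> \<sigma>)) \<in> group_algebra n"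
    using x'(1) by (simp add: group_algebra_def permutes_comp_cancel(1)[OF permutes_inv[OF assms(1)]])
  then show ?thesis
    unfolding young_ideal_def x'(2)
    by (rule image_eqI[rotated]) (simp add: regular.act_translate[OF assms(1) UNIV_I])
qed

lemma zero_in_young_ideal: "0 \<in> young_ideal n \<nu>"
  unfolding young_ideal_def by (rule image_eqI[of _ _ 0]) (simp_all add: group_algebra_def)

text \<open>This is \<open>vanishes_if_symmetrizers_vanish\<close> for the regular representation,
  with translation by g as multiplication by \<open>delta g\<close>.\<close>

lemma group_algebra_vanishing:
  fixes x :: "(nat \<Rightarrow> nat) \<Rightarrow> 'k::field_char_0"
  assumes "\<And>\<nu> y. \<nu> \<in> admissible n \<Longrightarrow>
    group_algebra_mult n (young_symmetrizer (padded n \<nu>)) (group_algebra_mult n y x) = 0"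
  shows "x = 0"
proof -
  have act_eq: "sym_rep.act (\<lambda>(a::'k) x (\<sigma>::nat \<Rightarrow> nat). a * x \<sigma>) n (\<lambda>\<tau> x \<sigma>. x (inv \<tau> \<circ> \<sigma>)) y z
    = group_algebra_mult n y z" for y z
    by (auto simp: fun_eq_iff sym_rep.act_def[OF sym_rep_regular] group_algebra_mult_def sum_fun_apply)
  show ?thesis
  proof (rule sym_rep_char_0.vanishes_if_symmetrizers_vanish[OF sym_rep_char_0.intro[OF sym_rep_regular]])
    fix \<nu> g assume \<nu>: "\<nu> \<in> admissible n" and g: "g permutes {1..n}"
    show "sym_rep.act (\<lambda>(a::'k) x (\<sigma>::nat \<Rightarrow> nat). a * x \<sigma>) n (\<lambda>\<tau> x \<sigma>. x (inv \<tau> \<circ> \<sigma>))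
      (young_symmetrizer (padded n \<nu>)) (\<lambda>\<sigma>. x (inv g \<circ> \<sigma>)) = 0"
      using assms[OF \<nu>, of "delta g"] by (simp add: act_eq delta_mult[OF g])
  qed simp
qed

context sym_rep_char_0
begin

lemma span_in_image_act: "B \<subseteq> act x ` W \<Longrightarrow> span B \<subseteq> act x ` W"
  using span_minimal subspace_image_act by blast

context
  fixes I :: "nat list \<Rightarrow> 'v set"
  assumes fin: "\<And>\<nu>. \<nu> \<in> admissible n \<Longrightarrow> finite (I \<nu>)"
    and indep: "\<And>\<nu>. \<nu> \<in> admissible n \<Longrightarrow> independent (I \<nu>)"
    and span_I: "\<And>\<nu>. \<nu> \<in> admissible n \<Longrightarrow> span (I \<nu>) = act (young_symmetrizer (padded n \<nu>)) ` W"
begin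

private abbreviation (input) "c \<nu> \<equiv> young_symmetrizer (padded n \<nu>) :: (nat \<Rightarrow> nat) \<Rightarrow> 'k"

definition summands where "summands = rep_dsum (SIGMA \<nu>:admissible n. I \<nu>) (\<lambda>(\<nu>, i). V_irrep \<nu> n)"

text \<open>Each vector i of a basis of c_\<nu> W indexes one copy of the left ideal generated by
  c_\<nu>, mapped to W by x |-> x i.\<close>

definition assemble :: "(nat list \<times> 'v \<Rightarrow> (nat \<Rightarrow> nat) \<Rightarrow> 'k) \<Rightarrow> 'v" where
  "assemble x = (\<Sum>(\<nu>, i)\<in>(SIGMA \<nu>:admissible n. I \<nu>). act (x (\<nu>, i)) i)"

lemma finite_index: "finite (SIGMA \<nu>:admissible n. I \<nu>)"
  by (rule finite_SigmaI[OF finite_admissible fin])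

lemma summands_carrier:
  "x \<in> rep_carrier summands \<longleftrightarrow>
     (\<forall>\<nu>\<in>admissible n. \<forall>i\<in>I \<nu>. x (\<nu>, i) \<in> young_ideal n \<nu>) \<and>
     (\<forall>j. j \<notin> (SIGMA \<nu>:admissible n. I \<nu>) \<longrightarrow> x j = 0)"
proof -
  have "finite {j. x j \<noteq> 0}" if "\<forall>j. j \<notin> (SIGMA \<nu>:admissible n. I \<nu>) \<longrightarrow> x j = 0"
    by (rule finite_subset[OF _ finite_index]) (use that in blast)
  then show ?thesis
    by (auto simp: summands_def rep_dsum_def V_irrep_eq)
qed

lemma summands_scale:
  "rep_scale summands a x = (\<lambda>j. if j \<in> (SIGMA \<nu>:admissible n. I \<nu>) then (\<lambda>\<sigma>. a * x j \<sigma>) else 0)"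
  by (auto simp: summands_def rep_dsum_def V_irrep_eq fun_eq_iff)

lemma summands_act:
  "rep_act summands \<tau> x = (\<lambda>j. if j \<in> (SIGMA \<nu>:admissible n. I \<nu>) then (\<lambda>\<sigma>. x j (inv \<tau> \<circ> \<sigma>)) else 0)"
  by (auto simp: summands_def rep_dsum_def V_irrep_eq fun_eq_iff)

lemma I_in: "\<nu> \<in> admissible n \<Longrightarrow> i \<in> I \<nu> \<Longrightarrow> i \<in> act (c \<nu>) ` W"
  using span_base span_I by blast

lemma I_in_W: "\<nu> \<in> admissible n \<Longrightarrow> i \<in> I \<nu> \<Longrightarrow> i \<in> W"
  using I_in act_closed by blast

lemma symmetrizer_eigenvalue:
  assumes \<nu>: "\<nu> \<in> admissible n"
  obtains m where "m \<noteq> 0" "\<forall>e \<in> act (c \<nu>) ` W. act (c \<nu>) e = scale m e"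
proof -
  obtain m where m: "m \<noteq> 0" "group_algebra_mult n (c \<nu>) (c \<nu>) = (\<lambda>\<sigma>. m * c \<nu> \<sigma>)"
    by (rule young_symmetrizer_idempotent[OF padded_sorted[OF \<nu>] padded_size[OF \<nu>]])
  have "act (c \<nu>) e = scale m e" if e: "e \<in> act (c \<nu>) ` W" for e
  proof -
    obtain w where w: "w \<in> W" "e = act (c \<nu>) w" using e by blast
    then have "act (c \<nu>) e = act (group_algebra_mult n (c \<nu>) (c \<nu>)) w"
      using act_mult by simp
    then show ?thesis using w by (simp add: m act_scale_left)
  qed
  with m(1) show ?thesis using that by blast
qed

lemma assemble_add: "assemble (x + y) = assemble x + assemble y"
  by (simp add: assemble_def act_add_left sum.distrib case_prod_beta)

lemma assemble_scale: "assemble (rep_scale summands a x) = scale a (assemble x)"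
  unfolding assemble_def summands_scale scale_sum_right
  by (intro sum.cong) (auto simp: act_scale_left)

lemma assemble_act:
  assumes "\<tau> permutes {1..n}"
  shows "assemble (rep_act summands \<tau> x) = \<rho> \<tau> (assemble x)"
proof -
  have "\<rho> \<tau> (assemble x) = (\<Sum>j\<in>(SIGMA \<nu>:admissible n. I \<nu>). \<rho> \<tau> (act (x j) (snd j)))"
    unfolding assemble_def case_prod_beta
    by (subst action_sum[OF assms]) (auto simp: I_in_W act_closed)
  also have "\<dots> = assemble (rep_act summands \<tau> x)"
    unfolding assemble_def summands_act case_prod_beta
    by (intro sum.cong) (auto simp: act_translate[OF assms I_in_W])
  finally show ?thesis ..
qed

lemma assemble_in_W: "assemble x \<in> W"
  unfolding assemble_def by (rule subspace_sum[OF subspace_W]) (auto intro: act_closed I_in_W)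

lemma summands_add:
  "x \<in> rep_carrier summands \<Longrightarrow> y \<in> rep_carrier summands \<Longrightarrow> x + y \<in> rep_carrier summands"
  by (simp add: summands_carrier young_ideal_add)

lemma summands_scale_closed:
  "x \<in> rep_carrier summands \<Longrightarrow> rep_scale summands a x \<in> rep_carrier summands"
  by (simp add: summands_carrier summands_scale young_ideal_scale)

lemma summands_act_closed:
  "\<tau> permutes {1..n} \<Longrightarrow> x \<in> rep_carrier summands \<Longrightarrow> rep_act summands \<tau> x \<in> rep_carrier summands"
  by (simp add: summands_carrier summands_act young_ideal_translate)

text \<open>For any y, applying c_\<nu> y to the sum removes the components of other shapes and
  turns the component at i into a multiple s_i of c_\<nu>, which acts on i by a nonzero scalar.
  Independence of \<open>I \<nu>\<close> gives s_i = 0. So all symmetrizers annihilate every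
  multiple of every component.\<close>

lemma assemble_injective:
  assumes x: "x \<in> rep_carrier summands" and 0: "assemble x = 0"
  shows "x = 0"
proof
  fix j :: "nat list \<times> 'v"
  let ?m = "group_algebra_mult n :: _ \<Rightarrow> _ \<Rightarrow> _ \<Rightarrow> 'k"
  have "x (\<nu>, i) = 0" if \<nu>: "\<nu> \<in> admissible n" and i: "i \<in> I \<nu>" for \<nu> i
  proof -
    have ideal: "\<exists>x'. x (\<nu>', i') = ?m x' (c \<nu>')" if "\<nu>' \<in> admissible n" "i' \<in> I \<nu>'" for \<nu>' i'
      using x that unfolding summands_carrier young_ideal_def by blast
    have orth: "?m (c \<nu>'') (?m y (x (\<nu>', i'))) = 0"
      if "\<nu>'' \<in> admissible n" "\<nu>' \<in> admissible n" "\<nu>'' \<noteq> \<nu>'" "i' \<in> I \<nu>'" for \<nu>'' \<nu>' i' y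
    proof -
      from ideal[OF that(2,4)] obtain x' where "x (\<nu>', i') = ?m x' (c \<nu>')" by blast
      then show ?thesis
        using padded_symmetrizer_orthogonal[OF that(1-3), of "?m y x'"] by (simp add: gmult_assoc)
    qed
    have "?m (c \<nu>) (?m y (x (\<nu>, i))) = 0" for y
    proof -
      obtain m where m: "m \<noteq> 0" "\<forall>e \<in> act (c \<nu>) ` W. act (c \<nu>) e = scale m e"
        by (rule symmetrizer_eigenvalue[OF \<nu>])
      have "\<exists>s. ?m (c \<nu>) (?m y (x (\<nu>, i'))) = (\<lambda>\<sigma>. s * c \<nu> \<sigma>)" if i': "i' \<in> I \<nu>" for i'
      proof -
        obtain x' where "x (\<nu>, i') = ?m x' (c \<nu>)" using ideal[OF \<nu> i'] by blast
        then show ?thesis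
          using young_symmetrizer_sandwich[OF padded_sorted[OF \<nu>] padded_size[OF \<nu>], of "?m y x'"]
          by (simp add: gmult_assoc)
      qed
      then obtain s where s: "\<And>i'. i' \<in> I \<nu> \<Longrightarrow> ?m (c \<nu>) (?m y (x (\<nu>, i'))) = (\<lambda>\<sigma>. s i' * c \<nu> \<sigma>)"
        by metis
      have "0 = act (?m (c \<nu>) y) (assemble x)" using 0 by simp
      also have "\<dots> = (\<Sum>\<nu>'\<in>admissible n. \<Sum>i'\<in>I \<nu>'. act (?m (c \<nu>) y) (act (x (\<nu>', i')) i'))"
        unfolding assemble_def
        by (subst act_sum_right)
           (auto simp: act_closed I_in_W sum.Sigma[OF finite_admissible] fin intro!: sum.cong)
      also have "\<dots> = (\<Sum>\<nu>'\<in>admissible n. if \<nu>' = \<nu> then \<Sum>i'\<in>I \<nu>. scale m (scale (s i') i') else 0)"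
      proof (intro sum.cong refl)
        fix \<nu>' assume \<nu>': "\<nu>' \<in> admissible n"
        have "act (?m (c \<nu>) y) (act (x (\<nu>', i')) i') = (if \<nu>' = \<nu> then scale m (scale (s i') i') else 0)"
          if i': "i' \<in> I \<nu>'" for i'
        proof -
          have "act (?m (c \<nu>) y) (act (x (\<nu>', i')) i') = act (?m (c \<nu>) (?m y (x (\<nu>', i')))) i'"
            using I_in_W[OF \<nu>' i'] by (simp add: act_mult act_closed)
          also have "\<dots> = (if \<nu>' = \<nu> then scale m (scale (s i') i') else 0)"
            using orth[OF \<nu> \<nu>' _ i', of y] s[of i'] i' bspec[OF m(2) I_in[OF \<nu>]]
            by (auto simp: act_scale_left mult.commute)
          finally show ?thesis .
        qed
        then show "(\<Sum>i'\<in>I \<nu>'. act (?m (c \<nu>) y) (act (x (\<nu>', i')) i'))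
          = (if \<nu>' = \<nu> then \<Sum>i'\<in>I \<nu>. scale m (scale (s i') i') else 0)"
          by (auto intro: sum.neutral)
      qed
      also have "\<dots> = scale m (\<Sum>i'\<in>I \<nu>. scale (s i') i')"
        by (subst sum.delta) (auto simp: finite_admissible \<nu> scale_sum_right simp del: scale_scale)
      finally have "(\<Sum>i'\<in>I \<nu>. scale (s i') i') = 0" using m(1) by simp
      then have "s i = 0"
        using independentD[OF indep[OF \<nu>] fin[OF \<nu>] order_refl _ i] by blast
      then show ?thesis using s[OF i] by (simp add: zero_fun_def)
    qed
    then have "?m (c \<nu>') (?m y (x (\<nu>, i))) = 0" if "\<nu>' \<in> admissible n" for \<nu>' y
      using orth[OF that \<nu> _ i] by (cases "\<nu>' = \<nu>") auto
    then show ?thesis by (rule group_algebra_vanishing)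
  qed
  then show "x j = 0 j"
    using x unfolding summands_carrier by (cases j) (metis SigmaE2 SigmaI zero_fun_apply)
qed

text \<open>The image is a subspace that contains all vectors g c_\<nu> w, and these span W by
  \<open>resolution\<close>. For a basis vector i, the element g i is reached because (g c_\<nu>) i
  is a nonzero multiple of it.\<close>

lemma assemble_surjective: "W \<subseteq> assemble ` rep_carrier summands"
proof
  let ?R = "assemble ` rep_carrier summands"
  have sub: "subspace ?R"
  proof (rule subspaceI)
    have "assemble 0 = 0" by (simp add: assemble_def case_prod_beta)
    then show "0 \<in> ?R"
      by (intro image_eqI[of _ _ 0]) (auto simp: summands_carrier zero_in_young_ideal)
  next
    fix u v assume "u \<in> ?R" "v \<in> ?R"
    then obtain x y where "x \<in> rep_carrier summands" "y \<in> rep_carrier summands"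
      "u = assemble x" "v = assemble y" by blast
    then show "u + v \<in> ?R"
      by (intro image_eqI[of _ _ "x + y"]) (simp_all add: assemble_add summands_add)
  next
    fix a u assume "u \<in> ?R"
    then obtain x where "x \<in> rep_carrier summands" "u = assemble x" by blast
    then show "scale a u \<in> ?R"
      by (intro image_eqI[of _ _ "rep_scale summands a x"]) (simp_all add: assemble_scale summands_scale_closed)
  qed
  have single: "act x i \<in> ?R" if \<nu>: "\<nu> \<in> admissible n" and i: "i \<in> I \<nu>" and x: "x \<in> young_ideal n \<nu>" for \<nu> i x
  proof (rule image_eqI)
    let ?x = "\<lambda>j. if j = (\<nu>, i) then x else 0"
    have "assemble ?x = (\<Sum>j\<in>(SIGMA \<nu>:admissible n. I \<nu>). if j = (\<nu>, i) then act x i else 0)"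
      unfolding assemble_def
    proof (intro sum.cong refl)
      show "(case j of (\<nu>, i) \<Rightarrow> act (?x (\<nu>, i)) i) = (if j = (\<nu>, i) then act x i else 0)" for j
        by (cases j) simp
    qed
    also have "\<dots> = act x i" using \<nu> i by (subst sum.delta) (auto simp: finite_index)
    finally show "act x i = assemble ?x" ..
    show "?x \<in> rep_carrier summands"
      using \<nu> i x zero_in_young_ideal by (auto simp: summands_carrier)
  qed
  have translate: "\<rho> g e \<in> ?R"
    if \<nu>: "\<nu> \<in> admissible n" and g: "g permutes {1..n}" and e: "e \<in> act (c \<nu>) ` W" for \<nu> g e
  proof -
    obtain m where m: "m \<noteq> 0" "\<forall>e \<in> act (c \<nu>) ` W. act (c \<nu>) e = scale m e"
      by (rule symmetrizer_eigenvalue[OF \<nu>])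
    have ideal: "(\<lambda>\<sigma>. c \<nu> (inv g \<circ> \<sigma>)) \<in> young_ideal n \<nu>"
      unfolding young_ideal_def
      by (rule image_eqI[of _ _ "delta g"]) (simp_all add: delta_mult[OF g] delta_in[OF g])
    have "\<rho> g i \<in> ?R" if i: "i \<in> I \<nu>" for i
    proof -
      have iW: "i \<in> W" by (rule I_in_W[OF \<nu> i])
      have "act (\<lambda>\<sigma>. c \<nu> (inv g \<circ> \<sigma>)) i = scale m (\<rho> g i)"
        by (simp add: act_translate[OF g iW] bspec[OF m(2) I_in[OF \<nu> i]] action_scale[OF g iW])
      then have "\<rho> g i = scale (inverse m) (act (\<lambda>\<sigma>. c \<nu> (inv g \<circ> \<sigma>)) i)" using m(1) by simp
      then show ?thesis using subspace_scale[OF sub single[OF \<nu> i ideal]] by metis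
    qed
    moreover have "e \<in> span (I \<nu>)" using e span_I[OF \<nu>] by simp
    then obtain u where "e = (\<Sum>i\<in>I \<nu>. scale (u i) i)"
      unfolding span_finite[OF fin[OF \<nu>]] by blast
    then have "\<rho> g e = (\<Sum>i\<in>I \<nu>. scale (u i) (\<rho> g i))"
      by (simp add: action_sum[OF g] action_scale[OF g] I_in_W[OF \<nu>] subspace_scale[OF subspace_W])
    ultimately show ?thesis by (simp add: subspace_sum[OF sub] subspace_scale[OF sub])
  qed
  fix w assume w: "w \<in> W"
  obtain \<alpha> where \<alpha>: "\<forall>w\<in>W. w = (\<Sum>\<nu>\<in>admissible n. scale (\<alpha> \<nu>)
    (\<Sum>g | g permutes {1..n}. \<rho> g (act (c \<nu>) (\<rho> (inv g) w))))"
    using resolution by blast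
  show "w \<in> ?R"
    by (subst bspec[OF \<alpha> w], intro subspace_sum[OF sub] subspace_scale[OF sub] translate)
       (auto intro: imageI action_closed permutes_inv w)
qed

lemma decomposition:
  "rep_iso n \<lparr>rep_carrier = W, rep_scale = scale, rep_act = \<rho>\<rparr>
     (rep_dsum (SIGMA \<nu>:admissible n. I \<nu>) (\<lambda>(\<nu>, i). V_irrep \<nu> n))"
  unfolding summands_def[symmetric]
proof (rule rep_iso_inverseI[where h = assemble])
  have "inj_on assemble (rep_carrier summands)"
  proof (rule inj_onI)
    fix x y assume x: "x \<in> rep_carrier summands" and y: "y \<in> rep_carrier summands"
      and eq: "assemble x = assemble y"
    have eq0: "x + rep_scale summands (-1) y = 0"
      using x y eq
      by (intro assemble_injective)
         (auto simp: assemble_add assemble_scale summands_add summands_scale_closed)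
    have diff: "x j \<sigma> + rep_scale summands (-1) y j \<sigma> = 0" for j \<sigma>
      using arg_cong[OF eq0, of "\<lambda>f. f j \<sigma>"] by simp
    have "x j \<sigma> = y j \<sigma>" for j \<sigma>
    proof (cases "j \<in> (SIGMA \<nu>:admissible n. I \<nu>)")
      case True
      then show ?thesis using diff[of j \<sigma>] by (simp add: summands_scale)
    next
      case False
      then show ?thesis using x y by (cases j) (simp add: summands_carrier)
    qed
    then show "x = y" by (intro ext)
  qed
  then show "bij_betw assemble (rep_carrier summands)
      (rep_carrier \<lparr>rep_carrier = W, rep_scale = scale, rep_act = \<rho>\<rparr>)"
    using assemble_surjective assemble_in_W by (auto simp: bij_betw_def)
qed (simp_all add: assemble_add assemble_scale assemble_act summands_add summands_scale_closed summands_act_closed)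

end

text \<open>A basis of c_\<nu> W serves as the index set for the copies of V(\<nu>)_n, and finite
  dimension makes its size a natural number.\<close>

theorem has_multiplicities_dim:
  assumes fd: "finite B" "W \<subseteq> span B"
    and mult: "\<And>\<nu>. \<nu> \<in> admissible n \<Longrightarrow> c \<nu> = enat (dim (act (young_symmetrizer (padded n \<nu>)) ` W))"
    and zero: "\<And>\<nu>. is_partition \<nu> \<Longrightarrow> \<nu> \<notin> admissible n \<Longrightarrow> c \<nu> = 0"
  shows "has_multiplicities n \<lparr>rep_carrier = W, rep_scale = scale, rep_act = \<rho>\<rparr> c"
proof -
  have "\<forall>\<nu>. \<exists>I. finite I \<and> independent I \<and> span I = act (young_symmetrizer (padded n \<nu>)) ` W \<and>
    card I = dim (act (young_symmetrizer (padded n \<nu>)) ` W)"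
  proof
    fix \<nu>
    let ?E = "act (young_symmetrizer (padded n \<nu>)) ` W"
    obtain I where I: "I \<subseteq> ?E" "independent I" "?E \<subseteq> span I" "card I = dim ?E"
      by (rule basis_exists)
    have "I \<subseteq> span B" using I(1) act_closed fd(2) by blast
    then have "finite I" using independent_span_bound[OF fd(1) I(2)] by blast
    moreover have "span I = ?E" using I span_in_image_act by blast
    ultimately show "\<exists>I. finite I \<and> independent I \<and> span I = ?E \<and> card I = dim ?E"
      using I by blast
  qed
  then obtain I where I: "\<And>\<nu>. finite (I \<nu>)" "\<And>\<nu>. independent (I \<nu>)"
    "\<And>\<nu>. span (I \<nu>) = act (young_symmetrizer (padded n \<nu>)) ` W"
    "\<And>\<nu>. card (I \<nu>) = dim (act (young_symmetrizer (padded n \<nu>)) ` W)"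
    by metis
  show ?thesis
    unfolding has_multiplicities_def
    using zero mult I decomposition[of I] by (intro conjI exI[of _ I]) auto
qed

end

section \<open>Linear maps defined on a subspace\<close>

context vector_space
begin

text \<open>T is linear on S only. Elsewhere, apart from 0, its values are arbitrary, like those of
  the maps of an FI-module.\<close>

lemma partial_linear_sum:
  assumes S: "subspace S" and T0: "T 0 = 0"
    and add: "\<And>x y. x \<in> S \<Longrightarrow> y \<in> S \<Longrightarrow> T (x + y) = T x + T y"
    and scale: "\<And>a x. x \<in> S \<Longrightarrow> T (scale a x) = scale a (T x)"
    and f: "\<And>i. i \<in> I \<Longrightarrow> f i \<in> S"
  shows "T (\<Sum>i\<in>I. scale (u i) (f i)) = (\<Sum>i\<in>I. scale (u i) (T (f i)))"
  using f
proof (induction I rule: infinite_finite_induct)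
  case (insert i I)
  then have "scale (u i) (f i) \<in> S" "(\<Sum>i\<in>I. scale (u i) (f i)) \<in> S"
    by (auto intro!: subspace_sum subspace_scale S)
  with insert show ?case by (simp add: add scale)
qed (simp_all add: T0)

context
  fixes S S' :: "'b set" and T :: "'b \<Rightarrow> 'b" and B :: "'b set"
  assumes S: "subspace S" and B: "finite B" "S \<subseteq> span B"
    and add: "\<And>x y. x \<in> S \<Longrightarrow> y \<in> S \<Longrightarrow> T (x + y) = T x + T y"
    and scale: "\<And>a x. x \<in> S \<Longrightarrow> T (scale a x) = scale a (T x)"
    and surj: "S' \<subseteq> T ` S"
begin

lemma partial_linear_zero: "T 0 = 0"
  using scale[of 0 0] subspace_0[OF S] by simp

lemma image_subset_span:
  assumes C: "C \<subseteq> S" "S \<subseteq> span C" "finite C"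
  shows "S' \<subseteq> span (T ` C)"
proof
  fix y assume "y \<in> S'"
  then obtain x where x: "x \<in> S" "y = T x" using surj by blast
  then have "x \<in> range (\<lambda>u. \<Sum>v\<in>C. scale (u v) v)"
    using C(2) span_finite[OF C(3)] by blast
  then obtain u where "x = (\<Sum>v\<in>C. scale (u v) v)" by blast
  then have "y = (\<Sum>v\<in>C. scale (u v) (T v))"
    using x partial_linear_sum[OF S partial_linear_zero add scale, of C "\<lambda>v. v" u] C(1) by auto
  then show "y \<in> span (T ` C)"
    by (simp add: span_sum span_scale span_base)
qed

lemma finite_independent_subset: "C \<subseteq> S \<Longrightarrow> independent C \<Longrightarrow> finite C"
  using independent_span_bound[OF B(1)] B(2) by blast

lemma dim_surjective_le: "dim S' \<le> dim S"
proof -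
  obtain C where C: "C \<subseteq> S" "independent C" "S \<subseteq> span C" "card C = dim S"
    by (rule basis_exists)
  have fin: "finite C" using finite_independent_subset C by blast
  have "dim S' \<le> card (T ` C)"
    by (rule dim_le_card[OF image_subset_span[OF C(1,3) fin]]) (simp add: fin)
  also have "\<dots> \<le> dim S" using card_image_le[OF fin] C(4) by metis
  finally show ?thesis .
qed

text \<open>Extend a nonzero y with T y = 0 to a basis of S. The images of the other basis vectors
  already span S', which is one vector too few.\<close>

lemma surjective_imp_injective:
  assumes dim: "dim S \<le> dim S'" and y: "y \<in> S" "T y = 0"
  shows "y = 0"
proof (rule ccontr)
  assume "y \<noteq> 0"
  then have "independent {y}" by simp
  with y obtain C where C: "{y} \<subseteq> C" "C \<subseteq> S" "independent C" "S \<subseteq> span C"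
    using maximal_independent_subset_extend[of "{y}" S] by blast
  have fin: "finite C" using finite_independent_subset C by blast
  have "S' \<subseteq> span (T ` C)" by (rule image_subset_span[OF C(2,4) fin])
  also have "T ` C = insert 0 (T ` (C - {y}))" using C(1) y(2) by force
  finally have "dim S' \<le> card (T ` (C - {y}))"
    by (intro dim_le_card) (simp_all add: fin)
  also have "\<dots> \<le> card (C - {y})" by (rule card_image_le) (simp add: fin)
  also have "\<dots> < card C" using C(1) fin by (intro psubset_card_mono) auto
  also have "card C = dim S" using C by (intro basis_card_eq_dim)
  finally show False using dim by simp
qed

end

end

section \<open>The symmetric group actions on an FI-module\<close>

context sym_rep
begin

lemma act_row_sum:
  assumes "sum_list \<mu> = n"
  shows "act (row_sum \<mu>) w = (\<Sum>p\<in>row_group \<mu>. \<rho> p w)"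
  unfolding act_def using assms row_group_permutes[of _ \<mu>]
  by (intro sum.mono_neutral_cong_right) (auto simp: finite_permutations row_sum_def)

lemma act_column_sum:
  assumes "sum_list \<mu> = n"
  shows "act (column_sum \<mu>) w = (\<Sum>q\<in>column_group \<mu>. scale (of_int (sign q)) (\<rho> q w))"
  unfolding act_def using assms column_group_permutes[of _ \<mu>]
  by (intro sum.mono_neutral_cong_right) (auto simp: finite_permutations column_sum_def)

lemma act_young_symmetrizer:
  assumes "sum_list \<mu> = n" "w \<in> W"
  shows "act (young_symmetrizer \<mu>) w = act (row_sum \<mu>) (act (column_sum \<mu>) w)"
  using act_mult[OF assms(2)] young_symmetrizer_eq[of \<mu>] assms(1) by metis

lemma act_row_sum_row:
  assumes "sum_list \<mu> = n" "p \<in> row_group \<mu>" "w \<in> W"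
  shows "act (row_sum \<mu>) (\<rho> p w) = act (row_sum \<mu>) w"
  using act_action[of p w "row_sum \<mu>"] row_group_permutes[OF assms(2)] assms
  by (simp add: row_sum_right row_group_inv)

lemma act_column_sum_column:
  assumes "sum_list \<mu> = n" "q \<in> column_group \<mu>" "w \<in> W"
  shows "act (column_sum \<mu>) (\<rho> q w) = scale (of_int (sign (inv q))) (act (column_sum \<mu>) w)"
  using act_action[of q w "column_sum \<mu>"] column_group_permutes[OF assms(2)] assms
  by (simp add: column_sum_right column_group_inv act_scale_left)

end

section \<open>Morphisms of FI\<close>

lemma fi_homI: "finite S \<Longrightarrow> finite T \<Longrightarrow> inj_on f S \<Longrightarrow> (\<And>x. x \<in> S \<Longrightarrow> f x \<in> T) \<Longrightarrow> restrict f S \<in> fi_hom S T"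
  by (auto simp: fi_hom_def inj_on_def)

lemma fi_hom_compose:
  assumes f: "f \<in> fi_hom S T" and g: "g \<in> fi_hom T U"
  shows "compose S g f \<in> fi_hom S U"
proof -
  have fT: "f x \<in> T" if "x \<in> S" for x using f that by (auto simp: fi_hom_def)
  have gU: "g x \<in> U" if "x \<in> T" for x using g that by (auto simp: fi_hom_def)
  have inj: "inj_on f S" "inj_on g T" using f g by (auto simp: fi_hom_def)
  have "inj_on (\<lambda>x. g (f x)) S"
    by (rule inj_onI) (use inj fT in \<open>meson inj_onD\<close>)
  then show ?thesis
    unfolding compose_def using f g fT gU by (intro fi_homI) (simp_all add: fi_hom_def)
qed

lemma restrict_permutation_hom: "\<sigma> permutes {1..n} \<Longrightarrow> restrict \<sigma> {1..n} \<in> fi_hom {1..n} {1..n}"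
  by (intro fi_homI) (auto simp: permutes_inj_on permutes_in_image simp del: atLeastAtMost_iff)

lemma finite_fi_hom: "finite (fi_hom S T)"
proof (cases "finite S \<and> finite T")
  case True
  then show ?thesis
    by (intro finite_subset[OF _ finite_PiE[of S "\<lambda>_. T"]]) (auto simp: fi_hom_def)
next
  case False
  then have "fi_hom S T = {}" by (auto simp: fi_hom_def)
  then show ?thesis by simp
qed

text \<open>For k in {1..n+1} this is the increasing injection that misses exactly k; k = n + 1
  gives the standard inclusion.\<close>

definition skip :: "nat \<Rightarrow> nat \<Rightarrow> nat \<Rightarrow> nat" where
  "skip n k = (\<lambda>e\<in>{1..n}. if e < k then e else Suc e)"

lemma skip_hom: "skip n k \<in> fi_hom {1..n} {1..Suc n}"
  unfolding skip_def by (rule fi_homI) (auto simp: inj_on_def split: if_splits)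

lemma skip_image: "k \<in> {1..Suc n} \<Longrightarrow> skip n k ` {1..n} = {1..Suc n} - {k}"
proof (intro set_eqI iffI)
  fix e assume "k \<in> {1..Suc n}" "e \<in> {1..Suc n} - {k}"
  then show "e \<in> skip n k ` {1..n}"
    by (intro image_eqI[of _ _ "if e < k then e else e - 1"]) (auto simp: skip_def)
qed (auto simp: skip_def split: if_splits)

context fi_module
begin

definition perm_act :: "nat \<Rightarrow> (nat \<Rightarrow> nat) \<Rightarrow> 'v \<Rightarrow> 'v" where
  "perm_act n \<sigma> = F {1..n} {1..n} (restrict \<sigma> {1..n})"

lemma map_zero: "f \<in> fi_hom S T \<Longrightarrow> F S T f 0 = 0"
  using map_scale[of f S T 0 0] subspace_0[OF subspace_obj] by (simp add: fi_hom_def)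

lemma map_sum:
  assumes "f \<in> fi_hom S T" "\<And>i. i \<in> I \<Longrightarrow> g i \<in> V S"
  shows "F S T f (\<Sum>i\<in>I. scale (u i) (g i)) = (\<Sum>i\<in>I. scale (u i) (F S T f (g i)))"
  using assms subspace_obj[of S]
  by (intro partial_linear_sum[where S = "V S"]) (auto simp: map_zero map_add map_scale fi_hom_def)

lemma sym_rep_perm_act: "sym_rep scale n (V {1..n}) (perm_act n)"
proof unfold_locales
  fix \<sigma> \<tau> w
  assume \<sigma>: "\<sigma> permutes {1..n}" and \<tau>: "\<tau> permutes {1..n}" and w: "w \<in> V {1..n}"
  have "compose {1..n} (restrict \<sigma> {1..n}) (restrict \<tau> {1..n}) = restrict (\<sigma> \<circ> \<tau>) {1..n}"
    using permutes_in_image[OF \<tau>] by (auto simp: compose_def fun_eq_iff)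
  then show "perm_act n (\<sigma> \<circ> \<tau>) w = perm_act n \<sigma> (perm_act n \<tau> w)"
    using map_comp[OF restrict_permutation_hom[OF \<tau>] restrict_permutation_hom[OF \<sigma>] w]
    by (simp add: perm_act_def)
next
  fix w assume "w \<in> V {1..n}"
  then show "perm_act n id w = w"
    using map_id[of "{1..n}" w] by (simp add: perm_act_def id_def)
qed (auto simp: perm_act_def subspace_obj map_add map_scale
    intro: map_closed[OF restrict_permutation_hom] map_add[OF restrict_permutation_hom]
      map_scale[OF restrict_permutation_hom])

sublocale rep: sym_rep scale n "V {1..n}" "perm_act n" for n
  by (rule sym_rep_perm_act)

lemma fi_rep_eq: "fi_rep scale V F n = \<lparr>rep_carrier = V {1..n}, rep_scale = scale, rep_act = perm_act n\<rparr>"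
  by (simp add: fi_rep_def perm_act_def fun_eq_iff)

lemma perm_act_map:
  assumes f: "f \<in> fi_hom S {1..n}" and \<sigma>: "\<sigma> permutes {1..n}" and v: "v \<in> V S"
  shows "perm_act n \<sigma> (F S {1..n} f v) = F S {1..n} (\<lambda>i\<in>S. \<sigma> (f i)) v"
proof -
  have "compose S (restrict \<sigma> {1..n}) f = (\<lambda>i\<in>S. \<sigma> (f i))"
    using f by (auto simp: compose_def fun_eq_iff fi_hom_def)
  then show ?thesis
    using map_comp[OF f restrict_permutation_hom[OF \<sigma>] v] by (simp add: perm_act_def)
qed

text \<open>The spans of these sets form the submodule generated by G. In each degree the set is
  finite when G is.\<close>

definition translates :: "(nat \<times> 'v) set \<Rightarrow> nat set \<Rightarrow> 'v set" where
  "translates G S = {F {1..m} S f v | m v f. (m, v) \<in> G \<and> f \<in> fi_hom {1..m} S}"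

lemma translates_subset: "G \<subseteq> (SIGMA n:UNIV. V {1..n}) \<Longrightarrow> translates G S \<subseteq> V S"
  by (auto simp: translates_def intro: map_closed)

lemma finite_translates: "finite G \<Longrightarrow> finite (translates G S)"
proof -
  assume G: "finite G"
  have "translates G S = (\<Union>(m, v)\<in>G. (\<lambda>f. F {1..m} S f v) ` fi_hom {1..m} S)"
    by (auto simp: translates_def)
  then show ?thesis using G by (auto simp: finite_fi_hom)
qed

lemma map_span_translates:
  assumes G: "G \<subseteq> (SIGMA n:UNIV. V {1..n})" and f: "f \<in> fi_hom S T" and x: "x \<in> span (translates G S)"
  shows "F S T f x \<in> span (translates G T)"
proof -
  have S: "finite S" using f by (simp add: fi_hom_def)
  let ?P = "{x \<in> V S. F S T f x \<in> span (translates G T)}"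
  have "subspace ?P"
  proof (rule subspaceI)
    show "0 \<in> ?P"
      using map_zero[OF f] subspace_0[OF subspace_obj[OF S]] span_zero by simp
    show "x + y \<in> ?P" if "x \<in> ?P" "y \<in> ?P" for x y
      using that map_add[OF f] subspace_add[OF subspace_obj[OF S]] span_add by simp
    show "scale a x \<in> ?P" if "x \<in> ?P" for a x
      using that map_scale[OF f] subspace_scale[OF subspace_obj[OF S]] span_scale by simp
  qed
  moreover have "translates G S \<subseteq> ?P"
  proof
    fix x assume "x \<in> translates G S"
    then obtain m v g where x: "x = F {1..m} S g v" "(m, v) \<in> G" "g \<in> fi_hom {1..m} S"
      by (auto simp: translates_def)
    then have v: "v \<in> V {1..m}" using G by blast
    have "F S T f x = F {1..m} T (compose {1..m} f g) v"
      using map_comp[OF x(3) f v] x(1) by simp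
    moreover have "compose {1..m} f g \<in> fi_hom {1..m} T"
      by (rule fi_hom_compose[OF x(3) f])
    ultimately have "F S T f x \<in> translates G T" using x(2) by (auto simp: translates_def)
    then show "x \<in> ?P" using map_closed[OF x(3) v] x(1) span_base by auto
  qed
  ultimately have "span (translates G S) \<subseteq> ?P" by (rule span_minimal[rotated])
  with x show ?thesis by blast
qed

text \<open>The spans of the translates form a submodule, and it contains G because identities are
  morphisms.\<close>

lemma finitely_generated_spanE:
  assumes "fi_finitely_generated scale V F"
  obtains G where "finite G" "G \<subseteq> (SIGMA n:UNIV. V {1..n})"
    "\<And>S. finite S \<Longrightarrow> span (translates G S) = V S"
proof -
  obtain G where G: "G \<subseteq> (SIGMA n:UNIV. V {1..n})" "finite G"
    and gen: "\<forall>U. fi_submodule scale V F U \<and> (\<forall>(n, v) \<in> G. v \<in> U {1..n}) \<longrightarrow> (\<forall>S. finite S \<longrightarrow> U S = V S)"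
    using assms unfolding fi_finitely_generated_def by (elim exE conjE)
  let ?U = "\<lambda>S. span (translates G S)"
  have "fi_submodule scale V F ?U"
    unfolding fi_submodule_def
    by (intro conjI allI impI ballI span_minimal[OF translates_subset[OF G(1)] subspace_obj]
        subspace_span map_span_translates[OF G(1)])
  moreover have "\<forall>(n, v) \<in> G. v \<in> ?U {1..n}"
  proof clarify
    fix n v assume nv: "(n, v) \<in> G"
    then have "v \<in> V {1..n}" using G by blast
    then have "v = F {1..n} {1..n} (\<lambda>i\<in>{1..n}. i) v" using map_id by simp
    moreover have "(\<lambda>i\<in>{1..n}. i) \<in> fi_hom {1..n} {1..n}" by (auto simp: fi_hom_def inj_on_def)
    ultimately have "v \<in> translates G {1..n}" using nv unfolding translates_def by blast
    then show "v \<in> ?U {1..n}" by (rule span_base)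
  qed
  ultimately have "\<forall>S. finite S \<longrightarrow> ?U S = V S" by (intro gen[THEN spec, THEN mp] conjI)
  then show ?thesis by (intro that[OF G(2,1)]) simp
qed

lemma fi_phi_eq_skip: "fi_phi F n = F {1..n} {1..Suc n} (skip n (Suc n))"
proof -
  have "skip n (Suc n) = (\<lambda>i\<in>{1..n}. i)" by (auto simp: skip_def fun_eq_iff)
  then show ?thesis by (simp add: fi_phi_def)
qed

text \<open>Closing the gap at k turns f into an injection f' into {1..n}, and
  \<open>skip n k\<close> opens the gap again.\<close>

lemma factor_through_skip:
  assumes f: "f \<in> fi_hom {1..m} {1..Suc n}" and k: "k \<in> {1..Suc n}" "k \<notin> f ` {1..m}" and v: "v \<in> V {1..m}"
  obtains x where "x \<in> V {1..n}" "F {1..m} {1..Suc n} f v = F {1..n} {1..Suc n} (skip n k) x"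
proof -
  define f' where "f' = (\<lambda>i\<in>{1..m}. if f i < k then f i else f i - 1)"
  have ne: "f i \<noteq> k" "f i \<in> {1..Suc n}" if "i \<in> {1..m}" for i
    using that k f by (auto simp: fi_hom_def)
  have f': "f' \<in> fi_hom {1..m} {1..n}"
    unfolding f'_def
  proof (rule fi_homI)
    show "inj_on (\<lambda>i. if f i < k then f i else f i - 1) {1..m}"
    proof (rule inj_onI)
      fix i j assume ij: "i \<in> {1..m}" "j \<in> {1..m}"
        and "(if f i < k then f i else f i - 1) = (if f j < k then f j else f j - 1)"
      then have "f i = f j" using ne[OF ij(1)] ne[OF ij(2)] by (auto split: if_splits)
      moreover have "inj_on f {1..m}" using f by (simp add: fi_hom_def)
      ultimately show "i = j" using ij by (blast dest: inj_onD)
    qed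
    show "(if f i < k then f i else f i - 1) \<in> {1..n}" if "i \<in> {1..m}" for i
      using ne[OF that] k by auto
  qed auto
  have "compose {1..m} (skip n k) f' = f"
  proof
    fix i
    show "compose {1..m} (skip n k) f' i = f i"
    proof (cases "i \<in> {1..m}")
      case True
      then show ?thesis
        using ne[OF True] k by (auto simp: compose_def skip_def f'_def)
    next
      case False
      then show ?thesis using f by (auto simp: compose_def fi_hom_def PiE_def extensional_def)
    qed
  qed
  then have "F {1..m} {1..Suc n} f v = F {1..n} {1..Suc n} (skip n k) (F {1..m} {1..n} f' v)"
    using map_comp[OF f' skip_hom v] by metis
  then show ?thesis using that map_closed[OF f' v] by blast
qed

text \<open>The two injections differ by the permutation that sends n + 1 to k and moves the letters
  from k to n up by one.\<close>

lemma skip_eq_perm_phi: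
  assumes k: "k \<in> {1..Suc n}"
  obtains \<sigma> where "\<sigma> permutes {1..Suc n}"
    "\<And>x. x \<in> V {1..n} \<Longrightarrow> F {1..n} {1..Suc n} (skip n k) x = perm_act (Suc n) \<sigma> (fi_phi F n x)"
proof -
  define \<sigma> where "\<sigma> e = (if e \<in> {1..n} then skip n k e else if e = Suc n then k else e)" for e
  have range: "\<sigma> e \<in> {1..Suc n}" if "e \<in> {1..Suc n}" for e
    using that k by (auto simp: \<sigma>_def skip_def)
  have "inj_on \<sigma> {1..Suc n}"
    by (rule inj_onI) (auto simp: \<sigma>_def skip_def split: if_splits)
  then have "bij_betw \<sigma> {1..Suc n} {1..Suc n}"
    using range by (metis bij_betw_def endo_inj_surj finite_atLeastAtMost image_subsetI)
  then have \<sigma>: "\<sigma> permutes {1..Suc n}"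
    by (rule bij_imp_permutes) (auto simp: \<sigma>_def)
  have eq: "(\<lambda>i\<in>{1..n}. \<sigma> (skip n (Suc n) i)) = skip n k"
    by (auto simp: \<sigma>_def skip_def fun_eq_iff)
  have "F {1..n} {1..Suc n} (skip n k) x = perm_act (Suc n) \<sigma> (fi_phi F n x)" if "x \<in> V {1..n}" for x
    using perm_act_map[OF skip_hom \<sigma> that, of "Suc n"] by (simp add: eq fi_phi_eq_skip)
  then show ?thesis using that \<sigma> by blast
qed

end

section \<open>Enlarging the first row of a Young diagram\<close>

lemma young_cells_padded:
  "(0, j) \<in> young_cells (padded n \<nu>) \<longleftrightarrow> j < n - sum_list \<nu>"
  "(Suc i, j) \<in> young_cells (padded n \<nu>) \<longleftrightarrow> i < length \<nu> \<and> j < \<nu> ! i"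
  by (simp_all add: young_cells_def padded_def)

lemma padded_row_col:
  assumes \<nu>: "\<nu> \<in> admissible n" and e: "e \<in> {1..n}" and col: "first_part \<nu> \<le> col_of (padded n \<nu>) e"
  shows "row_of (padded n \<nu>) e = 0"
proof (rule ccontr)
  let ?i = "row_of (padded n \<nu>) e"
  assume "?i \<noteq> 0"
  then obtain i where i: "?i = Suc i" by (cases ?i) auto
  have "(?i, col_of (padded n \<nu>) e) \<in> young_cells (padded n \<nu>)"
    using e padded_size[OF \<nu>] by (intro cell_of_entry) simp
  then have cell: "i < length \<nu>" "col_of (padded n \<nu>) e < \<nu> ! i"
    unfolding i young_cells_padded by simp_all
  have "sorted_wrt (\<ge>) \<nu>" using \<nu> by (simp add: admissible_def is_partition_def)
  then have "\<nu> ! i \<le> first_part \<nu>"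
    using cell(1) by (cases \<nu>; cases i) (auto simp: first_part_def)
  with cell(2) col show False by simp
qed

text \<open>The columns with index at least \<open>first_part \<nu>\<close> lie beyond all lower
  rows and have a single cell.\<close>

lemma column_group_fixes:
  assumes \<nu>: "\<nu> \<in> admissible n" and e: "e \<in> {1..n}" and col: "first_part \<nu> \<le> col_of (padded n \<nu>) e"
    and q: "q \<in> column_group (padded n \<nu>)"
  shows "q e = e"
proof -
  have qp: "q permutes {1..n}" using column_group_permutes[OF q] padded_size[OF \<nu>] by simp
  then have qe: "q e \<in> {1..n}" using e permutes_in_image[OF qp] by blast
  have c: "col_of (padded n \<nu>) (q e) = col_of (padded n \<nu>) e"
    using q e padded_size[OF \<nu>] by (simp add: column_group_iff)
  have "row_of (padded n \<nu>) (q e) = 0"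
    by (rule padded_row_col[OF \<nu> qe]) (simp add: c col)
  moreover have "row_of (padded n \<nu>) e = 0" by (rule padded_row_col[OF \<nu> e col])
  ultimately show ?thesis
    using row_col_inj[of "q e" "padded n \<nu>" e] c qe e by (simp only: padded_size[OF \<nu>])
qed

lemma padded_first_row:
  assumes "j < n - sum_list \<nu>"
  shows "row_of (padded n \<nu>) (Suc j) = 0" "col_of (padded n \<nu>) (Suc j) = j"
  using row_of_entry[of 0 j "padded n \<nu>"] col_of_entry[of 0 j "padded n \<nu>"] assms
  by (simp_all add: padded_def young_cells_def)

context
  fixes n :: nat and \<nu> :: "nat list" and k :: nat
  assumes \<nu>: "\<nu> \<in> admissible n"
  defines "k \<equiv> Suc (n - sum_list \<nu>)"
begin

lemma admissible_Suc: "\<nu> \<in> admissible (Suc n)"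
  using \<nu> by (simp add: admissible_def)

lemma new_entry_range: "k \<in> {1..Suc n}"
  by (simp add: k_def)

lemma new_entry_cell: "row_of (padded (Suc n) \<nu>) k = 0" "col_of (padded (Suc n) \<nu>) k = n - sum_list \<nu>"
  using padded_first_row[of "n - sum_list \<nu>" "Suc n" \<nu>] \<nu> by (auto simp: k_def admissible_def)

text \<open>k is the entry of the last cell of the first row of the larger diagram. Skipping it
  keeps the rest of that row and raises the entries of all lower rows by one, exactly as the longer
  first row does.\<close>

lemma skip_cell:
  assumes e: "e \<in> {1..n}"
  shows "row_of (padded (Suc n) \<nu>) (skip n k e) = row_of (padded n \<nu>) e"
    "col_of (padded (Suc n) \<nu>) (skip n k e) = col_of (padded n \<nu>) e"
proof -
  let ?i = "row_of (padded n \<nu>) e" and ?j = "col_of (padded n \<nu>) e"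
  have cell: "(?i, ?j) \<in> young_cells (padded n \<nu>)" and entry: "young_entry (padded n \<nu>) ?i ?j = e"
    using e padded_size[OF \<nu>] by (simp_all add: cell_of_entry entry_of_cell)
  have Suc_diff: "Suc n - sum_list \<nu> = Suc (n - sum_list \<nu>)" using \<nu> by (simp add: admissible_def Suc_diff_le)
  have cell': "(?i, ?j) \<in> young_cells (padded (Suc n) \<nu>)"
    using cell by (cases ?i) (auto simp: padded_def young_cells_def)
  have "young_entry (padded (Suc n) \<nu>) ?i ?j = skip n k e"
  proof (cases ?i)
    case 0
    then show ?thesis
      using cell entry e by (simp add: padded_def young_cells_def skip_def k_def)
  next
    case (Suc i)
    have "young_entry \<nu> i ?j \<ge> 1" by (simp add: young_entry_def)
    then show ?thesis
      using entry e Suc Suc_diff by (simp add: padded_def skip_def k_def)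
  qed
  then show "row_of (padded (Suc n) \<nu>) (skip n k e) = ?i" "col_of (padded (Suc n) \<nu>) (skip n k e) = ?j"
    using row_of_entry[OF cell'] col_of_entry[OF cell'] by simp_all
qed

section \<open>Lifting permutations to the larger diagram\<close>

lemma inj_skip: "inj_on (skip n k) {1..n}"
  using skip_hom[of n k] by (simp add: fi_hom_def)

lemma bij_skip: "bij_betw (skip n k) {1..n} ({1..Suc n} - {k})"
  using inj_skip skip_image[OF new_entry_range] by (simp add: bij_betw_def)

definition lift_perm :: "(nat \<Rightarrow> nat) \<Rightarrow> nat \<Rightarrow> nat" where
  "lift_perm q = map_permutation {1..n} (skip n k) q"

lemma lift_perm_permutes: "q permutes {1..n} \<Longrightarrow> lift_perm q permutes {1..Suc n} - {k}"
  unfolding lift_perm_def by (rule map_permutation_permutes[OF bij_skip])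

lemma lift_perm_permutes': "q permutes {1..n} \<Longrightarrow> lift_perm q permutes {1..Suc n}"
  by (rule permutes_subset[OF lift_perm_permutes]) auto

lemma lift_perm_skip: "e \<in> {1..n} \<Longrightarrow> lift_perm q (skip n k e) = skip n k (q e)"
  unfolding lift_perm_def by (rule map_permutation_apply[OF inj_skip])

lemma lift_perm_new_entry: "q permutes {1..n} \<Longrightarrow> lift_perm q k = k"
  using permutes_not_in[OF lift_perm_permutes] by blast

lemma skip_cases:
  assumes "e' \<in> {1..Suc n}"
  obtains "e' = k" | e where "e \<in> {1..n}" "e' = skip n k e"
  using assms skip_image[OF new_entry_range] by blast

lemma lift_row_group:
  assumes p: "p \<in> row_group (padded n \<nu>)"
  shows "lift_perm p \<in> row_group (padded (Suc n) \<nu>)"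
proof -
  have pp: "p permutes {1..n}" using row_group_permutes[OF p] padded_size[OF \<nu>] by simp
  have "row_of (padded (Suc n) \<nu>) (lift_perm p e') = row_of (padded (Suc n) \<nu>) e'" if "e' \<in> {1..Suc n}" for e'
    using that
  proof (cases rule: skip_cases)
    case (2 e)
    have "p e \<in> {1..n}" using 2(1) permutes_in_image[OF pp] by blast
    then show ?thesis
      using 2 p padded_size[OF \<nu>] by (simp add: lift_perm_skip skip_cell row_group_iff)
  qed (simp add: lift_perm_new_entry pp)
  then show ?thesis
    using lift_perm_permutes'[OF pp] padded_size[OF admissible_Suc] by (simp add: row_group_iff)
qed

text \<open>Admissibility at n places the new cell beyond all lower rows, alone in its column. A
  column permutation of the larger diagram therefore fixes k and comes from the smaller one.\<close>

lemma bij_lift_column_group: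
  "bij_betw lift_perm (column_group (padded n \<nu>)) (column_group (padded (Suc n) \<nu>))"
proof -
  have perm: "q permutes {1..n}" if "q \<in> column_group (padded n \<nu>)" for q
    using column_group_permutes[OF that] padded_size[OF \<nu>] by simp
  have "inj_on lift_perm (column_group (padded n \<nu>))"
  proof (rule inj_onI)
    fix q q' assume q: "q \<in> column_group (padded n \<nu>)" and q': "q' \<in> column_group (padded n \<nu>)"
      and eq: "lift_perm q = lift_perm q'"
    show "q = q'"
    proof
      fix e
      show "q e = q' e"
      proof (cases "e \<in> {1..n}")
        case True
        then have "skip n k (q e) = skip n k (q' e)" using eq lift_perm_skip by metis
        then show ?thesis
          using inj_onD[OF inj_skip] permutes_in_image[OF perm[OF q]] permutes_in_image[OF perm[OF q']] True
          by blast
      next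
        case False
        then show ?thesis using permutes_not_in[OF perm[OF q]] permutes_not_in[OF perm[OF q']] by simp
      qed
    qed
  qed
  moreover have "lift_perm q \<in> column_group (padded (Suc n) \<nu>)" if q: "q \<in> column_group (padded n \<nu>)" for q
  proof -
    have "col_of (padded (Suc n) \<nu>) (lift_perm q e') = col_of (padded (Suc n) \<nu>) e'" if "e' \<in> {1..Suc n}" for e'
      using that
    proof (cases rule: skip_cases)
      case (2 e)
      have "q e \<in> {1..n}" using 2(1) permutes_in_image[OF perm[OF q]] by blast
      then show ?thesis
        using 2 q padded_size[OF \<nu>] by (simp add: lift_perm_skip skip_cell column_group_iff)
    qed (simp add: lift_perm_new_entry perm[OF q])
    then show ?thesis
      using lift_perm_permutes'[OF perm[OF q]] padded_size[OF admissible_Suc] by (simp add: column_group_iff)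
  qed
  moreover have "q' \<in> lift_perm ` column_group (padded n \<nu>)" if q': "q' \<in> column_group (padded (Suc n) \<nu>)" for q'
  proof
    have q'p: "q' permutes {1..Suc n}" using column_group_permutes[OF q'] padded_size[OF admissible_Suc] by simp
    have "q' k = k"
      by (rule column_group_fixes[OF admissible_Suc new_entry_range _ q'])
         (use \<nu> new_entry_cell in \<open>auto simp: admissible_def\<close>)
    then have q'k: "q' permutes {1..Suc n} - {k}"
      by (intro permutes_superset[OF q'p]) auto
    define q where "q = map_permutation ({1..Suc n} - {k}) (inv_into {1..n} (skip n k)) q'"
    have qp: "q permutes {1..n}"
      unfolding q_def by (rule map_permutation_permutes[OF bij_betw_inv_into[OF bij_skip] q'k])
    show lift_perm_q: "q' = lift_perm q"
      unfolding lift_perm_def q_def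
      by (rule map_permutation_compose_inv[symmetric, OF bij_betw_inv_into[OF bij_skip] q'k])
         (use bij_betw_inv_into_right[OF bij_skip] in blast)
    have "col_of (padded n \<nu>) (q e) = col_of (padded n \<nu>) e" if e: "e \<in> {1..n}" for e
    proof -
      have qe: "q e \<in> {1..n}" using e permutes_in_image[OF qp] by blast
      have "skip n k e \<in> {1..Suc n}" using e skip_image[OF new_entry_range] by blast
      then have "col_of (padded (Suc n) \<nu>) (q' (skip n k e)) = col_of (padded (Suc n) \<nu>) (skip n k e)"
        using q' padded_size[OF admissible_Suc] by (simp add: column_group_iff)
      then show ?thesis using lift_perm_skip[OF e, of q] skip_cell[OF e] skip_cell[OF qe] by (simp add: lift_perm_q)
    qed
    then show "q \<in> column_group (padded n \<nu>)"
      using qp padded_size[OF \<nu>] by (simp add: column_group_iff)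
  qed
  ultimately show ?thesis by (auto simp: bij_betw_def)
qed

lemma sign_lift: "q permutes {1..n} \<Longrightarrow> sign (lift_perm q) = sign q"
  unfolding lift_perm_def by (intro sign_map_permutation inj_skip) auto

end

section \<open>Weight and stability\<close>

locale fi_module_char_0 = fi_module scale V F
  for scale :: "'k::field_char_0 \<Rightarrow> 'v::ab_group_add \<Rightarrow> 'v" and V F
begin

sublocale rep: sym_rep_char_0 scale n "V {1..n}" "perm_act n" for n
  by (rule sym_rep_char_0.intro[OF sym_rep_perm_act])

text \<open>When V_n has finite dimension, the dimension of this space is the multiplicity of
  V(\<nu>)_n, by \<open>has_multiplicities_dim\<close>.\<close>

definition young_part :: "nat \<Rightarrow> nat list \<Rightarrow> 'v set" where
  "young_part n \<nu> = rep.act n (young_symmetrizer (padded n \<nu>)) ` V {1..n}"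

definition enlarge :: "nat \<Rightarrow> nat list \<Rightarrow> 'v \<Rightarrow> 'v" where
  "enlarge n \<nu> = F {1..n} {1..Suc n} (skip n (Suc (n - sum_list \<nu>)))"

definition transfer :: "nat \<Rightarrow> nat list \<Rightarrow> 'v \<Rightarrow> 'v" where
  "transfer n \<nu> y = rep.act (Suc n) (row_sum (padded (Suc n) \<nu>)) (enlarge n \<nu> y)"

lemma enlarge_closed: "x \<in> V {1..n} \<Longrightarrow> enlarge n \<nu> x \<in> V {1..Suc n}"
  unfolding enlarge_def by (rule map_closed[OF skip_hom])

lemma enlarge_perm:
  assumes \<nu>: "\<nu> \<in> admissible n" and q: "q permutes {1..n}" and x: "x \<in> V {1..n}"
  shows "enlarge n \<nu> (perm_act n q x) = perm_act (Suc n) (lift_perm n \<nu> q) (enlarge n \<nu> x)"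
proof -
  let ?s = "skip n (Suc (n - sum_list \<nu>))"
  have eq: "compose {1..n} ?s (restrict q {1..n}) = (\<lambda>i\<in>{1..n}. lift_perm n \<nu> q (?s i))"
    by (rule ext) (simp add: compose_def lift_perm_skip[OF \<nu>] del: atLeastAtMost_iff)
  have "enlarge n \<nu> (perm_act n q x) = F {1..n} {1..Suc n} (compose {1..n} ?s (restrict q {1..n})) x"
    unfolding enlarge_def perm_act_def using map_comp[OF restrict_permutation_hom[OF q] skip_hom x] by simp
  also have "\<dots> = perm_act (Suc n) (lift_perm n \<nu> q) (enlarge n \<nu> x)"
    unfolding eq enlarge_def by (rule perm_act_map[OF skip_hom lift_perm_permutes'[OF \<nu> q] x, symmetric])
  finally show ?thesis .
qed

text \<open>Lifting matches the two column groups and preserves signs, and \<open>enlarge\<close>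
  carries the action of a permutation to the action of its lift.\<close>

lemma enlarge_column_sum:
  assumes \<nu>: "\<nu> \<in> admissible n" and x: "x \<in> V {1..n}"
  shows "rep.act (Suc n) (column_sum (padded (Suc n) \<nu>)) (enlarge n \<nu> x)
    = enlarge n \<nu> (rep.act n (column_sum (padded n \<nu>)) x)"
proof -
  have perm: "q permutes {1..n}" if "q \<in> column_group (padded n \<nu>)" for q
    using column_group_permutes[OF that] padded_size[OF \<nu>] by simp
  have "rep.act (Suc n) (column_sum (padded (Suc n) \<nu>)) (enlarge n \<nu> x)
    = (\<Sum>q\<in>column_group (padded n \<nu>). scale (of_int (sign (lift_perm n \<nu> q)))
        (perm_act (Suc n) (lift_perm n \<nu> q) (enlarge n \<nu> x)))"
    unfolding rep.act_column_sum[OF padded_size[OF admissible_Suc[OF \<nu>]]]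
    by (rule sum.reindex_bij_betw[OF bij_lift_column_group[OF \<nu>], symmetric])
  also have "\<dots> = (\<Sum>q\<in>column_group (padded n \<nu>). scale (of_int (sign q)) (enlarge n \<nu> (perm_act n q x)))"
    by (intro sum.cong refl) (simp add: sign_lift[OF \<nu>] enlarge_perm[OF \<nu> _ x] perm)
  also have "\<dots> = enlarge n \<nu> (rep.act n (column_sum (padded n \<nu>)) x)"
    unfolding rep.act_column_sum[OF padded_size[OF \<nu>]] enlarge_def
    by (rule map_sum[OF skip_hom, symmetric]) (simp add: rep.action_closed perm x)
  finally show ?thesis .
qed

text \<open>The row sum a' absorbs lifted row permutations, so a' \<iota>(a z) is |R| times a'
  \<iota>(z), where R is the row group of the smaller shape. For z = b x the column sum passes
  through: \<iota>(b x) = b' \<iota>(x).\<close>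

lemma transfer_symmetrizer:
  assumes \<nu>: "\<nu> \<in> admissible n" and x: "x \<in> V {1..n}"
  shows "transfer n \<nu> (rep.act n (young_symmetrizer (padded n \<nu>)) x)
    = scale (of_nat (card (row_group (padded n \<nu>))))
        (rep.act (Suc n) (young_symmetrizer (padded (Suc n) \<nu>)) (enlarge n \<nu> x))"
proof -
  let ?a' = "row_sum (padded (Suc n) \<nu>)" and ?R = "row_group (padded n \<nu>)"
  define z where "z = rep.act n (column_sum (padded n \<nu>)) x"
  have z: "z \<in> V {1..n}" unfolding z_def by (rule rep.act_closed[OF x])
  have perm: "p permutes {1..n}" if "p \<in> ?R" for p
    using row_group_permutes[OF that] padded_size[OF \<nu>] by simp
  have "transfer n \<nu> (rep.act n (young_symmetrizer (padded n \<nu>)) x)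
    = rep.act (Suc n) ?a' (enlarge n \<nu> (\<Sum>p\<in>?R. scale 1 (perm_act n p z)))"
    unfolding transfer_def rep.act_young_symmetrizer[OF padded_size[OF \<nu>] x] z_def[symmetric]
      rep.act_row_sum[OF padded_size[OF \<nu>]] by simp
  also have "\<dots> = rep.act (Suc n) ?a' (\<Sum>p\<in>?R. perm_act (Suc n) (lift_perm n \<nu> p) (enlarge n \<nu> z))"
  proof -
    have "enlarge n \<nu> (\<Sum>p\<in>?R. scale 1 (perm_act n p z))
      = (\<Sum>p\<in>?R. scale 1 (enlarge n \<nu> (perm_act n p z)))"
      unfolding enlarge_def by (rule map_sum[OF skip_hom]) (simp add: rep.action_closed perm z)
    also have "\<dots> = (\<Sum>p\<in>?R. perm_act (Suc n) (lift_perm n \<nu> p) (enlarge n \<nu> z))"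
      by (intro sum.cong refl) (simp add: enlarge_perm[OF \<nu> _ z] perm)
    finally show ?thesis by simp
  qed
  also have "\<dots> = (\<Sum>p\<in>?R. rep.act (Suc n) ?a' (perm_act (Suc n) (lift_perm n \<nu> p) (enlarge n \<nu> z)))"
    by (rule rep.act_sum_right) (simp add: rep.action_closed enlarge_closed z lift_perm_permutes'[OF \<nu>] perm)
  also have "\<dots> = (\<Sum>p\<in>?R. rep.act (Suc n) ?a' (enlarge n \<nu> z))"
    by (intro sum.cong refl rep.act_row_sum_row padded_size admissible_Suc \<nu> lift_row_group enlarge_closed z)
  also have "\<dots> = scale (of_nat (card ?R)) (rep.act (Suc n) ?a' (enlarge n \<nu> z))"
    by (simp add: sum_constant_scale)
  also have "rep.act (Suc n) ?a' (enlarge n \<nu> z)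
    = rep.act (Suc n) (young_symmetrizer (padded (Suc n) \<nu>)) (enlarge n \<nu> x)"
    unfolding rep.act_young_symmetrizer[OF padded_size[OF admissible_Suc[OF \<nu>]] enlarge_closed[OF x]]
      enlarge_column_sum[OF \<nu> x] z_def ..
  finally show ?thesis .
qed

lemma enlarge_add: "x \<in> V {1..n} \<Longrightarrow> y \<in> V {1..n} \<Longrightarrow> enlarge n \<nu> (x + y) = enlarge n \<nu> x + enlarge n \<nu> y"
  unfolding enlarge_def by (rule map_add[OF skip_hom])

lemma enlarge_scale: "x \<in> V {1..n} \<Longrightarrow> enlarge n \<nu> (scale a x) = scale a (enlarge n \<nu> x)"
  unfolding enlarge_def by (rule map_scale[OF skip_hom])

lemma transfer_add: "x \<in> V {1..n} \<Longrightarrow> y \<in> V {1..n} \<Longrightarrow> transfer n \<nu> (x + y) = transfer n \<nu> x + transfer n \<nu> y"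
  by (simp add: transfer_def enlarge_add rep.act_add_right enlarge_closed)

lemma transfer_scale: "x \<in> V {1..n} \<Longrightarrow> transfer n \<nu> (scale a x) = scale a (transfer n \<nu> x)"
  by (simp add: transfer_def enlarge_scale rep.act_scale_right enlarge_closed)

lemma young_part_subset: "young_part n \<nu> \<subseteq> V {1..n}"
  unfolding young_part_def using rep.act_closed by blast

lemma subspace_young_part: "subspace (young_part n \<nu>)"
  unfolding young_part_def by (rule rep.subspace_image_act)

lemma subspace_transfer_image: "subspace (transfer n \<nu> ` young_part n \<nu>)"
proof -
  note sub = subspace_young_part[of n \<nu>] and V = subsetD[OF young_part_subset]
  show ?thesis
  proof (rule subspaceI)
    have "transfer n \<nu> 0 = 0"
      using transfer_scale[OF V[OF subspace_0[OF sub]], where a = 0] by simp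
    then show "0 \<in> transfer n \<nu> ` young_part n \<nu>" using subspace_0[OF sub] by (metis imageI)
  next
    fix u v assume "u \<in> transfer n \<nu> ` young_part n \<nu>" "v \<in> transfer n \<nu> ` young_part n \<nu>"
    then obtain x y where "x \<in> young_part n \<nu>" "y \<in> young_part n \<nu>" "u = transfer n \<nu> x" "v = transfer n \<nu> y"
      by blast
    then show "u + v \<in> transfer n \<nu> ` young_part n \<nu>"
      by (intro image_eqI[of _ _ "x + y"]) (simp_all add: transfer_add V subspace_add[OF sub])
  next
    fix a u assume "u \<in> transfer n \<nu> ` young_part n \<nu>"
    then obtain x where "x \<in> young_part n \<nu>" "u = transfer n \<nu> x" by blast
    then show "scale a u \<in> transfer n \<nu> ` young_part n \<nu>"
      by (intro image_eqI[of _ _ "scale a x"]) (simp_all add: transfer_scale V subspace_scale[OF sub])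
  qed
qed

lemma generator_from_enlarge:
  assumes \<nu>: "\<nu> \<in> admissible n" and f: "f \<in> fi_hom {1..m} {1..Suc n}" and v: "v \<in> V {1..m}"
    and m: "m + sum_list \<nu> + first_part \<nu> \<le> n"
  obtains x where "x \<in> V {1..n}"
    "rep.act (Suc n) (young_symmetrizer (padded (Suc n) \<nu>)) (F {1..m} {1..Suc n} f v)
      = rep.act (Suc n) (young_symmetrizer (padded (Suc n) \<nu>)) (enlarge n \<nu> x)"
proof -
  let ?k = "Suc (n - sum_list \<nu>)" and ?\<mu> = "padded (Suc n) \<nu>"
  have \<nu>': "\<nu> \<in> admissible (Suc n)" by (rule admissible_Suc[OF \<nu>])
  note size = padded_size[OF \<nu>']
  have k: "?k \<in> {1..Suc n}" by (rule new_entry_range[OF \<nu>])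
  define u where "u = F {1..m} {1..Suc n} f v"
  have u: "u \<in> V {1..Suc n}" unfolding u_def by (rule map_closed[OF f v])
  show ?thesis
  proof (cases "?k \<in> f ` {1..m}")
    case False
    then obtain x where "x \<in> V {1..n}" "F {1..m} {1..Suc n} f v = enlarge n \<nu> x"
      unfolding enlarge_def by (rule factor_through_skip[OF f k _ v])
    then show ?thesis using that by metis
  next
    case True
    have "card (f ` {1..m}) \<le> m" using card_image_le[of "{1..m}" f] by simp
    \<comment> \<open>The entries in this interval are the cells of the first row in columns of
      index at least \<open>first_part \<nu>\<close>. They number n + 1 - |\<nu>| -
      \<open>first_part \<nu>\<close>, more than the at most m values of f.\<close>
    also have "m < card {Suc (first_part \<nu>)..?k}" using m by simp
    finally have "\<not> {Suc (first_part \<nu>)..?k} \<subseteq> f ` {1..m}"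
      by (meson card_mono finite_atLeastAtMost finite_imageI leD)
    then obtain j where e: "first_part \<nu> \<le> j" "j < Suc n - sum_list \<nu>" "Suc j \<notin> f ` {1..m}" "Suc j \<le> ?k"
      using m by (auto simp: subset_iff) (metis Suc_le_D Suc_le_mono Suc_diff_le add_leD1 add_leD2 le_imp_less_Suc)
    let ?e = "Suc j"
    have e_range: "?e \<in> {1..Suc n}" using e by auto
    have rows: "row_of ?\<mu> ?e = 0" "row_of ?\<mu> ?k = 0"
      and cols: "first_part \<nu> \<le> col_of ?\<mu> ?e" "first_part \<nu> \<le> col_of ?\<mu> ?k"
      using padded_first_row[OF e(2)] new_entry_cell[OF \<nu>] e m by simp_all
    define \<tau> where "\<tau> = transpose ?e ?k"
    have \<tau>_row: "\<tau> \<in> row_group ?\<mu>"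
      unfolding \<tau>_def using e_range k rows size by (intro transpose_in_row_group) simp_all
    then have \<tau>: "\<tau> permutes {1..Suc n}" using row_group_permutes size by metis
    \<comment> \<open>Both letters exchanged by \<tau> are alone in their columns, so q fixes them.
      This lets \<tau> pass the column sum and be absorbed by the row sum.\<close>
    have commute: "q \<circ> \<tau> = \<tau> \<circ> q" if q: "q \<in> column_group ?\<mu>" for q
    proof -
      have fixed: "q ?e = ?e" "q ?k = ?k"
        using column_group_fixes[OF \<nu>' e_range cols(1) q] column_group_fixes[OF \<nu>' k cols(2) q] by auto
      have "inj q" using column_group_permutes[OF q] by (rule permutes_inj)
      show ?thesis
      proof
        fix x
        consider "x = ?e" | "x = ?k" | "x \<noteq> ?e" "x \<noteq> ?k" by blast
        then show "(q \<circ> \<tau>) x = (\<tau> \<circ> q) x"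
        proof cases
          case 3
          then have "q x \<noteq> ?e" "q x \<noteq> ?k"
            using injD[OF \<open>inj q\<close>, of x ?e] injD[OF \<open>inj q\<close>, of x ?k] fixed by auto
          then show ?thesis using 3 by (simp add: \<tau>_def)
        qed (simp_all add: \<tau>_def fixed)
      qed
    qed
    have perm: "q permutes {1..Suc n}" if "q \<in> column_group ?\<mu>" for q
      using column_group_permutes[OF that] size by simp
    have swap: "rep.act (Suc n) (column_sum ?\<mu>) (perm_act (Suc n) \<tau> u)
      = perm_act (Suc n) \<tau> (rep.act (Suc n) (column_sum ?\<mu>) u)"
    proof -
      have "rep.act (Suc n) (column_sum ?\<mu>) (perm_act (Suc n) \<tau> u)
        = (\<Sum>q\<in>column_group ?\<mu>. scale (of_int (sign q)) (perm_act (Suc n) (q \<circ> \<tau>) u))"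
        unfolding rep.act_column_sum[OF size]
        by (intro sum.cong refl) (simp add: rep.action_comp perm \<tau> u)
      also have "\<dots> = (\<Sum>q\<in>column_group ?\<mu>. perm_act (Suc n) \<tau> (scale (of_int (sign q)) (perm_act (Suc n) q u)))"
        by (intro sum.cong refl)
           (simp add: commute rep.action_comp rep.action_scale rep.action_closed perm \<tau> u)
      also have "\<dots> = perm_act (Suc n) \<tau> (rep.act (Suc n) (column_sum ?\<mu>) u)"
        unfolding rep.act_column_sum[OF size]
        by (rule rep.action_sum[OF \<tau>, symmetric])
           (simp add: subspace_scale[OF rep.subspace_W] rep.action_closed perm u)
      finally show ?thesis .
    qed
    have "rep.act (Suc n) (young_symmetrizer ?\<mu>) (perm_act (Suc n) \<tau> u)
      = rep.act (Suc n) (row_sum ?\<mu>) (perm_act (Suc n) \<tau> (rep.act (Suc n) (column_sum ?\<mu>) u))"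
      by (simp add: rep.act_young_symmetrizer[OF size] rep.action_closed \<tau> u swap)
    also have "\<dots> = rep.act (Suc n) (young_symmetrizer ?\<mu>) u"
      by (simp add: rep.act_row_sum_row[OF size \<tau>_row] rep.act_closed u rep.act_young_symmetrizer[OF size])
    finally have eq: "rep.act (Suc n) (young_symmetrizer ?\<mu>) u
      = rep.act (Suc n) (young_symmetrizer ?\<mu>) (perm_act (Suc n) \<tau> u)" ..
    define f' where "f' = (\<lambda>i\<in>{1..m}. \<tau> (f i))"
    have \<tau>u: "perm_act (Suc n) \<tau> u = F {1..m} {1..Suc n} f' v"
      unfolding u_def f'_def by (rule perm_act_map[OF f \<tau> v])
    have "compose {1..m} (restrict \<tau> {1..Suc n}) f = f'"
      using f by (auto simp: compose_def f'_def fun_eq_iff fi_hom_def)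
    then have f': "f' \<in> fi_hom {1..m} {1..Suc n}"
      using fi_hom_compose[OF f restrict_permutation_hom[OF \<tau>]] by simp
    have "?k \<notin> f' ` {1..m}"
    proof
      assume "?k \<in> f' ` {1..m}"
      then obtain i where i: "i \<in> {1..m}" "\<tau> (f i) = ?k" by (auto simp: f'_def)
      then have "f i = ?e" by (auto simp: \<tau>_def transpose_def split: if_splits)
      then show False using e(3) imageI[OF i(1), of f] by simp
    qed
    then obtain x where "x \<in> V {1..n}" "F {1..m} {1..Suc n} f' v = enlarge n \<nu> x"
      unfolding enlarge_def by (rule factor_through_skip[OF f' k _ v])
    then show ?thesis using that eq \<tau>u u_def by metis
  qed
qed

context
  fixes G :: "(nat \<times> 'v) set" and d :: nat
  assumes G: "G \<subseteq> (SIGMA n:UNIV. V {1..n})"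
    and gen: "\<And>S. finite S \<Longrightarrow> span (translates G S) = V S"
    and deg: "\<And>m v. (m, v) \<in> G \<Longrightarrow> m \<le> d"
begin

text \<open>The w for which c' w lies in the image form a subspace, so translated generators
  suffice. For these c' w = c' \<iota>(x), which is the transfer of c x up to a factor that is
  invertible in characteristic 0. The bound on n is that of \<open>generator_from_enlarge\<close>
  with m \<le> d.\<close>

lemma transfer_surjective:
  assumes \<nu>: "\<nu> \<in> admissible n" and n: "d + sum_list \<nu> + first_part \<nu> \<le> n"
  shows "young_part (Suc n) \<nu> \<subseteq> transfer n \<nu> ` young_part n \<nu>"
proof -
  let ?c' = "young_symmetrizer (padded (Suc n) \<nu>)" and ?T = "transfer n \<nu> ` young_part n \<nu>"
  let ?r = "of_nat (card (row_group (padded n \<nu>))) :: 'k"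
  note sub = subspace_transfer_image[of n \<nu>]
  have "finite (row_group (padded n \<nu>))"
    by (rule finite_subset[OF _ finite_permutations[of "{1..sum_list (padded n \<nu>)}"]])
       (auto simp: row_group_def)
  then have r: "?r \<noteq> 0" using id_in_row_group by fastforce
  have enl: "rep.act (Suc n) ?c' (enlarge n \<nu> x) \<in> ?T" if x: "x \<in> V {1..n}" for x
  proof -
    have "transfer n \<nu> (rep.act n (young_symmetrizer (padded n \<nu>)) x) \<in> ?T"
      using x by (simp add: young_part_def)
    then have "scale (inverse ?r) (scale ?r (rep.act (Suc n) ?c' (enlarge n \<nu> x))) \<in> ?T"
      unfolding transfer_symmetrizer[OF \<nu> x] by (rule subspace_scale[OF sub])
    then show ?thesis using r by simp
  qed
  let ?P = "{w \<in> V {1..Suc n}. rep.act (Suc n) ?c' w \<in> ?T}"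
  have "subspace ?P"
    using subspace_0[OF rep.subspace_W] subspace_add[OF rep.subspace_W] subspace_scale[OF rep.subspace_W]
      subspace_0[OF sub] subspace_add[OF sub] subspace_scale[OF sub]
    by (intro subspaceI) (simp_all add: rep.act_add_right rep.act_scale_right)
  moreover have "translates G {1..Suc n} \<subseteq> ?P"
  proof
    fix w assume w: "w \<in> translates G {1..Suc n}"
    then obtain m v f where mvf: "w = F {1..m} {1..Suc n} f v" "(m, v) \<in> G" "f \<in> fi_hom {1..m} {1..Suc n}"
      by (auto simp: translates_def)
    have v: "v \<in> V {1..m}" using G mvf(2) by blast
    have "m + sum_list \<nu> + first_part \<nu> \<le> n" using deg[OF mvf(2)] n by simp
    then obtain x where "x \<in> V {1..n}" "rep.act (Suc n) ?c' w = rep.act (Suc n) ?c' (enlarge n \<nu> x)"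
      unfolding mvf(1) by (rule generator_from_enlarge[OF \<nu> mvf(3) v])
    moreover have "w \<in> V {1..Suc n}" using w translates_subset[OF G] by blast
    ultimately show "w \<in> ?P" using enl by simp
  qed
  ultimately have "V {1..Suc n} \<subseteq> ?P"
    using span_minimal gen[of "{1..Suc n}"] by (metis finite_atLeastAtMost)
  then show ?thesis by (auto simp: young_part_def)
qed

text \<open>A generator of degree \<open>m\<close> meets at most \<open>m\<close> cells. If there are more than \<open>m\<close> cells below
  the first row, some column contains two cells that it misses, and the transposition of these
  cells fixes the generator but is antisymmetrized.\<close>

lemma young_part_trivial:
  assumes \<nu>: "\<nu> \<in> admissible n" and d: "d < sum_list \<nu>"
  shows "young_part n \<nu> = {0}"
proof -
  let ?\<mu> = "padded n \<nu>"
  note size = padded_size[OF \<nu>]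
  have vanish: "rep.act n (young_symmetrizer ?\<mu>) (F {1..m} {1..n} f v) = 0"
    if mv: "(m, v) \<in> G" and f: "f \<in> fi_hom {1..m} {1..n}" for m v f
  proof -
    have v: "v \<in> V {1..m}" using G mv by blast
    define w where "w = F {1..m} {1..n} f v"
    have w: "w \<in> V {1..n}" unfolding w_def by (rule map_closed[OF f v])
    let ?H = "f ` {1..m}"
    have "\<exists>x y. x \<in> {1..n} - ?H \<and> y \<in> {1..n} - ?H \<and> x \<noteq> y \<and> col_of ?\<mu> x = col_of ?\<mu> y"
    proof (rule ccontr)
      assume no: "\<not> ?thesis"
      let ?top = "\<lambda>x. Suc (col_of ?\<mu> x)"
      let ?L = "{n - sum_list \<nu><..n}"
      have low: "x \<in> {1..n}" "row_of ?\<mu> x \<noteq> 0" if "x \<in> ?L" for x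
        using that row_of_less_iff[of x ?\<mu> "Suc 0"] size by (auto simp: padded_def)
      have top: "row_of ?\<mu> (?top x) = 0" "col_of ?\<mu> (?top x) = col_of ?\<mu> x" "?top x \<in> {1..n}"
        if x: "x \<in> {1..n}" for x
      proof -
        have "(row_of ?\<mu> x, col_of ?\<mu> x) \<in> young_cells ?\<mu>" using x size by (simp add: cell_of_entry)
        then have "(0, col_of ?\<mu> x) \<in> young_cells ?\<mu>"
        proof (cases "row_of ?\<mu> x")
          case (Suc i)
          assume "(row_of ?\<mu> x, col_of ?\<mu> x) \<in> young_cells ?\<mu>"
          then have "i < length \<nu>" "col_of ?\<mu> x < \<nu> ! i" unfolding Suc young_cells_padded by auto
          moreover have "\<nu> ! i \<le> n - sum_list \<nu>" if "i < length \<nu>"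
            using padded_sorted[OF \<nu>] that by (auto simp: padded_def)
          ultimately show ?thesis unfolding young_cells_padded by simp
        qed simp
        then have "col_of ?\<mu> x < n - sum_list \<nu>" unfolding young_cells_padded by simp
        then show "row_of ?\<mu> (?top x) = 0" "col_of ?\<mu> (?top x) = col_of ?\<mu> x" "?top x \<in> {1..n}"
          using padded_first_row by auto
      qed
      \<comment> \<open>If f misses a cell below the first row, it hits the top of that column, as
        otherwise the column would contain two missed cells. So g maps the |\<nu>| lower cells
        injectively into \<open>?H\<close>, which has at most d < |\<nu>| elements.\<close>
      define g where "g x = (if x \<in> ?H then x else ?top x)" for x
      have "g ` ?L \<subseteq> ?H"
      proof (rule image_subsetI)
        fix x assume x: "x \<in> ?L"
        note x_low = low[OF x]
        show "g x \<in> ?H"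
        proof (cases "x \<in> ?H")
          case False
          have "x \<noteq> ?top x" using x_low(2) top(1)[OF x_low(1)] by auto
          then have "?top x \<in> ?H"
            using no top(2,3)[OF x_low(1)] x_low(1) False by (metis Diff_iff)
          then show ?thesis using False by (simp add: g_def)
        qed (simp add: g_def)
      qed
      moreover have "inj_on g ?L"
      proof (rule inj_onI)
        fix x y assume xy: "x \<in> ?L" "y \<in> ?L" and eq: "g x = g y"
        note x = low[OF xy(1)] and y = low[OF xy(2)]
        show "x = y"
        proof (cases "x \<in> ?H"; cases "y \<in> ?H")
          assume "x \<notin> ?H" "y \<notin> ?H"
          then show ?thesis using eq no x y by (auto simp: g_def)
        qed (use eq x y top(1)[OF x(1)] top(1)[OF y(1)] in \<open>auto simp: g_def simp del: image_iff\<close>)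
      qed
      ultimately have "card ?L \<le> card ?H"
        by (metis card_image card_mono finite_atLeastAtMost finite_imageI)
      also have "card ?H \<le> m" using card_image_le[of "{1..m}" f] by simp
      also have "m \<le> d" using deg[OF mv] .
      finally show False using d \<nu> by (simp add: admissible_def)
    qed
    then obtain x y where xy: "x \<in> {1..n} - ?H" "y \<in> {1..n} - ?H" "x \<noteq> y" "col_of ?\<mu> x = col_of ?\<mu> y"
      by blast
    let ?t = "transpose x y"
    have t: "?t \<in> column_group ?\<mu>"
      using xy size by (intro transpose_in_column_group) auto
    then have tp: "?t permutes {1..n}" using column_group_permutes size by metis
    have "(\<lambda>i\<in>{1..m}. ?t (f i)) = f"
      using xy f by (auto simp: fun_eq_iff transpose_def fi_hom_def PiE_def extensional_def)
    then have "perm_act n ?t w = w" unfolding w_def using perm_act_map[OF f tp v] by simp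
    then have "rep.act n (column_sum ?\<mu>) w = - rep.act n (column_sum ?\<mu>) w"
      using rep.act_column_sum_column[OF size t w] xy(3) by (simp add: sign_swap_id)
    then have "scale 2 (rep.act n (column_sum ?\<mu>) w) = 0"
      by (metis add.right_inverse one_add_one scale_left_distrib scale_one)
    then have "rep.act n (column_sum ?\<mu>) w = 0" by simp
    then show ?thesis
      using rep.act_young_symmetrizer[OF size w] unfolding w_def by simp
  qed
  let ?P = "{w \<in> V {1..n}. rep.act n (young_symmetrizer ?\<mu>) w = 0}"
  have "subspace ?P"
    using subspace_0[OF rep.subspace_W] subspace_add[OF rep.subspace_W] subspace_scale[OF rep.subspace_W]
    by (intro subspaceI) (simp_all add: rep.act_add_right rep.act_scale_right)
  moreover have "translates G {1..n} \<subseteq> ?P"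
  proof
    fix w assume w: "w \<in> translates G {1..n}"
    then obtain m v f where "w = F {1..m} {1..n} f v" "(m, v) \<in> G" "f \<in> fi_hom {1..m} {1..n}"
      by (auto simp: translates_def)
    then show "w \<in> ?P" using vanish w translates_subset[OF G, of "{1..n}"] by auto
  qed
  ultimately have "V {1..n} \<subseteq> ?P"
    using span_minimal gen[of "{1..n}"] by (metis finite_atLeastAtMost)
  then show ?thesis
    using subspace_0[OF subspace_young_part[of n \<nu>]] by (auto simp: young_part_def)
qed

end

end

section \<open>Uniform representation stability\<close>

lemma eventually_constant:
  fixes f :: "nat \<Rightarrow> nat"
  assumes "\<And>n. n \<ge> a \<Longrightarrow> f (Suc n) \<le> f n"
  obtains N where "N \<ge> a" "\<And>n. n \<ge> N \<Longrightarrow> f n = f N"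
proof -
  obtain N where N: "N \<ge> a" "\<And>n. n \<ge> a \<Longrightarrow> f N \<le> f n"
    using ex_has_least_nat[of "\<lambda>n. n \<ge> a" a f] by blast
  have "f n \<le> f N" if "n \<ge> N" for n
    using that
  proof (induction n rule: dec_induct)
    case (step n)
    then show ?case using assms[of n] N(1) by simp
  qed simp
  then show ?thesis using that N by (meson le_antisym order_trans)
qed

context fi_module_char_0
begin

context
  fixes G :: "(nat \<times> 'v) set" and d :: nat
  assumes G: "G \<subseteq> (SIGMA n:UNIV. V {1..n})" and fin: "finite G"
    and gen: "\<And>S. finite S \<Longrightarrow> span (translates G S) = V S"
    and deg: "\<And>m v. (m, v) \<in> G \<Longrightarrow> m \<le> d"
begin

lemma young_part_span: "young_part n \<nu> \<subseteq> span (translates G {1..n})"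
  using young_part_subset gen by simp

lemma young_part_stabilizes:
  assumes "is_partition \<nu>"
  obtains N where "\<nu> \<in> admissible N"
    "\<And>n. n \<ge> N \<Longrightarrow> dim (young_part n \<nu>) = dim (young_part N \<nu>)"
    "\<And>n y. n \<ge> N \<Longrightarrow> y \<in> young_part n \<nu> \<Longrightarrow> transfer n \<nu> y = 0 \<Longrightarrow> y = 0"
proof -
  \<comment> \<open>From a on, \<nu> is admissible and the transfer maps are onto.\<close>
  define a where "a = d + sum_list \<nu> + first_part \<nu>"
  have adm: "\<nu> \<in> admissible n" if "n \<ge> a" for n
    using that assms by (simp add: admissible_def a_def)
  have T_add: "transfer n \<nu> (x + y) = transfer n \<nu> x + transfer n \<nu> y"
    if "x \<in> young_part n \<nu>" "y \<in> young_part n \<nu>" for n x y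
    using that young_part_subset[of n \<nu>] by (intro transfer_add) auto
  have T_scale: "transfer n \<nu> (scale b x) = scale b (transfer n \<nu> x)"
    if "x \<in> young_part n \<nu>" for n b x
    using that young_part_subset[of n \<nu>] by (intro transfer_scale) auto
  have surj: "young_part (Suc n) \<nu> \<subseteq> transfer n \<nu> ` young_part n \<nu>" if "n \<ge> a" for n
    by (rule transfer_surjective[OF G gen deg adm[OF that]]) (use that in \<open>simp_all add: a_def\<close>)
  have "dim (young_part (Suc n) \<nu>) \<le> dim (young_part n \<nu>)" if "n \<ge> a" for n
    by (rule dim_surjective_le[OF subspace_young_part finite_translates[OF fin] young_part_span
          T_add T_scale surj[OF that]])
  then obtain N where N: "N \<ge> a" "\<And>n. n \<ge> N \<Longrightarrow> dim (young_part n \<nu>) = dim (young_part N \<nu>)"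
    using eventually_constant[of a "\<lambda>n. dim (young_part n \<nu>)"] by metis
  have "y = 0" if "n \<ge> N" "y \<in> young_part n \<nu>" "transfer n \<nu> y = 0" for n y
    by (rule surjective_imp_injective[OF subspace_young_part finite_translates[OF fin] young_part_span
          T_add T_scale surj _ that(2,3)])
       (use that(1) N(1) N(2)[of n] N(2)[of "Suc n"] in simp_all)
  then show ?thesis using that adm[OF N(1)] N(2) by blast
qed

lemma fi_phi_closed: "x \<in> V {1..n} \<Longrightarrow> fi_phi F n x \<in> V {1..Suc n}"
  unfolding fi_phi_eq_skip by (rule map_closed[OF skip_hom])

lemma fi_phi_perm_act:
  assumes g: "g permutes {1..n}" and x: "x \<in> V {1..n}"
  shows "fi_phi F n (perm_act n g x) = perm_act (Suc n) g (fi_phi F n x)"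
proof -
  have g': "g permutes {1..Suc n}" by (rule permutes_subset[OF g]) auto
  have eq: "compose {1..n} (skip n (Suc n)) (restrict g {1..n}) = (\<lambda>i\<in>{1..n}. g (skip n (Suc n) i))"
  proof
    fix i
    show "compose {1..n} (skip n (Suc n)) (restrict g {1..n}) i = (\<lambda>i\<in>{1..n}. g (skip n (Suc n) i)) i"
      using permutes_in_image[OF g, of i] by (auto simp: compose_def skip_def)
  qed
  have "fi_phi F n (perm_act n g x) = F {1..n} {1..Suc n} (compose {1..n} (skip n (Suc n)) (restrict g {1..n})) x"
    unfolding fi_phi_eq_skip perm_act_def using map_comp[OF restrict_permutation_hom[OF g] skip_hom x] by simp
  also have "\<dots> = perm_act (Suc n) g (fi_phi F n x)"
    unfolding eq fi_phi_eq_skip by (rule perm_act_map[OF skip_hom g' x, symmetric])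
  finally show ?thesis .
qed

text \<open>The kernel of \<phi>_n is stable under S_n, so y = c_\<nu> g w lies in it. As
  \<open>enlarge\<close> is \<phi>_n followed by a permutation, the transfer kills y too, and y = 0.
  The resolution of the identity then gives w = 0.\<close>

lemma kernel_trivial:
  assumes w: "w \<in> V {1..n}" "fi_phi F n w = 0"
    and inj: "\<And>\<nu> y. \<nu> \<in> admissible n \<Longrightarrow> y \<in> young_part n \<nu> \<Longrightarrow> transfer n \<nu> y = 0 \<Longrightarrow> y = 0"
  shows "w = 0"
proof (rule rep.vanishes_if_symmetrizers_vanish[OF w(1)])
  fix \<nu> g assume \<nu>: "\<nu> \<in> admissible n" and g: "g permutes {1..n}"
  let ?c = "young_symmetrizer (padded n \<nu>) :: _ \<Rightarrow> 'k"
  define y where "y = rep.act n ?c (perm_act n g w)"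
  have gw: "perm_act n g w \<in> V {1..n}" by (rule rep.action_closed[OF g w(1)])
  have y: "y \<in> young_part n \<nu>" using gw by (simp add: y_def young_part_def)
  then have yV: "y \<in> V {1..n}" using young_part_subset by blast
  have zero: "perm_act (Suc n) h 0 = 0" if "h permutes {1..Suc n}" for h
    unfolding perm_act_def by (rule map_zero[OF restrict_permutation_hom[OF that]])
  have "fi_phi F n (perm_act n h (perm_act n g w)) = 0" if h: "h permutes {1..n}" for h
    using zero[OF permutes_subset[OF h]] zero[OF permutes_subset[OF g]]
    by (simp add: fi_phi_perm_act h g gw w)
  then have phi_y: "fi_phi F n y = 0"
    unfolding y_def rep.act_def fi_phi_eq_skip
    by (subst map_sum[OF skip_hom]) (simp_all add: rep.action_closed gw)
  obtain \<sigma> where \<sigma>: "\<sigma> permutes {1..Suc n}"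
    and "\<And>x. x \<in> V {1..n} \<Longrightarrow> enlarge n \<nu> x = perm_act (Suc n) \<sigma> (fi_phi F n x)"
    unfolding enlarge_def by (rule skip_eq_perm_phi[OF new_entry_range[OF \<nu>]]) blast
  then have "enlarge n \<nu> y = 0" using yV phi_y zero[OF \<sigma>] by simp
  then have "transfer n \<nu> y = 0" by (simp add: transfer_def)
  then show "rep.act n ?c (perm_act n g w) = 0" using inj[OF \<nu> y] by (simp add: y_def)
qed

text \<open>The value 0 is what \<open>has_multiplicities\<close> demands where V(\<nu>)_n is
  undefined.\<close>

definition multiplicity :: "nat \<Rightarrow> nat list \<Rightarrow> nat" where
  "multiplicity n \<nu> = (if \<nu> \<in> admissible n then dim (young_part n \<nu>) else 0)"

lemma has_multiplicities_multiplicity: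
  "has_multiplicities n (fi_rep scale V F n) (\<lambda>\<nu>. enat (multiplicity n \<nu>))"
  unfolding fi_rep_eq
  by (rule rep.has_multiplicities_dim[OF finite_translates[OF fin, of "{1..n}"]])
     (simp_all add: gen multiplicity_def young_part_def zero_enat_def)

text \<open>Only the finitely many \<nu> with |\<nu>| \<le> d have a nonzero
  \<open>young_part\<close>, so the maximum of their thresholds is a uniform bound. Including d in
  the maximum provides the range needed by \<open>orbit_of_phi_spans\<close>.\<close>

lemma stable_range:
  "\<exists>N\<ge>d. (\<forall>n\<ge>N. \<forall>\<nu>. is_partition \<nu> \<longrightarrow> multiplicity n \<nu> = multiplicity N \<nu>) \<and>
     (\<forall>n\<ge>N. \<forall>\<nu>\<in>admissible n. \<forall>y\<in>young_part n \<nu>. transfer n \<nu> y = 0 \<longrightarrow> y = 0)"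
proof -
  let ?P = "{\<nu>. is_partition \<nu> \<and> sum_list \<nu> \<le> d}"
  have "\<forall>\<nu>. \<exists>N. is_partition \<nu> \<longrightarrow> \<nu> \<in> admissible N \<and>
    (\<forall>n\<ge>N. dim (young_part n \<nu>) = dim (young_part N \<nu>)) \<and>
    (\<forall>n\<ge>N. \<forall>y\<in>young_part n \<nu>. transfer n \<nu> y = 0 \<longrightarrow> y = 0)"
    using young_part_stabilizes by metis
  then obtain N where N: "\<And>\<nu>. is_partition \<nu> \<Longrightarrow> \<nu> \<in> admissible (N \<nu>)"
    "\<And>\<nu> n. is_partition \<nu> \<Longrightarrow> n \<ge> N \<nu> \<Longrightarrow> dim (young_part n \<nu>) = dim (young_part (N \<nu>) \<nu>)"
    "\<And>\<nu> n y. is_partition \<nu> \<Longrightarrow> n \<ge> N \<nu> \<Longrightarrow> y \<in> young_part n \<nu> \<Longrightarrow> transfer n \<nu> y = 0 \<Longrightarrow> y = 0"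
    by metis
  define M where "M = Max (insert d (N ` ?P))"
  have fin_max: "finite (insert d (N ` ?P))" using finite_partitions[of d] by simp
  have "d \<le> M" unfolding M_def by (rule Max_ge[OF fin_max]) simp
  have M: "N \<nu> \<le> M" if "is_partition \<nu>" "sum_list \<nu> \<le> d" for \<nu>
    unfolding M_def by (rule Max_ge[OF fin_max]) (use that in simp)
  have large: "young_part n \<nu> = {0}" if "\<nu> \<in> admissible n" "\<not> sum_list \<nu> \<le> d" for n \<nu>
    using that by (intro young_part_trivial[OF G gen deg]) simp_all
  have adm: "\<nu> \<in> admissible n" if "is_partition \<nu>" "sum_list \<nu> \<le> d" "n \<ge> M" for n \<nu>
    using N(1)[OF that(1)] M[OF that(1,2)] that(3) by (simp add: admissible_def)
  have 1: "multiplicity n \<nu> = multiplicity M \<nu>" if n: "n \<ge> M" and \<nu>: "is_partition \<nu>" for n \<nu>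
  proof (cases "sum_list \<nu> \<le> d")
    case True
    then show ?thesis
      using N(2)[OF \<nu>, of n] N(2)[OF \<nu>, of M] M[OF \<nu> True] n adm[OF \<nu> True]
      by (simp add: multiplicity_def)
  next
    case False
    then have "dim (young_part n \<nu>) = 0" if "\<nu> \<in> admissible n" for n
      using large[OF that] dim_le_card[of "{0}" "{}"] by simp
    then show ?thesis by (simp add: multiplicity_def)
  qed
  have 2: "y = 0" if n: "n \<ge> M" and \<nu>: "\<nu> \<in> admissible n"
    and y: "y \<in> young_part n \<nu>" "transfer n \<nu> y = 0" for n \<nu> y
  proof (cases "sum_list \<nu> \<le> d")
    case True
    have "is_partition \<nu>" using \<nu> by (simp add: admissible_def)
    then show ?thesis using N(3)[OF _ _ y] M[OF _ True] n by simp
  next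
    case False
    then show ?thesis using large[OF \<nu>] y by simp
  qed
  show ?thesis using \<open>d \<le> M\<close> 1 2 by blast
qed

text \<open>A generator of degree at most d \<le> n misses one of the n + 1 letters k, so its
  translate factors through \<open>skip n k\<close>, which is \<phi>_n up to a permutation.\<close>

lemma orbit_of_phi_spans:
  assumes n: "d \<le> n"
  shows "span {perm_act (Suc n) \<sigma> (fi_phi F n x) | \<sigma> x. \<sigma> permutes {1..Suc n} \<and> x \<in> V {1..n}}
    = V {1..Suc n}" (is "span ?X = _")
proof
  have "?X \<subseteq> V {1..Suc n}" by (auto intro: rep.action_closed fi_phi_closed)
  then show "span ?X \<subseteq> V {1..Suc n}" by (rule span_minimal[OF _ rep.subspace_W])
  have "translates G {1..Suc n} \<subseteq> ?X"
  proof
    fix w assume "w \<in> translates G {1..Suc n}"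
    then obtain m v f where mvf: "w = F {1..m} {1..Suc n} f v" "(m, v) \<in> G" "f \<in> fi_hom {1..m} {1..Suc n}"
      by (auto simp: translates_def)
    have v: "v \<in> V {1..m}" using G mvf(2) by blast
    have "card (f ` {1..m}) \<le> m" using card_image_le[of "{1..m}" f] by simp
    also have "m < card {1..Suc n}" using deg[OF mvf(2)] n by simp
    finally have "\<not> {1..Suc n} \<subseteq> f ` {1..m}"
      by (meson card_mono finite_atLeastAtMost finite_imageI leD)
    then obtain k where k: "k \<in> {1..Suc n}" "k \<notin> f ` {1..m}" by blast
    obtain x where x: "x \<in> V {1..n}" "w = F {1..n} {1..Suc n} (skip n k) x"
      unfolding mvf(1) by (rule factor_through_skip[OF mvf(3) k v])
    obtain \<sigma> where "\<sigma> permutes {1..Suc n}"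
      "\<And>x. x \<in> V {1..n} \<Longrightarrow> F {1..n} {1..Suc n} (skip n k) x = perm_act (Suc n) \<sigma> (fi_phi F n x)"
      by (rule skip_eq_perm_phi[OF k(1)]) blast
    then show "w \<in> ?X" using x by blast
  qed
  from span_mono[OF this] show "V {1..Suc n} \<subseteq> span ?X" using gen[of "{1..Suc n}"] by simp
qed

lemma generated_imp_stable:
  "uniformly_rep_stable (fi_rep scale V F) (fi_phi F) \<and>
   (\<exists>c. \<forall>\<^sub>F n in sequentially. has_multiplicities n (fi_rep scale V F n) (\<lambda>\<nu>. enat (c \<nu>)))"
proof -
  obtain N where "N \<ge> d"
    and const: "\<And>n \<nu>. n \<ge> N \<Longrightarrow> is_partition \<nu> \<Longrightarrow> multiplicity n \<nu> = multiplicity N \<nu>"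
    and inj: "\<And>n \<nu> y. n \<ge> N \<Longrightarrow> \<nu> \<in> admissible n \<Longrightarrow> y \<in> young_part n \<nu> \<Longrightarrow> transfer n \<nu> y = 0 \<Longrightarrow> y = 0"
    using stable_range by blast
  have inj_phi: "inj_on (fi_phi F n) (V {1..n})" if n: "n \<ge> N" for n
  proof (rule inj_onI)
    fix x y assume x: "x \<in> V {1..n}" and y: "y \<in> V {1..n}" and eq: "fi_phi F n x = fi_phi F n y"
    have neg: "scale (-1) y \<in> V {1..n}" by (rule subspace_scale[OF rep.subspace_W y])
    have "fi_phi F n (x + scale (-1) y) = 0"
      using eq unfolding fi_phi_eq_skip map_add[OF skip_hom x neg] map_scale[OF skip_hom y] by simp
    then have "x + scale (-1) y = 0"
      by (rule kernel_trivial[OF subspace_add[OF rep.subspace_W x neg] _ inj[OF n]])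
    then show "x = y" by simp
  qed
  have span_phi: "span {rep_act (fi_rep scale V F (Suc n)) \<sigma> (fi_phi F n x) | \<sigma> x.
      \<sigma> permutes {1..Suc n} \<and> x \<in> V {1..n}} = V {1..Suc n}" if "n \<ge> N" for n
    using orbit_of_phi_spans[of n] that \<open>N \<ge> d\<close> by (simp add: fi_rep_eq)
  have "uniformly_rep_stable (fi_rep scale V F) (fi_phi F)"
    unfolding uniformly_rep_stable_def
  proof (intro exI[of _ N] conjI allI impI exI[of _ "\<lambda>n \<nu>. enat (multiplicity n \<nu>)"]
      has_multiplicities_multiplicity)
    fix n assume n: "n \<ge> N"
    show "inj_on (fi_phi F n) (rep_carrier (fi_rep scale V F n))"
      using inj_phi[OF n] by (simp add: fi_rep_eq)
    show "module.span (rep_scale (fi_rep scale V F (Suc n)))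
        {rep_act (fi_rep scale V F (Suc n)) \<sigma> (fi_phi F n x) |\<sigma> x.
          \<sigma> permutes {1..Suc n} \<and> x \<in> rep_carrier (fi_rep scale V F n)}
      = rep_carrier (fi_rep scale V F (Suc n))"
      using span_phi[OF n] by (simp add: fi_rep_eq)
    show "enat (multiplicity n \<nu>) = enat (multiplicity N \<nu>)" if "is_partition \<nu>" for \<nu>
      using const[OF n that] by simp
  qed
  \<comment> \<open>The function at level N agrees with the one at level n on partitions, and only
    there are its values read.\<close>
  moreover have "has_multiplicities n (fi_rep scale V F n) (\<lambda>\<nu>. enat (multiplicity N \<nu>))" if n: "n \<ge> N" for n
  proof -
    have "enat (multiplicity N \<nu>) = enat (multiplicity n \<nu>)" if "is_partition \<nu>" for \<nu>
      using const[OF n that] by simp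
    then show ?thesis
      using has_multiplicities_multiplicity[of n] unfolding has_multiplicities_def admissible_def by auto
  qed
  then have "\<forall>\<^sub>F n in sequentially. has_multiplicities n (fi_rep scale V F n) (\<lambda>\<nu>. enat (multiplicity N \<nu>))"
    unfolding eventually_sequentially by blast
  ultimately show ?thesis by blast
qed

end

section \<open>The two implications\<close>

lemma finitely_generated_imp_stable:
  assumes "fi_finitely_generated scale V F"
  shows "uniformly_rep_stable (fi_rep scale V F) (fi_phi F)"
    "\<forall>n. rep_finite_dim (fi_rep scale V F n)"
    "\<exists>c. \<forall>\<^sub>F n in sequentially. has_multiplicities n (fi_rep scale V F n) (\<lambda>\<nu>. enat (c \<nu>))"
proof -
  obtain G where G: "finite G" "G \<subseteq> (SIGMA n:UNIV. V {1..n})"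
    "\<And>S. finite S \<Longrightarrow> span (translates G S) = V S"
    by (rule finitely_generated_spanE[OF assms]) blast
  have deg: "m \<le> Max (fst ` G)" if "(m, v) \<in> G" for m v
    using that G(1) by (intro Max_ge) force+
  show "uniformly_rep_stable (fi_rep scale V F) (fi_phi F)"
    "\<exists>c. \<forall>\<^sub>F n in sequentially. has_multiplicities n (fi_rep scale V F n) (\<lambda>\<nu>. enat (c \<nu>))"
    using generated_imp_stable[OF G(2,1,3) deg] by auto
  show "\<forall>n. rep_finite_dim (fi_rep scale V F n)"
  proof
    fix n
    show "rep_finite_dim (fi_rep scale V F n)"
      unfolding rep_finite_dim_def fi_rep_eq
      by (intro exI[of _ "translates G {1..n}"]) (simp add: finite_translates translates_subset G)
  qed
qed

text \<open>Bases in degrees up to N generate: the spanning condition reaches the later degrees by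
  induction, and a bijection from {1..|S|} reaches an arbitrary finite set S.\<close>

lemma stable_imp_finitely_generated:
  assumes stable: "uniformly_rep_stable (fi_rep scale V F) (fi_phi F)"
    and fd: "\<And>n. rep_finite_dim (fi_rep scale V F n)"
  shows "fi_finitely_generated scale V F"
proof -
  obtain N where span: "\<And>n. n \<ge> N \<Longrightarrow>
    span {perm_act (Suc n) \<sigma> (fi_phi F n x) | \<sigma> x. \<sigma> permutes {1..Suc n} \<and> x \<in> V {1..n}} = V {1..Suc n}"
    using stable unfolding uniformly_rep_stable_def fi_rep_eq by auto
  have "\<forall>n. \<exists>B. finite B \<and> B \<subseteq> V {1..n} \<and> span B = V {1..n}"
    using fd unfolding rep_finite_dim_def fi_rep_eq by simp
  then obtain B where B: "\<And>n. finite (B n)" "\<And>n. B n \<subseteq> V {1..n}" "\<And>n. span (B n) = V {1..n}"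
    by metis
  let ?G = "SIGMA n:{..N}. B n"
  have "U S = V S" if U: "fi_submodule scale V F U" and G: "\<forall>(n, v) \<in> ?G. v \<in> U {1..n}" and S: "finite S" for U S
  proof -
    have sub: "U S \<subseteq> V S" "subspace (U S)" if "finite S" for S
      using U that by (auto simp: fi_submodule_def)
    have closed: "F S T f x \<in> U T" if "f \<in> fi_hom S T" "x \<in> U S" for S T f x
      using U that by (auto simp: fi_submodule_def)
    have basis: "B n \<subseteq> U {1..n}" if "n \<le> N" for n
      using G that by auto
    have std: "V {1..n} \<subseteq> U {1..n}" for n
    proof (induction n rule: nat_induct)
      case (Suc n)
      show ?case
      proof (cases "Suc n \<le> N")
        case True
        then have "B (Suc n) \<subseteq> U {1..Suc n}" by (rule basis)
        then show ?thesis using span_minimal[OF _ sub(2)[OF finite_atLeastAtMost]] B(3) by metis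
      next
        case False
        have "{perm_act (Suc n) \<sigma> (fi_phi F n x) | \<sigma> x. \<sigma> permutes {1..Suc n} \<and> x \<in> V {1..n}} \<subseteq> U {1..Suc n}"
          using Suc unfolding perm_act_def fi_phi_eq_skip
          by (auto intro!: closed restrict_permutation_hom skip_hom)
        from span_minimal[OF this sub(2)[OF finite_atLeastAtMost]] show ?thesis
          using span[of n] False by simp
      qed
    next
      case 0
      show ?case using span_minimal[OF basis[of 0] sub(2)[OF finite_atLeastAtMost]] B(3) by simp
    qed
    obtain h where h: "bij_betw h {1..card S} S"
      using ex_bij_betw_nat_finite_1[OF S] by blast
    have f: "restrict h {1..card S} \<in> fi_hom {1..card S} S"
      using h S by (intro fi_homI) (auto simp: bij_betw_def)
    have g: "restrict (inv_into {1..card S} h) S \<in> fi_hom S {1..card S}"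
      using bij_betw_inv_into[OF h] S by (intro fi_homI) (auto simp: bij_betw_def)
    have "V S \<subseteq> U S"
    proof
      fix x assume x: "x \<in> V S"
      have "compose S (restrict h {1..card S}) (restrict (inv_into {1..card S} h) S) = (\<lambda>i\<in>S. i)"
        using bij_betw_inv_into_right[OF h] bij_betwE[OF bij_betw_inv_into[OF h]]
        by (auto simp: compose_def fun_eq_iff simp del: atLeastAtMost_iff)
      then have "x = F {1..card S} S (restrict h {1..card S}) (F S {1..card S} (restrict (inv_into {1..card S} h) S) x)"
        using map_comp[OF g f x] map_id[OF S x] by simp
      moreover have "F S {1..card S} (restrict (inv_into {1..card S} h) S) x \<in> U {1..card S}"
        using std map_closed[OF g x] by blast
      ultimately show "x \<in> U S" using closed[OF f] by metis
    qed
    then show ?thesis using sub(1)[OF S] by blast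
  qed
  then show ?thesis
    unfolding fi_finitely_generated_def
  proof (intro exI[of _ ?G] conjI allI impI)
    show "?G \<subseteq> (SIGMA n:UNIV. V {1..n})" using B(2) by blast
    show "finite ?G" using B(1) by simp
  qed auto
qed

end

theorem theorem1p13:
  fixes scale :: "'k::field_char_0 \<Rightarrow> 'v::ab_group_add \<Rightarrow> 'v"
    and V :: "nat set \<Rightarrow> 'v set"
    and F :: "nat set \<Rightarrow> nat set \<Rightarrow> (nat \<Rightarrow> nat) \<Rightarrow> 'v \<Rightarrow> 'v"
  assumes "fi_module scale V F"
  shows "(fi_finitely_generated scale V F \<longleftrightarrow>
            uniformly_rep_stable (fi_rep scale V F) (fi_phi F) \<and>
            (\<forall>n. rep_finite_dim (fi_rep scale V F n))) \<and>
         (fi_finitely_generated scale V F \<longrightarrow>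
            (\<exists>c :: nat list \<Rightarrow> nat. \<forall>\<^sub>F n in sequentially.
               has_multiplicities n (fi_rep scale V F n) (\<lambda>\<nu>. enat (c \<nu>))))"
proof -
  interpret fi_module_char_0 scale V F by (rule fi_module_char_0.intro[OF assms])
  show ?thesis
    using finitely_generated_imp_stable stable_imp_finitely_generated by blast
qed

end
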